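(* Let $W$ be a finite Coxeter group. Every flipclass $F$ of $W$ has the same number of increasing paths with respect to every reflection ordering of $W$.
   Context: Let $(W,S)$ be a Coxeter system with length function $\ell$ and reflections $T=\{wsw^{-1}\}$. The Bruhat graph has vertex set $W$ and edges $u\xrightarrow{t}v$ ($t\in T$) when $\ell(u)<\ell(v)$ and $vu^{-1}=t$; $P_h(u,v)$ is the set of length-$h$ paths from $u$ to $v$. For $u,v$, let $X(u,v)$ be the set of $x\notin\{u,v\}$ on some path of $P_2(u,v)$; there is a unique fixed-point-free involution $f$ of $X(u,v)$ such that $\ell(x_1)<\ell(x_2)$, $x_2\ne f(x_1)$ imply $\ell(f(x_1))<\ell(f(x_2))$; the flip of $(u\to x\to v)$ is $(u\to f(x)\to v)$. The $i$-th flip $f_i$ of a path $(x_0\to\cdots\to x_h)$ replaces $(x_{i-1}\to x_i\to x_{i+1})$ by its flip; an $h$-flipclass from $u$ to $v$ is a minimal nonempty subset of $P_h(u,v)$ closed under all $f_i$. A reflection ordering is a total order $\preceq$ on $T$ such that for every reflection subgroup $W'=\langle W'\cap T\rangle$ whose canonical Coxeter generating set $\chi(W')=\{t\in W'\cap T:\{r\in W'\cap T:\ell(rt)<\ell(t)\}=\{t\}\}$ is $\{a,b\}$, the reflections of $W'$ appear as $a\preceq aba\preceq ababa\preceq\cdots\preceq bab\preceq b$ or in the reverse order. A path with labels $t_1,\dots,t_h$ is increasing if $t_1\preceq\cdots\preceq t_h$. *)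

theory Defs
  imports "HOL-Algebra.Generated_Groups" "HOL-Algebra.Multiplicative_Group"
begin

(* Words over S are lists. The relators are (s t)^m(s,t) for s, t in S, where m(s,t) is the order
   of s t in G. Since group.ord is 0 for elements of infinite order, such pairs contribute only
   the empty relator. For s = t the order is 1, so s s is a relator; hence this monoid
   presentation defines the same group as the usual group presentation. *)

inductive word_cong :: "('a, 'b) monoid_scheme \<Rightarrow> 'a set \<Rightarrow> 'a list \<Rightarrow> 'a list \<Rightarrow> bool"
  for G (structure) and S where
  relator: "\<lbrakk>us \<in> lists S; vs \<in> lists S; s \<in> S; t \<in> S\<rbrakk> \<Longrightarrow>
    word_cong G S (us @ concat (replicate (group.ord G (s \<otimes> t)) [s, t]) @ vs) (us @ vs)"
| refl: "ws \<in> lists S \<Longrightarrow> word_cong G S ws ws"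
| sym: "word_cong G S us vs \<Longrightarrow> word_cong G S vs us"
| trans: "\<lbrakk>word_cong G S us vs; word_cong G S vs ws\<rbrakk> \<Longrightarrow> word_cong G S us ws"

locale coxeter_system = group G for G (structure) +
  fixes S :: "'a set"
  assumes S_closed: "S \<subseteq> carrier G"
    and generates: "generate G S = carrier G"
    and involutions: "s \<in> S \<Longrightarrow> ord s = 2"
    and presentation: "\<lbrakk>ws \<in> lists S; foldr (\<otimes>) ws \<one> = \<one>\<rbrakk> \<Longrightarrow> word_cong G S ws []"
begin

definition len :: "'a \<Rightarrow> nat" where
  "len w = (LEAST n. \<exists>ws\<in>lists S. length ws = n \<and> foldr (\<otimes>) ws \<one> = w)"

definition reflections :: "'a set" where
  "reflections = {w \<otimes> s \<otimes> inv w | w s. w \<in> carrier G \<and> s \<in> S}"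

definition bruhat_edge :: "'a \<Rightarrow> 'a \<Rightarrow> bool" where
  "bruhat_edge u v \<longleftrightarrow>
     u \<in> carrier G \<and> v \<in> carrier G \<and> len u < len v \<and> v \<otimes> inv u \<in> reflections"

(* A path is its list of vertices x_0, ..., x_h; the edge labels are determined by the vertices. *)

definition paths :: "nat \<Rightarrow> 'a \<Rightarrow> 'a \<Rightarrow> 'a list set" where
  "paths h u v = {p. length p = Suc h \<and> set p \<subseteq> carrier G \<and> p ! 0 = u \<and> p ! h = v \<and>
     (\<forall>i<h. bruhat_edge (p ! i) (p ! Suc i))}"

definition path_labels :: "'a list \<Rightarrow> 'a list" where
  "path_labels p = map (\<lambda>i. p ! Suc i \<otimes> inv (p ! i)) [0..<length p - 1]"

definition midpoints :: "'a \<Rightarrow> 'a \<Rightarrow> 'a set" where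
  "midpoints u v = {x. x \<notin> {u, v} \<and> (\<exists>p\<in>paths 2 u v. x \<in> set p)}"

(* Extensionality (\<rightarrow>\<^sub>E) fixes the value outside the midpoints, so that the involution
   is unique as a function on the whole type. *)

definition flip :: "'a \<Rightarrow> 'a \<Rightarrow> 'a \<Rightarrow> 'a" where
  "flip u v = (THE f. f \<in> midpoints u v \<rightarrow>\<^sub>E midpoints u v \<and>
     (\<forall>x\<in>midpoints u v. f x \<noteq> x \<and> f (f x) = x) \<and>
     (\<forall>x\<^sub>1\<in>midpoints u v. \<forall>x\<^sub>2\<in>midpoints u v.
        len x\<^sub>1 < len x\<^sub>2 \<and> x\<^sub>2 \<noteq> f x\<^sub>1 \<longrightarrow> len (f x\<^sub>1) < len (f x\<^sub>2)))"

definition path_flip :: "nat \<Rightarrow> 'a list \<Rightarrow> 'a list" where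
  "path_flip i p = p[i := flip (p ! (i - 1)) (p ! (i + 1)) (p ! i)]"

definition flip_closed :: "nat \<Rightarrow> 'a list set \<Rightarrow> bool" where
  "flip_closed h F \<longleftrightarrow> (\<forall>p\<in>F. \<forall>i. 1 \<le> i \<and> i < h \<longrightarrow> path_flip i p \<in> F)"

definition flipclass :: "nat \<Rightarrow> 'a \<Rightarrow> 'a \<Rightarrow> 'a list set \<Rightarrow> bool" where
  "flipclass h u v F \<longleftrightarrow> F \<noteq> {} \<and> F \<subseteq> paths h u v \<and> flip_closed h F \<and>
     (\<forall>F'. F' \<noteq> {} \<and> F' \<subseteq> F \<and> flip_closed h F' \<longrightarrow> F' = F)"

definition reflection_subgroup :: "'a set \<Rightarrow> bool" where
  "reflection_subgroup H \<longleftrightarrow> subgroup H G \<and> generate G (H \<inter> reflections) = H"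

definition canonical_gens :: "'a set \<Rightarrow> 'a set" where
  "canonical_gens H =
     {t \<in> H \<inter> reflections. {r \<in> H \<inter> reflections. len (r \<otimes> t) < len t} = {t}}"

(* alt a b 0 = a, alt a b 1 = a b a, alt a b 2 = a b a b a, ... *)

definition alt :: "'a \<Rightarrow> 'a \<Rightarrow> nat \<Rightarrow> 'a" where
  "alt a b i = (a \<otimes> b) [^] i \<otimes> a"

(* a \<le> aba \<le> ababa \<le> ... \<le> bab \<le> b with respect to the relation R. Let m be the order of a b.
   If 0 < m, this is a finite chain of length m and alt b a j = alt a b (m - 1 - j).
   If m = 0 (infinite order), it consists of the increasing sequence alt a b i followed by
   the decreasing sequence alt b a j. *)

definition dihedral_chain :: "('a \<times> 'a) set \<Rightarrow> 'a \<Rightarrow> 'a \<Rightarrow> bool" where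
  "dihedral_chain R a b \<longleftrightarrow> (let m = ord (a \<otimes> b) in
     (\<forall>i j. i \<le> j \<and> (m = 0 \<or> j < m) \<longrightarrow>
        (alt a b i, alt a b j) \<in> R \<and> (alt b a j, alt b a i) \<in> R) \<and>
     (\<forall>i j. m = 0 \<or> i + j < m \<longrightarrow> (alt a b i, alt b a j) \<in> R))"

(* The reverse of the chain from a to b is the chain from b to a. *)

definition reflection_ordering :: "('a \<times> 'a) set \<Rightarrow> bool" where
  "reflection_ordering R \<longleftrightarrow> linear_order_on reflections R \<and>
     (\<forall>H a b. reflection_subgroup H \<and> a \<noteq> b \<and> canonical_gens H = {a, b} \<longrightarrow>
        dihedral_chain R a b \<or> dihedral_chain R b a)"

definition increasing :: "('a \<times> 'a) set \<Rightarrow> 'a list \<Rightarrow> bool" where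
  "increasing R p \<longleftrightarrow> sorted_wrt (\<lambda>s t. (s, t) \<in> R) (path_labels p)"

end

end

(* In a finite Coxeter group a reflection ordering is the sequence s1, s1 s2 s1, s1 s2 s3 s2 s1, ...
   of a reduced word s1 s2 ... of the longest element, and any two such words are linked by braid
   moves. A braid move reverses one block of consecutive reflections in the ordering, consisting of
   the reflections in a conjugate D of a standard dihedral subgroup. Each coset D x carries the
   Bruhat graph of a dihedral group: it has exactly two elements on every level strictly between
   bottom and top, and the flip of a path inside the coset exchanges these two elements. The
   inversions in D of one of them form an initial segment of the block, those of the other one a
   final segment; since the label of an edge into x is an inversion of x and the label of an edge out
   of x is not, a path inside the coset is increasing at the first element and decreasing at the
   second one. Hence flipping all vertices whose two adjacent labels lie in D is an involution of the
   flipclass that exchanges the increasing paths for the two orderings. *)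

theory Submission
  imports Defs
begin

section \<open>Inversions\<close>

text \<open>\<open>flip u v\<close> is defined through all midpoints in the whole group, so an
  exchange inside a coset is a flip only if no midpoint lies outside the coset. This is the main
  obstacle: two distinct reflections with product in D must lie in D themselves. With roots this
  would be a statement about a plane; no root system is built here, and it is derived from lengths
  of reflections alone.

  The tool throughout is a cocycle rule: the inversion set of g h is the symmetric difference of
  that of g and the conjugate by g of that of h. It follows from the presentation, as each
  reflection occurs an even number of times in the reflection sequence of a relator.

  D is the conjugate of a standard subgroup W_{pq} by an element a of minimal length in a W_{pq}.
  Every vertex is a d z with d in W_{pq} and z minimal in W_{pq} z. Neither a nor z contributes
  inversions in D, so levels and edges of a coset can be read off from d.

  Flips change one vertex at a time; they can be combined because a flip inside a coset never alters
  which labels lie in D.\<close>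

lemma lists_take_drop: "ws \<in> lists A \<Longrightarrow> take i ws @ drop j ws \<in> lists A"
  by (auto dest: in_set_takeD in_set_dropD)

section \<open>Conjugation, words and reflection sequences\<close>

context group
begin

definition cj :: "'a \<Rightarrow> 'a \<Rightarrow> 'a" where
  "cj g x = g \<otimes> x \<otimes> inv g"

lemma inv_mult_cancel [simp]:
  assumes "x \<in> carrier G" "y \<in> carrier G"
  shows "x \<otimes> (inv x \<otimes> y) = y" "inv x \<otimes> (x \<otimes> y) = y"
  using assms by (simp_all flip: m_assoc)

lemma cj_closed [simp]: "g \<in> carrier G \<Longrightarrow> x \<in> carrier G \<Longrightarrow> cj g x \<in> carrier G"
  by (simp add: cj_def)

lemma cj_one [simp]: "x \<in> carrier G \<Longrightarrow> cj \<one> x = x"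
  by (simp add: cj_def)

lemma cj_cj [simp]:
  "g \<in> carrier G \<Longrightarrow> h \<in> carrier G \<Longrightarrow> x \<in> carrier G \<Longrightarrow> cj g (cj h x) = cj (g \<otimes> h) x"
  by (simp add: cj_def m_assoc inv_mult_group)

lemma cj_eq_one_iff [simp]: "g \<in> carrier G \<Longrightarrow> x \<in> carrier G \<Longrightarrow> cj g x = \<one> \<longleftrightarrow> x = \<one>"
  by (metis cj_cj cj_def cj_one inv_closed l_inv r_inv r_one one_closed)

lemma cj_mult:
  "g \<in> carrier G \<Longrightarrow> x \<in> carrier G \<Longrightarrow> y \<in> carrier G \<Longrightarrow> cj g (x \<otimes> y) = cj g x \<otimes> cj g y"
  by (simp add: cj_def m_assoc)

lemma cj_inv: "g \<in> carrier G \<Longrightarrow> x \<in> carrier G \<Longrightarrow> cj g (inv x) = inv (cj g x)"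
  by (simp add: cj_def m_assoc inv_mult_group)

lemma cj_cancel: "g \<in> carrier G \<Longrightarrow> x \<in> carrier G \<Longrightarrow> cj g x \<otimes> g = g \<otimes> x"
  by (simp add: cj_def m_assoc)

lemma cj_eq_iff:
  "g \<in> carrier G \<Longrightarrow> x \<in> carrier G \<Longrightarrow> y \<in> carrier G \<Longrightarrow> cj g x = y \<longleftrightarrow> x = cj (inv g) y"
  by auto

lemma inj_on_cj: "g \<in> carrier G \<Longrightarrow> inj_on (cj g) (carrier G)"
  by (rule inj_on_inverseI[where g = "cj (inv g)"]) simp

lemma count_list_map_cj:
  assumes "g \<in> carrier G" "t \<in> carrier G" "set xs \<subseteq> carrier G"
  shows "count_list (map (cj g) xs) t = count_list xs (cj (inv g) t)"
  using assms(3) by (induction xs) (use assms(1,2) in \<open>auto simp: cj_eq_iff\<close>)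

primrec altw :: "'a \<Rightarrow> 'a \<Rightarrow> nat \<Rightarrow> 'a list" where
  "altw p q 0 = []"
| "altw p q (Suc k) = p # altw q p k"

lemma length_altw [simp]: "length (altw p q k) = k"
  by (induction k arbitrary: p q) auto

lemma set_altw: "set (altw p q k) \<subseteq> {p, q}"
  by (induction k arbitrary: p q) auto

lemma concat_replicate_pair: "concat (replicate m [p, q]) = altw p q (2 * m)"
  by (induction m) auto

text \<open>For a word in involutions, the i-th entry is the reflection whose multiplication from
  the left deletes the i-th letter of the word, see \<open>delete_letter\<close>.\<close>

primrec refl_seq :: "'a list \<Rightarrow> 'a list" where
  "refl_seq [] = []"
| "refl_seq (s # ws) = s # map (cj s) (refl_seq ws)"

abbreviation wprod :: "'a list \<Rightarrow> 'a" where
  "wprod ws \<equiv> foldr (\<otimes>) ws \<one>"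

lemma length_refl_seq [simp]: "length (refl_seq ws) = length ws"
  by (induction ws) auto

lemma wprod_closed [simp]: "ws \<in> lists (carrier G) \<Longrightarrow> wprod ws \<in> carrier G"
  by (induction ws) auto

lemma wprod_append [simp]:
  "us \<in> lists (carrier G) \<Longrightarrow> vs \<in> lists (carrier G) \<Longrightarrow> wprod (us @ vs) = wprod us \<otimes> wprod vs"
  by (induction us) (auto simp: m_assoc simp del: foldr_append)

declare foldr_append [simp del]

lemma refl_seq_closed:
  "ws \<in> lists (carrier G) \<Longrightarrow> set (refl_seq ws) \<subseteq> carrier G"
  by (induction ws) auto

lemma map_cj_map_cj:
  "g \<in> carrier G \<Longrightarrow> h \<in> carrier G \<Longrightarrow> set xs \<subseteq> carrier G \<Longrightarrow>
    map (cj g) (map (cj h) xs) = map (cj (g \<otimes> h)) xs"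
  by (induction xs) auto

lemma refl_seq_append:
  assumes "us \<in> lists (carrier G)" "vs \<in> lists (carrier G)"
  shows "refl_seq (us @ vs) = refl_seq us @ map (cj (wprod us)) (refl_seq vs)"
  using assms(1)
proof (induction us)
  case Nil
  then show ?case using refl_seq_closed[OF assms(2)] by (auto intro!: map_idI[symmetric])
next
  case (Cons s us)
  then show ?case using refl_seq_closed[OF assms(2)] assms(2)
    by (auto simp: in_lists_conv_set)
qed

end

context coxeter_system
begin

lemma S_carrier [simp]: "s \<in> S \<Longrightarrow> s \<in> carrier G"
  using S_closed by auto

lemma S_lists: "ws \<in> lists S \<Longrightarrow> ws \<in> lists (carrier G)"
  using S_closed by auto

lemma S_sq [simp]: "s \<in> S \<Longrightarrow> s \<otimes> s = \<one>"
  using involutions[of s] pow_ord_eq_1[of s] by (simp add: numeral_2_eq_2)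

lemma S_ne_one: "s \<in> S \<Longrightarrow> s \<noteq> \<one>"
  using involutions[of s] by auto

lemma S_inv [simp]: "s \<in> S \<Longrightarrow> inv s = s"
  by (simp add: inv_equality)

lemma S_sq_cancel [simp]: "s \<in> S \<Longrightarrow> x \<in> carrier G \<Longrightarrow> s \<otimes> (s \<otimes> x) = x"
  by (simp flip: m_assoc)

lemma alt_closed [simp]: "a \<in> carrier G \<Longrightarrow> b \<in> carrier G \<Longrightarrow> alt a b i \<in> carrier G"
  by (simp add: alt_def)

lemma alt_0 [simp]: "a \<in> carrier G \<Longrightarrow> alt a b 0 = a"
  by (simp add: alt_def)

lemma pow_mult_swap:
  assumes "a \<in> carrier G" "b \<in> carrier G"
  shows "(a \<otimes> b) [^] (i::nat) \<otimes> a = a \<otimes> (b \<otimes> a) [^] i"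
proof (induction i)
  case (Suc i)
  have "(a \<otimes> b) [^] Suc i \<otimes> a = (a \<otimes> b) [^] i \<otimes> a \<otimes> (b \<otimes> a)"
    using assms by (simp add: m_assoc)
  then show ?case using Suc assms by (simp add: m_assoc)
qed (use assms in simp)

lemma cj_alt:
  assumes "a \<in> S" "b \<in> S"
  shows "cj a (alt b a i) = alt a b (Suc i)"
proof -
  have "alt a b (Suc i) = a \<otimes> (b \<otimes> a) [^] (Suc i)"
    unfolding alt_def using assms by (subst pow_mult_swap) simp_all
  also have "\<dots> = cj a (alt b a i)"
    using assms by (simp add: cj_def alt_def m_assoc)
  finally show ?thesis by simp
qed

lemma refl_seq_altw:
  assumes "p \<in> S" "q \<in> S"
  shows "refl_seq (altw p q k) = map (alt p q) [0..<k]"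
  using assms
proof (induction k arbitrary: p q)
  case (Suc k)
  have "refl_seq (altw p q (Suc k)) = p # map (\<lambda>i. alt p q (Suc i)) [0..<k]"
    using Suc by (simp add: cj_alt)
  also have "\<dots> = map (alt p q) [0..<Suc k]"
    using Suc by (simp add: upt_conv_Cons map_Suc_upt[symmetric] comp_def del: upt_Suc)
  finally show ?case .
qed simp

lemma altw_lists: "p \<in> S \<Longrightarrow> q \<in> S \<Longrightarrow> altw p q k \<in> lists S"
  by (induction k arbitrary: p q) auto

lemma wprod_altw_even:
  "p \<in> S \<Longrightarrow> q \<in> S \<Longrightarrow> wprod (altw p q (2 * m)) = (p \<otimes> q) [^] m"
proof (induction m)
  case (Suc m)
  have "(p \<otimes> q) \<otimes> (p \<otimes> q) [^] m = (p \<otimes> q) [^] Suc m"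
    using Suc.prems by (metis S_carrier m_closed nat_pow_Suc2)
  with Suc show ?case by (simp add: m_assoc)
qed simp

section \<open>Parity of reflection sequences under the relations\<close>

lemma alt_period:
  assumes "p \<in> S" "q \<in> S"
  shows "alt p q (ord (p \<otimes> q) + i) = alt p q i"
  using assms by (simp add: alt_def nat_pow_mult[symmetric])

text \<open>With m the order of \<open>p \<otimes> q\<close>, the sequence of the relator has 2 m
  entries and period m, so it is a list written twice.\<close>

lemma even_count_relator:
  assumes "p \<in> S" "q \<in> S"
  shows "even (count_list (refl_seq (altw p q (2 * ord (p \<otimes> q)))) t)"
proof -
  let ?m = "ord (p \<otimes> q)"
  have "map (alt p q) [0..<2 * ?m] = map (alt p q) ([0..<?m] @ map (\<lambda>i. ?m + i) [0..<?m])"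
    by (simp add: map_add_upt upt_add_eq_append[of 0 ?m ?m, simplified] mult_2 add.commute)
  also have "\<dots> = map (alt p q) [0..<?m] @ map (alt p q) [0..<?m]"
    using assms by (simp add: alt_period)
  finally show ?thesis using assms by (simp add: refl_seq_altw)
qed

text \<open>A relator has even length, product one, and contains every reflection an even number of
  times in its sequence. Product one ensures that the entries after it are conjugated in the same
  way with and without the relator.\<close>

lemma word_cong_invariant:
  assumes "word_cong G S us vs"
  shows "us \<in> lists S \<and> vs \<in> lists S \<and> wprod us = wprod vs \<and> (even (length us) \<longleftrightarrow> even (length vs)) \<and>
    (\<forall>t\<in>carrier G. even (count_list (refl_seq us) t) \<longleftrightarrow> even (count_list (refl_seq vs) t))"
  using assms
proof (induction rule: word_cong.induct)
  case (relator us vs s t)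
  let ?m = "ord (s \<otimes> t)"
  have L: "us \<in> lists (carrier G)" "vs \<in> lists (carrier G)" "altw s t (2 * ?m) \<in> lists (carrier G)"
    using relator S_lists altw_lists[of s t] by blast+
  have one: "wprod (altw s t (2 * ?m)) = \<one>"
    using relator by (simp add: wprod_altw_even)
  have U: "wprod us \<in> carrier G" using L by simp
  have one': "map (cj \<one>) (refl_seq vs) = refl_seq vs"
    using refl_seq_closed[OF L(2)] by (auto intro!: map_idI)
  have "refl_seq (us @ altw s t (2 * ?m) @ vs) = refl_seq us @
      map (cj (wprod us)) (refl_seq (altw s t (2 * ?m)) @ refl_seq vs)"
    using L one one' by (simp add: refl_seq_append append_in_lists_conv del: map_map)
  moreover have "even (count_list (map (cj (wprod us)) (refl_seq (altw s t (2 * ?m)))) x)"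
    if "x \<in> carrier G" for x
    using that U refl_seq_closed[OF L(3)] relator
    by (simp add: count_list_map_cj even_count_relator)
  ultimately show ?case
    unfolding concat_replicate_pair using L one relator altw_lists[of s t]
    by (simp add: append_in_lists_conv refl_seq_append[OF L(1,2)])
qed auto

definition inversions :: "'a \<Rightarrow> 'a set" where
  "inversions w = {t \<in> reflections. len (t \<otimes> w) < len w}"

lemma rev_word:
  "ws \<in> lists S \<Longrightarrow> wprod (rev ws) = inv (wprod ws)"
proof (induction ws)
  case (Cons s ws)
  then have "ws \<in> lists (carrier G)" "s \<in> S" using S_lists by auto
  moreover from this have "rev ws \<in> lists (carrier G)" by auto
  ultimately show ?case using Cons by (auto simp: inv_mult_group)
qed simp

text \<open>The presentation only speaks about words with product one. Both words are therefore
  followed by the reverse of \<open>vs\<close>, which contributes the same entries in both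
  cases.\<close>

lemma words_cong:
  assumes "us \<in> lists S" "vs \<in> lists S" "wprod us = wprod vs"
  shows "even (length us) \<longleftrightarrow> even (length vs)"
    and "t \<in> carrier G \<Longrightarrow> even (count_list (refl_seq us) t) \<longleftrightarrow> even (count_list (refl_seq vs) t)"
proof -
  have *: "even (length ws) \<longleftrightarrow> even (length vs)"
    "t \<in> carrier G \<Longrightarrow> even (count_list (refl_seq ws) t) \<longleftrightarrow>
      even (count_list (map (cj (wprod vs)) (refl_seq (rev vs))) t)"
    if ws: "ws \<in> lists S" "wprod ws = wprod vs" for ws
  proof -
    have L: "ws \<in> lists (carrier G)" "rev vs \<in> lists (carrier G)"
      using assms ws S_lists by auto
    have "wprod (ws @ rev vs) = \<one>"
      using L assms ws S_lists[of vs] by (simp add: rev_word)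
    moreover have "ws @ rev vs \<in> lists S" using assms ws by auto
    ultimately have "word_cong G S (ws @ rev vs) []" by (rule presentation[rotated])
    from word_cong_invariant[OF this]
    show "even (length ws) \<longleftrightarrow> even (length vs)"
      "t \<in> carrier G \<Longrightarrow> even (count_list (refl_seq ws) t) \<longleftrightarrow>
        even (count_list (map (cj (wprod vs)) (refl_seq (rev vs))) t)"
      using ws(2) L by (auto simp: refl_seq_append)
  qed
  show "even (length us) \<longleftrightarrow> even (length vs)"
    "t \<in> carrier G \<Longrightarrow> even (count_list (refl_seq us) t) \<longleftrightarrow> even (count_list (refl_seq vs) t)"
    using *[OF assms(1,3)] *[OF assms(2) HOL.refl] by auto
qed

lemma word_exists:
  assumes "w \<in> carrier G"
  obtains ws where "ws \<in> lists S" "wprod ws = w"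
proof -
  have "\<exists>ws\<in>lists S. wprod ws = w" if "w \<in> generate G S" for w
    using that
  proof (induction rule: generate.induct)
    case one
    then show ?case by (intro bexI[of _ "[]"]) auto
  next
    case (incl s)
    then show ?case by (intro bexI[of _ "[s]"]) auto
  next
    case (inv s)
    then show ?case by (intro bexI[of _ "[s]"]) auto
  next
    case (eng g h)
    then obtain us vs where "us \<in> lists S" "vs \<in> lists S" "wprod us = g" "wprod vs = h" by auto
    then show ?case using S_lists by (intro bexI[of _ "us @ vs"]) auto
  qed
  then show thesis using assms generates that by auto
qed

section \<open>Length and its parity\<close>

lemma reduced_word_exists:
  assumes "w \<in> carrier G"
  obtains ws where "ws \<in> lists S" "wprod ws = w" "length ws = len w"
proof -
  obtain us where us: "us \<in> lists S" "wprod us = w" by (rule word_exists[OF assms])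
  have "\<exists>ws\<in>lists S. length ws = len w \<and> wprod ws = w"
    unfolding len_def by (rule LeastI[where P = "\<lambda>n. \<exists>ws\<in>lists S. length ws = n \<and> wprod ws = w"]) (use us in auto)
  then show thesis using that by auto
qed

lemma len_le: "ws \<in> lists S \<Longrightarrow> len (wprod ws) \<le> length ws"
  unfolding len_def by (rule Least_le) auto

lemma len_one [simp]: "len \<one> = 0"
  using len_le[of "[]"] by simp

lemma len_eq_0_iff:
  assumes "w \<in> carrier G"
  shows "len w = 0 \<longleftrightarrow> w = \<one>"
proof -
  obtain ws where "ws \<in> lists S" "wprod ws = w" "length ws = len w"
    by (rule reduced_word_exists[OF assms])
  then show ?thesis by (cases ws) auto
qed

lemma len_mult_le: "g \<in> carrier G \<Longrightarrow> h \<in> carrier G \<Longrightarrow> len (g \<otimes> h) \<le> len g + len h"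
proof -
  assume "g \<in> carrier G" "h \<in> carrier G"
  then obtain us vs where "us \<in> lists S" "wprod us = g" "length us = len g"
    "vs \<in> lists S" "wprod vs = h" "length vs = len h" by (metis reduced_word_exists)
  then show ?thesis using len_le[of "us @ vs"] S_lists by auto
qed

lemma len_inv_le:
  assumes "g \<in> carrier G"
  shows "len (inv g) \<le> len g"
proof -
  obtain ws where "ws \<in> lists S" "wprod ws = g" "length ws = len g"
    by (rule reduced_word_exists[OF assms])
  moreover from this have "rev ws \<in> lists S" by auto
  ultimately show ?thesis using len_le[of "rev ws"] rev_word[of ws] by simp
qed

lemma len_inv [simp]: "g \<in> carrier G \<Longrightarrow> len (inv g) = len g"
  using len_inv_le[of g] len_inv_le[of "inv g"] by simp

lemma even_len_wprod:
  assumes "ws \<in> lists S"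
  shows "even (len (wprod ws)) \<longleftrightarrow> even (length ws)"
proof -
  obtain us where "us \<in> lists S" "wprod us = wprod ws" "length us = len (wprod ws)"
    by (rule reduced_word_exists[of "wprod ws"]) (use S_lists[OF assms] in auto)
  then show ?thesis using words_cong(1)[of us ws] assms by simp
qed

lemma even_len_mult:
  "g \<in> carrier G \<Longrightarrow> h \<in> carrier G \<Longrightarrow> even (len (g \<otimes> h)) \<longleftrightarrow> (even (len g) \<longleftrightarrow> even (len h))"
proof -
  assume "g \<in> carrier G" "h \<in> carrier G"
  then obtain us vs where "us \<in> lists S" "wprod us = g" "length us = len g"
    "vs \<in> lists S" "wprod vs = h" "length vs = len h" by (metis reduced_word_exists)
  then show ?thesis using even_len_wprod[of "us @ vs"] S_lists by auto
qed

lemma len_S [simp]: "s \<in> S \<Longrightarrow> len s = 1"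
  using len_le[of "[s]"] len_eq_0_iff[of s] S_ne_one[of s] by fastforce

section \<open>Reflections and the parity cocycle\<close>

lemma reflection_carrier [simp]: "t \<in> reflections \<Longrightarrow> t \<in> carrier G"
  by (auto simp: reflections_def)

lemma reflectionE:
  assumes "t \<in> reflections"
  obtains w s where "w \<in> carrier G" "s \<in> S" "t = cj w s"
  using assms unfolding reflections_def cj_def by blast

lemma cj_S_reflection [simp]: "w \<in> carrier G \<Longrightarrow> s \<in> S \<Longrightarrow> cj w s \<in> reflections"
  unfolding reflections_def cj_def by blast

lemma S_reflection [simp]: "s \<in> S \<Longrightarrow> s \<in> reflections"
  using cj_S_reflection[of \<one> s] by simp

lemma cj_reflection [simp]: "w \<in> carrier G \<Longrightarrow> t \<in> reflections \<Longrightarrow> cj w t \<in> reflections"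
  by (erule reflectionE) simp

lemma cj_reflection_iff [simp]:
  "w \<in> carrier G \<Longrightarrow> t \<in> carrier G \<Longrightarrow> cj w t \<in> reflections \<longleftrightarrow> t \<in> reflections"
  using cj_reflection[of "inv w" "cj w t"] by auto

lemma reflection_sq [simp]: "t \<in> reflections \<Longrightarrow> t \<otimes> t = \<one>"
  by (erule reflectionE) (simp add: cj_def m_assoc)

lemma reflection_inv [simp]: "t \<in> reflections \<Longrightarrow> inv t = t"
  by (simp add: inv_equality)

lemma reflection_sq_cancel [simp]: "t \<in> reflections \<Longrightarrow> x \<in> carrier G \<Longrightarrow> t \<otimes> (t \<otimes> x) = x"
  by (simp flip: m_assoc)

lemma odd_len_reflection: "t \<in> reflections \<Longrightarrow> odd (len t)"
  by (erule reflectionE) (simp add: cj_def even_len_mult)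

lemma set_refl_seq: "ws \<in> lists S \<Longrightarrow> set (refl_seq ws) \<subseteq> reflections"
  by (induction ws) auto

lemma delete_letter:
  assumes "ws \<in> lists S" "i < length ws"
  shows "refl_seq ws ! i \<otimes> wprod ws = wprod (take i ws @ drop (Suc i) ws)"
proof -
  define us s vs where "us = take i ws" and "s = ws ! i" and "vs = drop (Suc i) ws"
  have ws: "ws = us @ s # vs" "length us = i"
    using assms(2) by (auto simp: us_def s_def vs_def id_take_nth_drop)
  have L: "us \<in> lists (carrier G)" "s \<in> S" "vs \<in> lists (carrier G)" "s # vs \<in> lists (carrier G)"
    using assms(1) S_lists unfolding ws(1) by auto
  have "refl_seq ws ! i = cj (wprod us) s"
    unfolding ws(1) using L ws(2)
    by (simp add: refl_seq_append nth_append del: refl_seq.simps) simp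
  then show ?thesis using L ws by (simp add: cj_def m_assoc)
qed

text \<open>By \<open>words_cong\<close> the parity is the same for all words of \<open>w\<close>,
  so any word may be used to compute it, as in \<open>odd_refl_wprod\<close>.\<close>

definition odd_refl :: "'a \<Rightarrow> 'a \<Rightarrow> bool" where
  "odd_refl w t \<longleftrightarrow> (\<exists>ws\<in>lists S. wprod ws = w \<and> odd (count_list (refl_seq ws) t))"

lemma odd_refl_wprod:
  "ws \<in> lists S \<Longrightarrow> t \<in> carrier G \<Longrightarrow> odd_refl (wprod ws) t \<longleftrightarrow> odd (count_list (refl_seq ws) t)"
  unfolding odd_refl_def using words_cong(2) by metis

lemma odd_refl_mult:
  assumes "g \<in> carrier G" "h \<in> carrier G" "t \<in> carrier G"
  shows "odd_refl (g \<otimes> h) t \<longleftrightarrow> odd_refl g t \<noteq> odd_refl h (cj (inv g) t)"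
proof -
  obtain us vs where w: "us \<in> lists S" "wprod us = g" "vs \<in> lists S" "wprod vs = h"
    using assms by (metis word_exists)
  have L: "us \<in> lists (carrier G)" "vs \<in> lists (carrier G)" using w S_lists by auto
  show ?thesis
    using odd_refl_wprod[of us t] odd_refl_wprod[of vs "cj (inv g) t"] odd_refl_wprod[of "us @ vs" t]
      w L assms refl_seq_closed[OF L(2)]
    by (auto simp: refl_seq_append count_list_map_cj)
qed

lemma odd_refl_S: "s \<in> S \<Longrightarrow> t \<in> carrier G \<Longrightarrow> odd_refl s t \<longleftrightarrow> t = s"
  using odd_refl_wprod[of "[s]" t] by auto

lemma odd_refl_one: "t \<in> carrier G \<Longrightarrow> \<not> odd_refl \<one> t"
  using odd_refl_wprod[of "[]" t] by auto

text \<open>For \<open>t = w s w^-1\<close> the contributions of \<open>w\<close> and of its inverse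
  are equal and cancel; the middle letter \<open>s\<close> contributes one occurrence.\<close>

lemma odd_refl_self:
  assumes "t \<in> reflections"
  shows "odd_refl t t"
proof -
  obtain w s where t: "w \<in> carrier G" "s \<in> S" "t = cj w s"
    by (rule reflectionE[OF assms])
  have "odd_refl (w \<otimes> inv w) t \<longleftrightarrow> odd_refl w t \<noteq> odd_refl (inv w) (cj (inv w) t)"
    using t by (intro odd_refl_mult) auto
  then have 1: "odd_refl (inv w) s \<longleftrightarrow> odd_refl w t" using t by (auto simp: odd_refl_one)
  have "odd_refl (w \<otimes> (s \<otimes> inv w)) t \<longleftrightarrow> odd_refl w t \<noteq> odd_refl (s \<otimes> inv w) s"
    using t by (subst odd_refl_mult) auto
  also have "odd_refl (s \<otimes> inv w) s \<longleftrightarrow> \<not> odd_refl (inv w) s"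
    using t by (subst odd_refl_mult) (auto simp: odd_refl_S cj_def m_assoc)
  finally show ?thesis using 1 t by (simp add: cj_def m_assoc)
qed

lemma odd_refl_reflection: "odd_refl w t \<Longrightarrow> t \<in> reflections"
  unfolding odd_refl_def using set_refl_seq count_notin by fastforce

text \<open>This is the strong exchange condition: \<open>t\<close> occurs in the sequence of a
  reduced word, and multiplying by \<open>t\<close> deletes the corresponding letter.\<close>

lemma odd_refl_imp_less:
  assumes "w \<in> carrier G" "odd_refl w t"
  shows "len (t \<otimes> w) < len w"
proof -
  obtain ws where ws: "ws \<in> lists S" "wprod ws = w" "length ws = len w"
    by (rule reduced_word_exists[OF assms(1)])
  have "odd (count_list (refl_seq ws) t)"
    using assms(2) ws(1,2) odd_refl_wprod[OF ws(1), of t] odd_refl_reflection[OF assms(2)] by simp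
  then have "t \<in> set (refl_seq ws)" by (metis count_notin even_zero)
  then obtain i where i: "i < length ws" "refl_seq ws ! i = t"
    by (metis in_set_conv_nth length_refl_seq)
  have "take i ws @ drop (Suc i) ws \<in> lists S"
    using ws(1) by (rule lists_take_drop)
  from len_le[OF this] delete_letter[OF ws(1) i(1)] show ?thesis using i ws by auto
qed

text \<open>Parity and length define the same set: were \<open>t\<close> even for \<open>w\<close>,
  it would be odd for \<open>t \<otimes> w\<close>, and multiplying by \<open>t\<close> again would
  make \<open>w\<close> shorter than \<open>t \<otimes> w\<close>.\<close>

lemma inversions_odd_refl:
  assumes "w \<in> carrier G"
  shows "t \<in> inversions w \<longleftrightarrow> odd_refl w t"
proof
  assume t: "t \<in> inversions w"
  then have T: "t \<in> reflections" "len (t \<otimes> w) < len w" by (auto simp: inversions_def)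
  show "odd_refl w t"
  proof (rule ccontr)
    assume "\<not> odd_refl w t"
    then have "odd_refl (t \<otimes> w) t"
      using T assms by (subst odd_refl_mult) (auto simp: odd_refl_self cj_def)
    from odd_refl_imp_less[OF _ this] T assms show False by auto
  qed
next
  assume "odd_refl w t"
  then show "t \<in> inversions w"
    using odd_refl_imp_less[OF assms] odd_refl_reflection by (auto simp: inversions_def)
qed

text \<open>The cocycle rule; it takes the place of roots and their signs.\<close>

lemma inversions_mult:
  assumes "g \<in> carrier G" "h \<in> carrier G" "t \<in> carrier G"
  shows "t \<in> inversions (g \<otimes> h) \<longleftrightarrow> (t \<in> inversions g) \<noteq> (cj (inv g) t \<in> inversions h)"
  using assms by (simp add: inversions_odd_refl odd_refl_mult)

lemma inversions_reflections: "inversions w \<subseteq> reflections"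
  by (auto simp: inversions_def)

lemma inversions_S [simp]: "s \<in> S \<Longrightarrow> inversions s = {s}"
  by (auto simp: inversions_odd_refl odd_refl_S dest: odd_refl_reflection)
     (metis inversions_odd_refl inversions_reflections odd_refl_S S_carrier reflection_carrier subsetD)

lemma inversions_one [simp]: "inversions \<one> = {}"
  by (auto simp: inversions_def)

lemma inversions_self: "t \<in> reflections \<Longrightarrow> t \<in> inversions t"
  by (simp add: inversions_odd_refl odd_refl_self)

lemma inversions_inv:
  assumes "g \<in> carrier G" "t \<in> carrier G"
  shows "t \<in> inversions (inv g) \<longleftrightarrow> cj g t \<in> inversions g"
  using inversions_mult[of "inv g" g t] assms by simp

lemma inversions_wprod:
  assumes "ws \<in> lists S"
  shows "inversions (wprod ws) = {t. odd (count_list (refl_seq ws) t)}"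
proof (rule Set.set_eqI)
  fix t
  have "wprod ws \<in> carrier G" using assms S_lists by auto
  moreover have "odd (count_list (refl_seq ws) t) \<Longrightarrow> t \<in> carrier G"
    using set_refl_seq[OF assms] by (metis count_notin even_zero reflection_carrier subsetD)
  ultimately show "t \<in> inversions (wprod ws) \<longleftrightarrow> t \<in> {t. odd (count_list (refl_seq ws) t)}"
    using assms odd_refl_wprod inversions_odd_refl odd_refl_reflection by (metis mem_Collect_eq reflection_carrier)
qed

section \<open>Inversion sets and reduced words\<close>

lemma odd_count_list_distinct: "distinct xs \<Longrightarrow> odd (count_list xs t) \<longleftrightarrow> t \<in> set xs"
  by (induction xs) auto

lemma inversions_wprod_distinct:
  assumes "ws \<in> lists S" "distinct (refl_seq ws)"
  shows "inversions (wprod ws) = set (refl_seq ws)"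
  using assms by (simp add: inversions_wprod odd_count_list_distinct)

text \<open>A reflection occurring twice would allow the deletion of two letters without changing
  the product, because its square is one.\<close>

lemma reduced_distinct:
  assumes "ws \<in> lists S" "length ws = len (wprod ws)"
  shows "distinct (refl_seq ws)"
proof (rule ccontr)
  assume "\<not> distinct (refl_seq ws)"
  then obtain i j where ij: "i < j" "j < length ws" "refl_seq ws ! i = refl_seq ws ! j"
    by (auto simp: distinct_conv_nth) (metis linorder_neqE_nat)
  \<comment> \<open>The later letter is deleted first, which leaves the entries before position
    \<open>j\<close>, in particular entry \<open>i\<close>, unchanged.\<close>
  let ?ws = "take j ws @ drop (Suc j) ws" and ?t = "refl_seq ws ! i"
  have ws': "?ws \<in> lists S" using assms(1) by (rule lists_take_drop)
  have L: "take j ws \<in> lists (carrier G)" "drop j ws \<in> lists (carrier G)" "drop (Suc j) ws \<in> lists (carrier G)"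
    using S_lists[OF assms(1)] by (auto dest: in_set_takeD in_set_dropD)
  have "refl_seq ws = refl_seq (take j ws @ drop j ws)" by simp
  also have "\<dots> = refl_seq (take j ws) @ map (cj (wprod (take j ws))) (refl_seq (drop j ws))"
    using L(1,2) by (rule refl_seq_append)
  finally have "?t = refl_seq (take j ws) ! i" using ij by (simp add: nth_append)
  moreover have "refl_seq ?ws = refl_seq (take j ws) @ map (cj (wprod (take j ws))) (refl_seq (drop (Suc j) ws))"
    using L by (intro refl_seq_append) auto
  ultimately have t: "refl_seq ?ws ! i = ?t" using ij by (simp add: nth_append)
  have len: "length ?ws = length ws - 1" using ij by simp
  have "wprod (take i ?ws @ drop (Suc i) ?ws) = ?t \<otimes> wprod ?ws"
    using delete_letter[OF ws', of i] t ij len by simp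
  also have "wprod ?ws = ?t \<otimes> wprod ws"
    using delete_letter[OF assms(1), of j] ij by simp
  also have "?t \<otimes> (?t \<otimes> wprod ws) = wprod ws"
  proof -
    have "?t \<in> reflections" using set_refl_seq[OF assms(1)] ij by (metis length_refl_seq less_trans nth_mem subsetD)
    moreover have "wprod ws \<in> carrier G" using S_lists[OF assms(1)] by simp
    ultimately show ?thesis by simp
  qed
  finally have eq: "wprod (take i ?ws @ drop (Suc i) ?ws) = wprod ws" .
  have "take i ?ws @ drop (Suc i) ?ws \<in> lists S"
    using ws' by (rule lists_take_drop)
  from len_le[OF this] eq len ij assms(2) show False by simp
qed

lemma finite_inversions [simp]: "w \<in> carrier G \<Longrightarrow> finite (inversions w)"
  by (metis List.finite_set inversions_wprod_distinct reduced_distinct reduced_word_exists)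

lemma card_inversions: "w \<in> carrier G \<Longrightarrow> card (inversions w) = len w"
  by (metis distinct_card inversions_wprod_distinct length_refl_seq reduced_distinct reduced_word_exists)

lemma distinct_imp_reduced:
  assumes "ws \<in> lists S" "distinct (refl_seq ws)"
  shows "len (wprod ws) = length ws"
  using assms S_lists
  by (metis card_inversions distinct_card inversions_wprod_distinct length_refl_seq wprod_closed)

text \<open>By the cocycle rule \<open>inv g \<otimes> h\<close> has no inversions, so its length is
  zero.\<close>

lemma inversions_inj:
  assumes "g \<in> carrier G" "h \<in> carrier G" "inversions g = inversions h"
  shows "g = h"
proof -
  have "inversions (inv g \<otimes> h) = {}"
  proof -
    have "t \<notin> inversions (inv g \<otimes> h)" if "t \<in> reflections" for t
      using that assms by (auto simp: inversions_mult inversions_inv)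
    then show ?thesis using inversions_reflections by blast
  qed
  then have "inv g \<otimes> h = \<one>"
    using card_inversions[of "inv g \<otimes> h"] assms by (simp add: len_eq_0_iff)
  then have "inv (inv g) = h" using assms by (metis inv_equality inv_closed inv_inv)
  then show ?thesis using assms by simp
qed

text \<open>\<open>t\<close> is an inversion of itself, hence an entry \<open>u s u^-1\<close> of
  the sequence of the given word \<open>u s v\<close>. Comparison with \<open>t = u s v\<close>
  shows that \<open>v\<close> is the inverse of \<open>u\<close>, and as the word is reduced,
  \<open>s\<close> is its middle letter. That \<open>u\<close> is a prefix of the given word matters
  in \<open>cj_simple_shorter\<close>.\<close>

lemma palindrome:
  assumes "t \<in> reflections" "ws \<in> lists S" "wprod ws = t" "length ws = len t"
  obtains k s where "s \<in> S" "t = cj (wprod (take k ws)) s" "len t = 2 * k + 1"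
    "len (wprod (take k ws)) = k"
proof -
  have "distinct (refl_seq ws)" using assms by (simp add: reduced_distinct)
  then have "t \<in> set (refl_seq ws)"
    using inversions_wprod_distinct assms inversions_self by blast
  then obtain i where i: "i < length ws" "refl_seq ws ! i = t"
    by (metis in_set_conv_nth length_refl_seq)
  define us s vs where "us = take i ws" and "s = ws ! i" and "vs = drop (Suc i) ws"
  have ws: "ws = us @ s # vs" "length us = i"
    using i(1) by (auto simp: us_def s_def vs_def id_take_nth_drop)
  have S: "us \<in> lists S" "s \<in> S" "vs \<in> lists S" using assms(2) unfolding ws(1) by auto
  have L: "us \<in> lists (carrier G)" "s \<in> carrier G" "vs \<in> lists (carrier G)" "s # vs \<in> lists (carrier G)"
    using S S_lists by auto
  have tcj: "t = cj (wprod us) s"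
    using i(2) unfolding ws(1) using L ws(2)
    by (simp add: refl_seq_append nth_append del: refl_seq.simps) simp
  have tprod: "t = wprod us \<otimes> (s \<otimes> wprod vs)" using assms(3) L unfolding ws(1) by simp
  have "wprod us \<otimes> (s \<otimes> wprod vs) = wprod us \<otimes> (s \<otimes> inv (wprod us))"
    using tcj tprod L by (simp add: cj_def m_assoc)
  then have "wprod vs = inv (wprod us)" using L by simp
  then have leneq: "len (wprod vs) = len (wprod us)" using L by simp
  have le: "len (wprod us) \<le> length us" "len (wprod vs) \<le> length vs" using S len_le by auto
  have "len t \<le> len (wprod us) + (1 + len (wprod vs))"
    unfolding tprod using L S len_mult_le[of "wprod us" "s \<otimes> wprod vs"] len_mult_le[of s "wprod vs"]
    by auto
  moreover have "len t = length us + 1 + length vs" using assms(4) ws by simp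
  ultimately have eq: "len (wprod us) = i" "len t = 2 * i + 1" using le leneq ws(2) by auto
  show thesis using that[of s i] tcj eq S(2) unfolding us_def by blast
qed

lemma len_cj_le: "w \<in> carrier G \<Longrightarrow> s \<in> S \<Longrightarrow> len (cj w s) \<le> 2 * len w + 1"
  using len_mult_le[of "w \<otimes> s" "inv w"] len_mult_le[of w s] by (simp add: cj_def)

lemma reflection_half:
  assumes "t \<in> reflections"
  obtains w s where "w \<in> carrier G" "s \<in> S" "t = cj w s" "len t = 2 * len w + 1"
proof -
  obtain ws where ws: "ws \<in> lists S" "wprod ws = t" "length ws = len t"
    by (rule reduced_word_exists[of t]) (use assms in auto)
  obtain k s where k: "s \<in> S" "t = cj (wprod (take k ws)) s" "len t = 2 * k + 1"
    "len (wprod (take k ws)) = k"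
    using palindrome[OF assms ws] by blast
  have "take k ws \<in> lists (carrier G)" using S_lists[OF ws(1)] by (auto dest: in_set_takeD)
  then show thesis using that[of "wprod (take k ws)" s] k by simp
qed

lemma inversions_reflection:
  assumes "w \<in> carrier G" "t \<in> reflections" "r \<in> reflections"
  shows "r \<in> inversions (cj w t) \<longleftrightarrow>
    ((r \<in> inversions w) \<noteq> (cj (inv w) r \<in> inversions t)) \<noteq> (cj (cj w t) r \<in> inversions w)"
proof -
  have "cj w t = w \<otimes> (t \<otimes> inv w)" using assms by (simp add: cj_def m_assoc)
  moreover have "cj (inv t) (cj (inv w) r) \<in> inversions (inv w) \<longleftrightarrow> cj (cj w t) r \<in> inversions w"
    using assms by (simp add: inversions_inv) (simp add: cj_def m_assoc)
  ultimately show ?thesis using assms by (auto simp: inversions_mult)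
qed

text \<open>Write \<open>t = w s w^-1\<close> as in \<open>reflection_half\<close>. The cocycle rule
  makes \<open>r\<close> or \<open>t r t\<close> an inversion \<open>x\<close> of \<open>w\<close>,
  and conjugating \<open>t\<close> by \<open>x\<close> replaces \<open>w\<close> by the shorter
  \<open>x w\<close>.\<close>

lemma cj_shorter:
  assumes "t \<in> reflections" "r \<in> inversions t" "r \<noteq> t"
  shows "len (cj r t) < len t \<or> len (cj (cj t r) t) < len t"
proof -
  obtain w s where w: "w \<in> carrier G" "s \<in> S" "t = cj w s" "len t = 2 * len w + 1"
    using reflection_half[OF assms(1)] .
  have r: "r \<in> reflections" using assms(2) inversions_reflections by auto
  have short: "len (cj x t) < len t" if "x \<in> inversions w" for x
  proof -
    have x: "x \<in> reflections" "len (x \<otimes> w) < len w" using that by (auto simp: inversions_def)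
    have "len (cj (x \<otimes> w) s) \<le> 2 * len (x \<otimes> w) + 1" using x w by (intro len_cj_le) auto
    then show ?thesis using w x by simp
  qed
  have "cj (inv w) r \<noteq> s" using assms(3) w r by (auto simp: cj_eq_iff)
  then have "r \<in> inversions w \<or> cj t r \<in> inversions w"
    using inversions_reflection[of w s r] w r assms(2) by auto
  then show ?thesis using short by blast
qed

lemma descent_word:
  assumes "w \<in> carrier G" "s \<in> S" "s \<in> inversions w"
  obtains ws where "s # ws \<in> lists S" "wprod (s # ws) = w" "length (s # ws) = len w"
proof -
  obtain ws where ws: "ws \<in> lists S" "wprod ws = s \<otimes> w" "length ws = len (s \<otimes> w)"
    by (rule reduced_word_exists[of "s \<otimes> w"]) (use assms in auto)
  have lt: "len (s \<otimes> w) < len w" using assms(3) by (simp add: inversions_def)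
  have "wprod (s # ws) = w" using ws assms by simp
  moreover have "s # ws \<in> lists S" using ws assms by auto
  moreover have "len w \<le> length (s # ws)" using len_le calculation by metis
  ultimately show thesis using that[of ws] ws lt by simp
qed

text \<open>For simple \<open>s\<close> the choice left open by \<open>cj_shorter\<close> is
  settled: \<open>t\<close> has a reduced word starting with \<open>s\<close>, so
  \<open>palindrome\<close> yields \<open>t = u r u^-1\<close> with \<open>u\<close> starting with
  \<open>s\<close>, and conjugation by \<open>s\<close> removes this letter from
  \<open>u\<close>.\<close>

lemma cj_simple_shorter:
  assumes "t \<in> reflections" "s \<in> S" "s \<in> inversions t" "s \<noteq> t"
  shows "len (cj s t) < len t"
proof -
  obtain ws where ws: "s # ws \<in> lists S" "wprod (s # ws) = t" "length (s # ws) = len t"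
    by (rule descent_word[of t s]) (use assms in auto)
  obtain k r where k: "r \<in> S" "t = cj (wprod (take k (s # ws))) r" "len t = 2 * k + 1"
    using palindrome[OF assms(1) ws] by blast
  \<comment> \<open>If the middle letter were the first one, \<open>t\<close> would be simple and
    have itself as its only inversion.\<close>
  have "k \<noteq> 0"
  proof
    assume "k = 0"
    then have "t = r" using k by simp
    then show False using assms(3,4) k(1) by simp
  qed
  then obtain j where j: "k = Suc j" by (metis not0_implies_Suc)
  let ?w = "wprod (take j ws)"
  have tl: "take j ws \<in> lists S" using ws(1) by (auto dest: in_set_takeD)
  then have w: "?w \<in> carrier G" by (simp add: S_lists)
  have "t = cj (s \<otimes> ?w) r" using k(2) j by simp
  then have "cj s t = cj ?w r" using w assms(2) k(1) by simp
  moreover have "len (cj ?w r) \<le> 2 * len ?w + 1" using w k(1) by (rule len_cj_le)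
  moreover have "len ?w \<le> j" using len_le[OF tl] by simp
  ultimately show ?thesis using k(3) j by simp
qed

end

section \<open>Standard dihedral subgroups\<close>

context group
begin

definition aw :: "'a \<Rightarrow> 'a \<Rightarrow> nat \<Rightarrow> 'a" where
  "aw p q k = wprod (altw p q k)"

text \<open>The subgroup generated by \<open>p\<close> and \<open>q\<close>, see
  \<open>generate_dih\<close>, given by explicit elements so that each comes with an alternating
  word of known length. For distinct simple \<open>p\<close> and \<open>q\<close> the two families
  meet at the identity and at the longest element.\<close>

definition dih :: "'a \<Rightarrow> 'a \<Rightarrow> 'a set" where
  "dih p q = {aw p q k | k. k \<le> ord (p \<otimes> q)} \<union> {aw q p k | k. k \<le> ord (p \<otimes> q)}"

end

locale finite_coxeter_system = coxeter_system +
  assumes finite_G: "finite (carrier G)"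

locale dihedral = finite_coxeter_system +
  fixes p q
  assumes pS [simp]: "p \<in> S" and qS [simp]: "q \<in> S" and p_neq_q: "p \<noteq> q"

text \<open>Every fact about \<open>p\<close> and \<open>q\<close> becomes available with exchanged
  roles; \<open>ord_swap\<close> and \<open>dih_swap\<close> translate the order and the subgroup
  back.\<close>

sublocale dihedral \<subseteq> swap: dihedral G S q p
  using p_neq_q by unfold_locales auto

lemma (in finite_coxeter_system) dihedralI: "p \<in> S \<Longrightarrow> q \<in> S \<Longrightarrow> p \<noteq> q \<Longrightarrow> dihedral G S p q"
  by unfold_locales

abbreviation (in dihedral) m where "m \<equiv> ord (p \<otimes> q)"

lemma (in dihedral) ord_swap: "ord (q \<otimes> p) = m"
  using ord_inv[of "p \<otimes> q"] by (simp add: inv_mult_group)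

lemma (in dihedral) dih_swap: "dih q p = dih p q"
  unfolding dih_def ord_swap by auto

lemma (in dihedral) m_ge_2: "2 \<le> m"
proof -
  have "m \<ge> 1" using ord_ge_1[OF finite_G, of "p \<otimes> q"] by simp
  moreover have "m \<noteq> 1"
  proof
    assume "m = 1"
    then have "p \<otimes> q = \<one>" using ord_eq_1[of "p \<otimes> q"] by simp
    then have "inv q = p" by (intro inv_equality) auto
    then show False using p_neq_q by simp
  qed
  ultimately show ?thesis by simp
qed

lemma (in dihedral) aw_0 [simp]: "aw p q 0 = \<one>"
  by (simp add: aw_def)

lemma (in dihedral) aw_Suc: "aw p q (Suc k) = p \<otimes> aw q p k"
  by (simp add: aw_def)

lemma (in dihedral) aw_1 [simp]: "aw p q (Suc 0) = p"
  by (simp add: aw_def)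

lemma (in dihedral) aw_closed [simp]: "aw p q k \<in> carrier G"
  unfolding aw_def by (intro wprod_closed S_lists altw_lists) auto

lemma (in dihedral) p_aw_Suc: "p \<otimes> aw p q (Suc k) = aw q p k"
  by (simp add: aw_Suc swap.aw_closed)

lemma (in dihedral) aw_add:
  "aw p q (i + j) = aw p q i \<otimes> aw (if even i then p else q) (if even i then q else p) j \<and>
   aw q p (i + j) = aw q p i \<otimes> aw (if even i then q else p) (if even i then p else q) j"
  by (induction i) (auto simp: aw_Suc swap.aw_Suc m_assoc swap.aw_closed)

lemma (in dihedral) inv_aw:
  "inv (aw p q k) = (if even k then aw q p k else aw p q k) \<and>
   inv (aw q p k) = (if even k then aw p q k else aw q p k)"
proof (induction k)
  case (Suc k)
  have "aw p q (k + 1) = aw p q k \<otimes> (if even k then p else q)"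
    "aw q p (k + 1) = aw q p k \<otimes> (if even k then q else p)"
    using aw_add[of k 1] by auto
  with Suc show ?case by (auto simp: aw_Suc swap.aw_Suc inv_mult_group swap.aw_closed)
qed simp

lemma (in dihedral) aw_double_m [simp]: "aw p q (2 * m) = \<one>"
  unfolding aw_def by (simp add: wprod_altw_even)

text \<open>The alternating word of length \<open>2 * m\<close> has product one; cut after
  \<open>2 * m - k\<close> letters, its first part is the inverse of the remaining \<open>k\<close>
  letters.\<close>

lemma (in dihedral) aw_reflect:
  assumes "k \<le> 2 * m"
  shows "aw p q (2 * m - k) = aw q p k"
proof -
  have "aw p q (2 * m - k) \<otimes> inv (aw q p k) = \<one>"
    using aw_add[of "2 * m - k" k] assms inv_aw[of k] by (auto split: if_splits)
  then show ?thesis using inv_equality[of "aw p q (2 * m - k)" "inv (aw q p k)"]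
    by (simp add: swap.aw_closed)
qed

lemma (in dihedral) aw_m: "aw p q m = aw q p m"
  using aw_reflect[of m] by simp

lemma (in dihedral) alt_aw: "alt p q i = aw p q (2 * i + 1)"
  using aw_add[of "2 * i" 1] by (simp add: alt_def) (simp add: aw_def wprod_altw_even)

lemma (in dihedral) alt_reflect:
  assumes "i < m"
  shows "alt q p i = alt p q (m - 1 - i)"
proof -
  have "2 * (m - 1 - i) + 1 = 2 * m - (2 * i + 1)" using assms by simp
  then show ?thesis unfolding alt_aw swap.alt_aw using aw_reflect[of "2 * i + 1"] assms by simp
qed

lemma (in dihedral) inj_on_alt: "inj_on (alt p q) {..<m}"
proof (rule inj_onI)
  fix i j assume ij: "i \<in> {..<m}" "j \<in> {..<m}" "alt p q i = alt p q j"
  then have "(p \<otimes> q) [^] i = (p \<otimes> q) [^] j" by (simp add: alt_def)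
  moreover have "inj_on (\<lambda>x. (p \<otimes> q) [^] x) {0 .. m - 1}" by (intro ord_inj) auto
  ultimately show "i = j" using ij by (auto dest!: inj_onD)
qed

lemma (in dihedral) refl_seq_distinct: "k \<le> m \<Longrightarrow> distinct (refl_seq (altw p q k))"
  using inj_on_alt by (auto simp: refl_seq_altw distinct_map intro: inj_on_subset)

text \<open>The source of the initial and final segments: inversions of words beginning with
  \<open>p\<close> are cut off from one end of the chain of reflections, those of words beginning
  with \<open>q\<close> from the other end, by \<open>alt_reflect\<close>.\<close>

lemma (in dihedral) inversions_aw: "k \<le> m \<Longrightarrow> inversions (aw p q k) = alt p q ` {..<k}"
  unfolding aw_def using inversions_wprod_distinct[OF altw_lists refl_seq_distinct]
  by (simp add: refl_seq_altw atLeast0LessThan)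

lemma (in dihedral) len_aw: "k \<le> m \<Longrightarrow> len (aw p q k) = k"
  unfolding aw_def using distinct_imp_reduced[OF altw_lists refl_seq_distinct] by simp

lemma (in dihedral) dih_cases:
  assumes "d \<in> dih p q"
  obtains k where "k \<le> m" "d = aw p q k" | k where "k \<le> m" "d = aw q p k"
  using assms unfolding dih_def by blast

lemma (in dihedral) aw_in_dih: "k \<le> m \<Longrightarrow> aw p q k \<in> dih p q"
  unfolding dih_def by blast

lemma (in dihedral) dih_closed: "d \<in> dih p q \<Longrightarrow> d \<in> carrier G"
  by (erule dih_cases) (auto simp: swap.aw_closed)

lemma (in dihedral) p_mult_dih: "d \<in> dih p q \<Longrightarrow> p \<otimes> d \<in> dih p q"
proof (erule dih_cases)
  have *: "p \<otimes> aw p q k \<in> dih p q" if "0 < k" "k \<le> m" for k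
    using that swap.aw_in_dih[of "k - 1"] p_aw_Suc[of "k - 1"] by (simp add: dih_swap ord_swap)
  show "p \<otimes> d \<in> dih p q" if k: "k \<le> m" "d = aw p q k" for k
    using * k aw_in_dih[of 1] m_ge_2 by (cases "k = 0") auto
  show "p \<otimes> d \<in> dih p q" if k: "k \<le> m" "d = aw q p k" for k
  \<comment> \<open>At \<open>k = m\<close> the word cannot be lengthened by \<open>p\<close>; there
    \<open>aw_m\<close> rewrites it as a word beginning with \<open>p\<close>.\<close>
  proof (cases "k = m")
    case True
    then show ?thesis using *[of m] m_ge_2 k aw_m by simp
  next
    case False
    then show ?thesis using aw_in_dih[of "Suc k"] k by (simp add: aw_Suc)
  qed
qed

lemma (in dihedral) generate_dih: "generate G {p, q} = dih p q"
proof
  have "wprod ws \<in> dih p q" if "ws \<in> lists {p, q}" for ws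
    using that
  proof (induction ws)
    case Nil
    then show ?case using aw_in_dih[of 0] by simp
  next
    case (Cons s ws)
    then show ?case using p_mult_dih swap.p_mult_dih by (auto simp: dih_swap)
  qed
  moreover have "\<exists>ws\<in>lists {p, q}. wprod ws = g" if "g \<in> generate G {p, q}" for g
    using that
  proof (induction rule: generate.induct)
    case one
    then show ?case by (intro bexI[of _ "[]"]) auto
  next
    case (incl s)
    then show ?case by (intro bexI[of _ "[s]"]) auto
  next
    case (inv s)
    then show ?case by (intro bexI[of _ "[s]"]) auto
  next
    case (eng g h)
    then obtain us vs where uv: "us \<in> lists {p, q}" "vs \<in> lists {p, q}" "wprod us = g" "wprod vs = h"
      by auto
    moreover have "lists {p, q} \<subseteq> lists (carrier G)" by (intro lists_mono) auto
    ultimately have "us \<in> lists (carrier G)" "vs \<in> lists (carrier G)" by blast+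
    then show ?case using uv by (intro bexI[of _ "us @ vs"]) auto
  qed
  ultimately show "generate G {p, q} \<subseteq> dih p q" by blast
  have gen: "subgroup (generate G {p, q}) G" by (intro generate_is_subgroup) auto
  then have "wprod ws \<in> generate G {p, q}" if "ws \<in> lists {p, q}" for ws
    using that by (induction ws) (auto intro: subgroup.m_closed subgroup.one_closed generate.incl)
  moreover have "altw p q k \<in> lists {p, q}" "altw q p k \<in> lists {p, q}" for k
    using set_altw[of p q k] set_altw[of q p k] by auto
  ultimately show "dih p q \<subseteq> generate G {p, q}" unfolding dih_def aw_def by blast
qed

lemma (in dihedral) subgroup_dih: "subgroup (dih p q) G"
  unfolding generate_dih[symmetric] by (intro generate_is_subgroup) auto

lemma (in dihedral) dih_mult [simp]: "x \<in> dih p q \<Longrightarrow> y \<in> dih p q \<Longrightarrow> x \<otimes> y \<in> dih p q"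
  using subgroup_dih by (rule subgroup.m_closed)

lemma (in dihedral) dih_inv [simp]: "x \<in> dih p q \<Longrightarrow> inv x \<in> dih p q"
  using subgroup_dih by (rule subgroup.m_inv_closed)

lemma (in dihedral) one_in_dih [simp]: "\<one> \<in> dih p q"
  using subgroup_dih by (rule subgroup.one_closed)

lemma (in dihedral) dih_mult_iff:
  assumes "x \<in> dih p q" "y \<in> carrier G"
  shows "x \<otimes> y \<in> dih p q \<longleftrightarrow> y \<in> dih p q" "y \<otimes> x \<in> dih p q \<longleftrightarrow> y \<in> dih p q"
proof -
  have x: "x \<in> carrier G" using assms dih_closed by simp
  have "y = inv x \<otimes> (x \<otimes> y)" "y = (y \<otimes> x) \<otimes> inv x" using assms x by (simp_all add: m_assoc)
  then show "x \<otimes> y \<in> dih p q \<longleftrightarrow> y \<in> dih p q" "y \<otimes> x \<in> dih p q \<longleftrightarrow> y \<in> dih p q"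
    using assms(1) by (metis dih_mult dih_inv)+
qed

lemma (in dihedral) cj_dih_iff: "x \<in> dih p q \<Longrightarrow> y \<in> carrier G \<Longrightarrow> cj x y \<in> dih p q \<longleftrightarrow> y \<in> dih p q"
  using dih_closed by (simp add: cj_def dih_mult_iff)

lemma (in dihedral) p_in_dih [simp]: "p \<in> dih p q"
  using aw_in_dih[of 1] m_ge_2 by simp

lemma (in dihedral) q_in_dih [simp]: "q \<in> dih p q"
  using swap.p_in_dih by (simp add: dih_swap)

lemma (in dihedral) alt_in_dih: "alt p q i \<in> dih p q"
proof (induction i)
  case (Suc i)
  have "alt p q (Suc i) = (p \<otimes> q) \<otimes> alt p q i"
    using nat_pow_Suc2[of "p \<otimes> q" i] by (simp add: alt_def m_assoc del: nat_pow_Suc)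
  with Suc show ?case by (simp add: dih_mult_iff dih_closed)
qed simp

lemma (in dihedral) dih_len_le: "d \<in> dih p q \<Longrightarrow> len d \<le> m"
  by (erule dih_cases) (auto simp: len_aw swap.len_aw ord_swap)

lemma (in dihedral) dih_aw_len:
  assumes "d \<in> dih p q"
  shows "d = aw p q (len d) \<or> d = aw q p (len d)"
  using assms by (rule dih_cases) (auto simp: len_aw swap.len_aw ord_swap)

lemma (in dihedral) alt_reflection: "alt p q i \<in> reflections"
proof -
  have "alt p q i \<in> reflections \<and> alt q p i \<in> reflections"
  proof (induction i)
    case (Suc i)
    then show ?case using cj_alt[of p q i] cj_alt[of q p i] by (metis cj_reflection S_carrier pS qS)
  qed simp
  then show ?thesis ..
qed

lemma (in dihedral) dih_odd_reflection:
  assumes "d \<in> dih p q" "odd (len d)"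
  shows "\<exists>i<m. d = alt p q i"
  using assms(1)
proof (rule dih_cases)
  fix k assume k: "k \<le> m" "d = aw p q k"
  then have "odd k" using assms(2) len_aw by simp
  then obtain i where "k = 2 * i + 1" by (rule oddE)
  then show ?thesis using k alt_aw[of i] by (intro exI[of _ i]) auto
next
  fix k assume k: "k \<le> m" "d = aw q p k"
  then have "odd k" using assms(2) swap.len_aw by (simp add: ord_swap)
  then obtain i where i: "k = 2 * i + 1" by (rule oddE)
  then have "d = alt p q (m - 1 - i)" "m - 1 - i < m"
    using k swap.alt_aw alt_reflect[of i] by auto
  then show ?thesis by auto
qed

lemma (in dihedral) dih_reflection_iff: "d \<in> dih p q \<Longrightarrow> d \<in> reflections \<longleftrightarrow> odd (len d)"
  using dih_odd_reflection alt_reflection odd_len_reflection by metis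

lemma (in dihedral) dih_reflections: "dih p q \<inter> reflections = alt p q ` {..<m}"
  using dih_odd_reflection dih_reflection_iff alt_in_dih alt_reflection by fast

section \<open>Minimal coset representatives\<close>

lemma (in dihedral) inversions_dih: "d \<in> dih p q \<Longrightarrow> inversions d \<subseteq> dih p q"
  by (erule dih_cases)
     (auto simp: inversions_aw swap.inversions_aw ord_swap alt_in_dih swap.alt_in_dih[unfolded dih_swap])

(* That is, z has minimal length in its coset of the dihedral subgroup. *)
definition (in dihedral) lmin :: "'a \<Rightarrow> bool" where
  "lmin z \<longleftrightarrow> z \<in> carrier G \<and> inversions z \<inter> dih p q = {}"

lemma (in dihedral) lmin_closed [simp]: "lmin z \<Longrightarrow> z \<in> carrier G"
  by (simp add: lmin_def)

text \<open>A shortest element of the coset will do: an inversion inside the subgroup would lead to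
  a shorter element of the same coset.\<close>

lemma (in dihedral) lmin_decomp:
  assumes "y \<in> carrier G"
  obtains d z where "d \<in> dih p q" "lmin z" "y = d \<otimes> z"
proof -
  define C where "C = (\<lambda>d. d \<otimes> y) ` dih p q"
  have "y \<in> C" unfolding C_def by (rule image_eqI[of _ _ \<one>]) (use assms in auto)
  then obtain z where z: "z \<in> C" "\<And>x. x \<in> C \<Longrightarrow> len z \<le> len x"
    using ex_has_least_nat[of "\<lambda>x. x \<in> C" y len] by blast
  obtain e where e: "e \<in> dih p q" "z = e \<otimes> y" using z(1) by (auto simp: C_def)
  have ec: "e \<in> carrier G" using e dih_closed by simp
  have "t \<notin> inversions z" if "t \<in> dih p q" for t
  proof
    assume t: "t \<in> inversions z"
    have eq: "t \<otimes> z = (t \<otimes> e) \<otimes> y" using e ec assms that dih_closed by (simp add: m_assoc)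
    have "t \<otimes> z \<in> C" 
      unfolding C_def eq by (rule imageI) (use that e(1) in simp)
    from z(2)[OF this] t show False by (simp add: inversions_def)
  qed
  then have "lmin z" unfolding lmin_def using e ec assms by auto
  moreover have "y = inv e \<otimes> z" using e ec assms by simp
  ultimately show thesis using that dih_inv[OF e(1)] by blast
qed

text \<open>Conjugation by \<open>d\<close> preserves the subgroup, so \<open>z\<close> contributes
  nothing there to the cocycle rule.\<close>

lemma (in dihedral) inversions_decomp:
  assumes "d \<in> dih p q" "lmin z"
  shows "inversions (d \<otimes> z) \<inter> dih p q = inversions d"
proof (rule Set.set_eqI)
  fix t
  have d: "d \<in> carrier G" using assms dih_closed by simp
  show "t \<in> inversions (d \<otimes> z) \<inter> dih p q \<longleftrightarrow> t \<in> inversions d"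
  proof (cases "t \<in> dih p q")
    case True
    then have "t \<in> carrier G" "cj (inv d) t \<in> dih p q" using assms cj_dih_iff dih_closed by auto
    then show ?thesis using True assms d by (auto simp: inversions_mult lmin_def)
  next
    case False
    then show ?thesis using inversions_dih[OF assms(1)] by auto
  qed
qed

text \<open>One contribution to the cocycle rule lies inside the subgroup and the other outside, so
  the symmetric difference is a disjoint union and cardinalities add up.\<close>

lemma (in dihedral) len_decomp:
  assumes "d \<in> dih p q" "lmin z"
  shows "len (d \<otimes> z) = len d + len z"
proof -
  have d: "d \<in> carrier G" and z: "z \<in> carrier G" using assms dih_closed by auto
  have "inversions (d \<otimes> z) = inversions d \<union> cj d ` inversions z"
  proof (rule Set.set_eqI)
    fix t
    show "t \<in> inversions (d \<otimes> z) \<longleftrightarrow> t \<in> inversions d \<union> cj d ` inversions z"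
    proof (cases "t \<in> reflections")
      case True
      then have t: "t \<in> carrier G" by simp
      have *: "t \<in> cj d ` inversions z \<longleftrightarrow> cj (inv d) t \<in> inversions z"
        using d t inversions_reflections by (force simp: image_iff)
      have "\<not> (t \<in> inversions d \<and> cj (inv d) t \<in> inversions z)"
        using inversions_dih[OF assms(1)] assms cj_dih_iff[of "inv d" t] t by (auto simp: lmin_def)
      then show ?thesis using * d z t by (auto simp: inversions_mult)
    next
      case False
      then show ?thesis using inversions_reflections d by (force simp: image_iff)
    qed
  qed
  moreover have "inversions d \<inter> cj d ` inversions z = {}"
    using inversions_dih[OF assms(1)] assms cj_dih_iff[of d] inversions_reflections[of z]
    by (force simp: lmin_def)
  moreover have "inj_on (cj d) (inversions z)"
    using inj_on_cj[OF d] by (rule inj_on_subset) (use inversions_reflections reflection_carrier in blast)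
  ultimately have "card (inversions (d \<otimes> z)) = card (inversions d) + card (inversions z)"
    using d z by (simp add: card_Un_disjoint card_image)
  then show ?thesis using d z by (simp add: card_inversions)
qed

text \<open>\<open>p\<close> and \<open>q\<close> are the two ends of the chain of reflections. An
  initial segment from either end that contains both is the whole chain, so the dihedral factor is
  the longest element.\<close>

lemma (in dihedral) both_descents:
  assumes "w \<in> carrier G" "p \<in> inversions w" "q \<in> inversions w"
  obtains z where "lmin z" "w = aw p q m \<otimes> z" "len w = m + len z"
proof -
  obtain d z where dz: "d \<in> dih p q" "lmin z" "w = d \<otimes> z" by (rule lmin_decomp[OF assms(1)])
  have pq: "p \<in> inversions d" "q \<in> inversions d"
    using assms(2,3) unfolding inversions_decomp[OF dz(1,2), symmetric] dz(3)[symmetric] by auto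
  have last: "q = alt p q (m - 1)" "p = alt q p (m - 1)"
    using alt_reflect[of 0] swap.alt_reflect[of 0] m_ge_2 by (auto simp: ord_swap)
  have "d = aw p q m"
    using dz(1)
  proof (rule dih_cases)
    fix k assume k: "k \<le> m" "d = aw p q k"
    then obtain i where "i < k" "q = alt p q i" using pq inversions_aw by auto
    then have "m - 1 = i" using last k m_ge_2 inj_onD[OF inj_on_alt, of "m - 1" i] by auto
    then have "k = m" using \<open>i < k\<close> k(1) by auto
    then show ?thesis using k by simp
  next
    fix k assume k: "k \<le> m" "d = aw q p k"
    then obtain i where "i < k" "p = alt q p i" using pq swap.inversions_aw by (auto simp: ord_swap)
    then have "m - 1 = i"
      using last k m_ge_2 inj_onD[OF swap.inj_on_alt, of "m - 1" i] by (auto simp: ord_swap)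
    then have "k = m" using \<open>i < k\<close> k by auto
    then show ?thesis using k aw_m by simp
  qed
  then show thesis using that[of z] dz len_decomp[OF dz(1,2)] len_aw[of m] by simp
qed

section \<open>Products of two reflections\<close>

lemma (in dihedral) simple_inversion_dih:
  assumes "d \<in> dih p q" "d \<noteq> \<one>"
  obtains s where "s \<in> {p, q}" "s \<in> inversions d"
  using assms(1)
proof (rule dih_cases)
  fix k assume k: "k \<le> m" "d = aw p q k"
  then have "k \<noteq> 0" using assms(2) by (metis aw_0)
  then have "alt p q 0 \<in> inversions d" using k by (simp only: inversions_aw) blast
  then show thesis using that[of p] by simp
next
  fix k assume k: "k \<le> m" "d = aw q p k"
  then have "k \<noteq> 0" using assms(2) by (metis swap.aw_0)
  then have "alt q p 0 \<in> inversions d" using k by (simp only: swap.inversions_aw ord_swap) blast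
  then show thesis using that[of q] by simp
qed

(* Among the reflections c outside the dihedral subgroup for which some product c d with d \<noteq> 1 in
   the subgroup is a reflection, one of minimal length has a conjugate c e, with e in the subgroup,
   as an inversion. Conjugating c by c e, or by its conjugate under c, would make it shorter. *)
theorem (in dihedral) reflection_product_in_dih:
  assumes r: "r \<in> reflections" "r' \<in> reflections" "r \<noteq> r'" "r \<otimes> r' \<in> dih p q"
  shows "r \<in> dih p q"
proof (rule ccontr)
  assume "r \<notin> dih p q"
  define C where "C = {c \<in> reflections. c \<notin> dih p q \<and> (\<exists>d\<in>dih p q. d \<noteq> \<one> \<and> c \<otimes> d \<in> reflections)}"
  have "r \<otimes> r' \<noteq> \<one>"
    using r inv_equality[of r r'] inv_equality[of r' r] by auto
  then have "r \<in> C"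
    unfolding C_def using r \<open>r \<notin> dih p q\<close> by (auto intro!: bexI[of _ "r \<otimes> r'"])
  then obtain c where c: "c \<in> C" "\<And>x. x \<in> C \<Longrightarrow> len c \<le> len x"
    using ex_has_least_nat[of "\<lambda>x. x \<in> C" r len] by blast
  have crefl [simp]: "c \<in> reflections" and cdih: "c \<notin> dih p q" using c(1) by (auto simp: C_def)
  \<comment> \<open>Since the set is stable under conjugation by the subgroup, no such conjugate of
    \<open>c\<close> can be shorter than \<open>c\<close>.\<close>
  have conj: "cj e c \<in> C" if e: "e \<in> dih p q" for e
  proof -
    obtain d where d: "d \<in> dih p q" "d \<noteq> \<one>" "c \<otimes> d \<in> reflections"
      using c(1) unfolding C_def by blast
    have ec: "e \<in> carrier G" "d \<in> carrier G" using e d dih_closed by auto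
    have "cj e d \<noteq> \<one>" "cj e d \<in> dih p q" "cj e c \<otimes> cj e d \<in> reflections"
      using e ec d by (simp_all add: cj_dih_iff flip: cj_mult)
    moreover have "cj e c \<in> reflections" "cj e c \<notin> dih p q"
      using e ec cdih by (simp_all add: cj_dih_iff)
    ultimately show ?thesis unfolding C_def by blast
  qed
  have lmin: "lmin c"
  proof -
    obtain d z where dz: "d \<in> dih p q" "lmin z" "c = d \<otimes> z" by (rule lmin_decomp[of c]) simp
    have "d = \<one>"
    proof (rule ccontr)
      assume "d \<noteq> \<one>"
      then obtain s where s: "s \<in> {p, q}" "s \<in> inversions d"
        using simple_inversion_dih[OF dz(1)] by blast
      then have "s \<in> inversions c"
        using inversions_decomp[OF dz(1,2)] dz(3) by blast
      moreover have "s \<in> S" "s \<in> dih p q" "s \<noteq> c" using s cdih by auto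
      ultimately show False
        using cj_simple_shorter[OF crefl] c(2)[OF conj[of s]] by fastforce
    qed
    then show ?thesis using dz by simp
  qed
  \<comment> \<open>A second minimal choice: a shortest partner \<open>d\<close> for the fixed
    \<open>c\<close>.\<close>
  define Q where "Q d \<longleftrightarrow> d \<in> dih p q \<and> d \<noteq> \<one> \<and> c \<otimes> d \<in> reflections" for d
  have "\<exists>d. Q d" using c(1) unfolding C_def Q_def by blast
  then obtain d where d: "Q d" "\<And>e. Q e \<Longrightarrow> len d \<le> len e"
    using ex_has_least_nat[of Q _ len] by blast
  have dd [simp]: "d \<in> dih p q" "d \<in> carrier G" "d \<noteq> \<one>" "c \<otimes> d \<in> reflections"
    using d(1) dih_closed by (auto simp: Q_def)
  \<comment> \<open>A reflection \<open>c e\<close> is its own inverse. In the factorization with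
    \<open>c\<close> on the right, \<open>c\<close> is a minimal coset representative, so lengths
    add up.\<close>
  have comm: "c \<otimes> e = inv e \<otimes> c" if "c \<otimes> e \<in> reflections" "e \<in> dih p q" for e
    using reflection_inv[OF that(1)] that(2) dih_closed by (simp add: inv_mult_group)
  have len_ce: "len (c \<otimes> e) = len e + len c" if "c \<otimes> e \<in> reflections" "e \<in> dih p q" for e
    using comm[OF that] that(2) len_decomp[OF _ lmin, of "inv e"] dih_closed[OF that(2)] by simp
  \<comment> \<open>Conjugating \<open>c\<close> by the reflection \<open>c e\<close> has the same
    effect as conjugating it by \<open>inv e\<close>.\<close>
  have cj_ce: "cj (c \<otimes> e) c \<in> C" if "c \<otimes> e \<in> reflections" "e \<in> dih p q" for e
  proof -
    have "cj (c \<otimes> e) c = (c \<otimes> e) \<otimes> c \<otimes> (c \<otimes> e)"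
      using that by (simp add: cj_def)
    also have "\<dots> = inv e \<otimes> (c \<otimes> e)"
      using that(2) dih_closed comm[OF that] by (simp add: m_assoc)
    also have "\<dots> = cj (inv e) c"
      using that(2) dih_closed by (simp add: cj_def m_assoc)
    finally show ?thesis using conj[of "inv e"] that(2) by simp
  qed
  have cd_notin: "c \<otimes> d \<notin> dih p q" using cdih by (simp add: dih_mult_iff)
  \<comment> \<open>The inversions of \<open>c d\<close> inside the subgroup are computed from both
    factorizations, \<open>c d\<close> and \<open>inv d c\<close>.\<close>
  have inv_d: "t \<in> inversions (inv d) \<longleftrightarrow> cj c t \<in> inversions d" if "t \<in> dih p q" for t
  proof -
    have t: "t \<in> carrier G" using that dih_closed by simp
    have "t \<in> inversions (inv d \<otimes> c) \<longleftrightarrow> t \<in> inversions (inv d)"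
      using inversions_decomp[OF _ lmin, of "inv d"] that by auto
    moreover have "t \<in> inversions (c \<otimes> d) \<longleftrightarrow> cj c t \<in> inversions d"
      using t that lmin by (auto simp: inversions_mult lmin_def)
    ultimately show ?thesis using comm[of d] by simp
  qed
  have "inv d \<noteq> \<one>" by (metis dd(2,3) inv_inv inv_one)
  then obtain s where s: "s \<in> {p, q}" "s \<in> inversions (inv d)"
    using simple_inversion_dih[of "inv d"] by auto
  then have sS [simp]: "s \<in> S" "s \<in> dih p q" by auto
  \<comment> \<open>\<open>u\<close> satisfies \<open>u c = c s\<close>; by \<open>inv_d\<close> it
    is an inversion of \<open>d\<close> and hence lies in the subgroup. Conjugating
    \<open>c d\<close> by \<open>s\<close> gives the shorter reflection \<open>c (u d s)\<close>,
    and minimality of \<open>d\<close> leaves only \<open>u d s = \<one>\<close>.\<close>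
  define u where "u = cj c s"
  have "u \<in> inversions d" using inv_d[of s] s unfolding u_def by simp
  then have u [simp]: "u \<in> dih p q" using inversions_dih[of d] by auto
  have ur [simp]: "u \<in> reflections" unfolding u_def by simp
  then have uc [simp]: "u \<in> carrier G" by (rule reflection_carrier)
  have "s \<in> inversions (c \<otimes> d)"
    using inversions_decomp[OF _ lmin, of "inv d"] s comm[of d] by auto
  then have lt: "len (cj s (c \<otimes> d)) < len (c \<otimes> d)"
    using cj_simple_shorter[OF dd(4) sS(1)] cd_notin sS(2) by metis
  have eq: "cj s (c \<otimes> d) = c \<otimes> (u \<otimes> d \<otimes> s)"
    by (simp add: cj_def u_def m_assoc)
  moreover have "cj s (c \<otimes> d) \<in> reflections" by simp
  ultimately have R: "c \<otimes> (u \<otimes> d \<otimes> s) \<in> reflections" by simp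
  have "len (u \<otimes> d \<otimes> s) < len d"
    using lt eq len_ce[OF R] len_ce[of d] by simp
  then have "\<not> Q (u \<otimes> d \<otimes> s)" using d(2) by fastforce
  then have one: "u \<otimes> d \<otimes> s = \<one>" using R by (simp add: Q_def)
  have us: "u \<otimes> s \<noteq> \<one>"
  proof
    assume "u \<otimes> s = \<one>"
    then have "u = s" using inv_equality[of u s] by simp
    then have "d = \<one>" using one by (metis cj_def cj_eq_one_iff dd(2) S_carrier sS(1) S_inv)
    then show False by simp
  qed
  \<comment> \<open>Both sides of \<open>c s = u c\<close> are tested for the inversion
    \<open>u c u\<close>: on the right, conjugation by \<open>u\<close> turns it into
    \<open>c\<close>, an inversion of itself.\<close>
  have "cj u c \<in> inversions c"
  proof -
    let ?t = "cj u c"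
    have t: "?t \<in> carrier G" "?t \<notin> dih p q" using cdih cj_dih_iff[of u c] by auto
    have "c \<otimes> s = u \<otimes> c" by (simp add: u_def cj_def m_assoc)
    then have "?t \<in> inversions (c \<otimes> s) \<longleftrightarrow> ?t \<in> inversions (u \<otimes> c)" by simp
    moreover have "?t \<in> inversions (u \<otimes> c) \<longleftrightarrow> c \<in> inversions c"
      using t inversions_dih[of u] by (auto simp: inversions_mult)
    moreover have "?t \<in> inversions (c \<otimes> s) \<longleftrightarrow> ?t \<in> inversions c"
    proof -
      have "cj c ?t \<noteq> s"
      proof
        assume "cj c ?t = s"
        then have "?t = cj c s" using t by (simp add: cj_eq_iff del: cj_cj)
        then show False using t unfolding u_def[symmetric] by simp
      qed
      then show ?thesis using t by (simp add: inversions_mult del: cj_cj)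
    qed
    ultimately show ?thesis using inversions_self[OF crefl] by simp
  qed
  moreover have "cj u c \<noteq> c"
  proof
    assume "cj u c = c"
    then have "u \<otimes> c = c \<otimes> u" using cj_cancel[of u c] by simp
    then have "cj c u = u" by (simp add: cj_def m_assoc)
    moreover have "cj c u = s" unfolding u_def by simp
    ultimately show False using us by simp
  qed
  \<comment> \<open>The two conjugating reflections offered by \<open>cj_shorter\<close> have the
    form \<open>c e\<close> with \<open>e = s u\<close> and \<open>e = u s\<close>. By
    \<open>cj_ce\<close> both keep \<open>c\<close> inside the set, against its minimal
    length.\<close>
  moreover have "cj u c = c \<otimes> (s \<otimes> u)" "cj c (cj u c) = c \<otimes> (u \<otimes> s)"
  proof -
    have uc: "u \<otimes> c = c \<otimes> s" by (simp add: u_def cj_def m_assoc)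
    have "cj u c = u \<otimes> c \<otimes> u" by (simp add: cj_def)
    then show "cj u c = c \<otimes> (s \<otimes> u)" by (simp add: uc m_assoc)
    have "cj c (cj u c) = c \<otimes> (u \<otimes> c \<otimes> u) \<otimes> c" by (simp add: cj_def)
    also have "\<dots> = c \<otimes> u \<otimes> (c \<otimes> (u \<otimes> c))" by (simp add: m_assoc)
    also have "\<dots> = c \<otimes> (u \<otimes> s)" by (simp add: uc m_assoc)
    finally show "cj c (cj u c) = c \<otimes> (u \<otimes> s)" .
  qed
  moreover have "cj u c \<in> reflections" "cj c (cj u c) \<in> reflections" by simp_all
  ultimately show False
    using cj_shorter[OF crefl, of "cj u c"] c(2)[OF cj_ce[of "s \<otimes> u"]] c(2)[OF cj_ce[of "u \<otimes> s"]]
    by fastforce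
qed

section \<open>Reflection orderings and reduced words\<close>

definition list_rel :: "'a list \<Rightarrow> ('a \<times> 'a) set" where
  "list_rel L = {(L ! i, L ! j) | i j. i \<le> j \<and> j < length L}"

lemma sorted_wrt_unique:
  assumes "sorted_wrt P xs" "sorted_wrt P ys" "distinct xs" "distinct ys" "set xs = set ys"
    and "\<And>x y. P x y \<Longrightarrow> P y x \<Longrightarrow> x = y"
  shows "xs = ys"
  using assms(1-5)
proof (induction xs arbitrary: ys)
  case (Cons x xs)
  then obtain y ys' where ys: "ys = y # ys'" by (cases ys) auto
  have "x = y"
  proof (rule ccontr)
    assume "x \<noteq> y"
    then have "x \<in> set ys'" "y \<in> set xs" using Cons.prems ys by auto
    then have "P x y" "P y x" using Cons.prems ys by auto
    then show False using assms(6) \<open>x \<noteq> y\<close> by blast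
  qed
  moreover from this have "set xs = set ys'" using Cons.prems ys by (auto simp: insert_ident)
  ultimately show ?case using Cons.IH[of ys'] Cons.prems ys by simp
qed simp

lemma linear_order_sorted_list:
  assumes "finite A" "linear_order_on A R"
  obtains L where "distinct L" "set L = A" "sorted_wrt (\<lambda>x y. (x, y) \<in> R) L"
proof -
  have tr: "trans R" and tot: "total_on A R"
    using assms(2) by (auto simp: linear_order_on_def partial_order_on_def preorder_on_def)
  have "\<exists>L. distinct L \<and> set L = B \<and> sorted_wrt (\<lambda>x y. (x, y) \<in> R) L" if "B \<subseteq> A" for B
    using finite_subset[OF that assms(1)] that
  proof (induction B)
    case (insert x B)
    then obtain L where L: "distinct L" "set L = B" "sorted_wrt (\<lambda>x y. (x, y) \<in> R) L" by auto
    let ?L = "filter (\<lambda>y. (y, x) \<in> R) L @ x # filter (\<lambda>y. (y, x) \<notin> R) L"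
    have "(x, y) \<in> R" if "y \<in> B" "(y, x) \<notin> R" for y
      using tot that insert by (auto simp: total_on_def)
    then have "sorted_wrt (\<lambda>x y. (x, y) \<in> R) ?L"
      using L transD[OF tr] by (auto simp: sorted_wrt_append sorted_wrt_filter)
    then show ?case using L insert by (intro exI[of _ ?L]) auto
  qed auto
  then show thesis using that by blast
qed

lemma linear_order_list_rel:
  assumes "linear_order_on A R" "set L = A" "sorted_wrt (\<lambda>x y. (x, y) \<in> R) L"
  shows "R = list_rel L"
proof -
  have R: "R \<subseteq> A \<times> A" "refl_on A R" "antisym R"
    using assms(1) by (auto simp: linear_order_on_def partial_order_on_def preorder_on_def)
  have 1: "(L ! i, L ! j) \<in> R" if "i \<le> j" "j < length L" for i j
    using that assms(2,3) R(2) by (cases "i = j") (auto simp: refl_on_def sorted_wrt_iff_nth_less)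
  have "(x, y) \<in> list_rel L" if xy: "(x, y) \<in> R" for x y
  proof -
    obtain i j where ij: "i < length L" "j < length L" "x = L ! i" "y = L ! j"
      using xy R(1) assms(2) by (metis SigmaD1 SigmaD2 in_set_conv_nth subsetD)
    show ?thesis
    proof (cases "i \<le> j")
      case False
      then have "x = y" using 1[of j i] xy R(3) ij by (auto dest: antisymD)
      then show ?thesis using ij unfolding list_rel_def by blast
    qed (use ij in \<open>auto simp: list_rel_def\<close>)
  qed
  then show ?thesis using 1 by (auto simp: list_rel_def)
qed

section \<open>Conjugation of powers and subgroups\<close>

lemma (in group) cj_self [simp]: "x \<in> carrier G \<Longrightarrow> cj x x = x"
  by (simp add: cj_def m_assoc)

lemma (in group) cj_pow: "g \<in> carrier G \<Longrightarrow> x \<in> carrier G \<Longrightarrow> cj g x [^] (n::nat) = cj g (x [^] n)"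
  by (induction n) (simp_all add: cj_mult, simp add: cj_def)

lemma (in group) ord_cj: "g \<in> carrier G \<Longrightarrow> x \<in> carrier G \<Longrightarrow> ord (cj g x) = ord x"
  using ord_unique[of "cj g x" "ord x"] pow_eq_id[of x] by (simp add: cj_pow)

lemma (in group) mem_cj_image:
  assumes "g \<in> carrier G" "t \<in> carrier G" "A \<subseteq> carrier G"
  shows "t \<in> cj g ` A \<longleftrightarrow> cj (inv g) t \<in> A"
  using assms cj_eq_iff[of g _ t] by (auto simp: image_iff) (metis subsetD)

lemma (in group) subgroup_cj_image:
  assumes "subgroup H G" "g \<in> carrier G"
  shows "subgroup (cj g ` H) G"
proof (rule subgroupI)
  have H: "x \<in> carrier G" if "x \<in> H" for x using subgroup.mem_carrier[OF assms(1) that] .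
  show "cj g ` H \<subseteq> carrier G" using H assms by auto
  show "cj g ` H \<noteq> {}" using subgroup.one_closed[OF assms(1)] by auto
  show "inv a \<in> cj g ` H" if "a \<in> cj g ` H" for a
    using that H assms subgroup.m_inv_closed[OF assms(1)] by (auto simp flip: cj_inv)
  show "a \<otimes> b \<in> cj g ` H" if "a \<in> cj g ` H" "b \<in> cj g ` H" for a b
    using that H assms subgroup.m_closed[OF assms(1)] by (auto simp flip: cj_mult)
qed

context coxeter_system
begin

definition alts :: "'a \<Rightarrow> 'a \<Rightarrow> 'a list" where
  "alts p q = map (alt p q) [0..<ord (p \<otimes> q)]"

(* Only the chains of conjugates a W_{pq} a^-1 of standard dihedral subgroups by elements a of
   minimal length in a W_{pq} are recorded; they suffice to recover a reduced word of the
   longest element. *)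
definition refl_order_list :: "'a list \<Rightarrow> bool" where
  "refl_order_list L \<longleftrightarrow> distinct L \<and> set L = reflections \<and>
    (\<forall>a p q. a \<in> carrier G \<and> p \<in> S \<and> q \<in> S \<and> p \<noteq> q \<and> inversions (inv a) \<inter> dih p q = {} \<longrightarrow>
      filter (\<lambda>t. t \<in> cj a ` dih p q) L \<in> {map (cj a) (alts p q), map (cj a) (alts q p)})"

lemma simple_inversion:
  assumes "w \<in> carrier G" "w \<noteq> \<one>"
  obtains s where "s \<in> S" "s \<in> inversions w"
proof -
  obtain ws where ws: "ws \<in> lists S" "wprod ws = w" "length ws = len w"
    by (rule reduced_word_exists[OF assms(1)])
  then obtain s vs where "ws = s # vs" using assms(2) by (cases ws) auto
  moreover have "distinct (refl_seq ws)" using ws by (intro reduced_distinct) auto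
  ultimately show thesis using that[of s] ws inversions_wprod_distinct[of ws] by auto
qed

lemma distinct_iff_reduced:
  "ws \<in> lists S \<Longrightarrow> distinct (refl_seq ws) \<longleftrightarrow> len (wprod ws) = length ws"
  using reduced_distinct distinct_imp_reduced by metis

lemma alt_cj:
  "g \<in> carrier G \<Longrightarrow> a \<in> carrier G \<Longrightarrow> b \<in> carrier G \<Longrightarrow> alt (cj g a) (cj g b) i = cj g (alt a b i)"
  by (simp add: alt_def cj_mult cj_pow[symmetric])

end

section \<open>Conjugates of standard dihedral subgroups\<close>

lemma (in dihedral) rmin_not_inversion:
  assumes "a \<in> carrier G" "lmin (inv a)" "t \<in> dih p q"
  shows "cj a t \<notin> inversions a"
  using assms inversions_inv[of a t] dih_closed[OF assms(3)] by (auto simp: lmin_def)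

lemma (in dihedral) dih_subset: "dih p q \<subseteq> carrier G"
  using dih_closed by blast

lemma (in dihedral) set_alts: "set (alts p q) = dih p q \<inter> reflections"
  unfolding dih_reflections alts_def by auto

lemma (in dihedral) distinct_alts: "distinct (alts p q)"
  using inj_on_alt by (simp add: alts_def distinct_map atLeast0LessThan)

text \<open>As \<open>a\<close> is minimal, its two contributions in
  \<open>inversions_reflection\<close> vanish on the conjugate, so the inversions there are the
  conjugates of those in the standard subgroup. A single inversion means length one, which leaves
  \<open>p\<close> and \<open>q\<close>.\<close>

lemma (in dihedral) canonical_gens_cj_dih:
  assumes "a \<in> carrier G" "lmin (inv a)"
  shows "canonical_gens (cj a ` dih p q) = {cj a p, cj a q}"
proof -
  let ?D = "cj a ` dih p q"
  have *: "{r \<in> ?D \<inter> reflections. len (r \<otimes> cj a t) < len (cj a t)} = cj a ` inversions t"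
    if t: "t \<in> dih p q" "t \<in> reflections" for t
  proof -
    have "r \<in> inversions (cj a t) \<longleftrightarrow> cj (inv a) r \<in> inversions t"
      if r: "r \<in> ?D" "r \<in> reflections" for r
    proof -
      obtain r0 where r0: "r0 \<in> dih p q" "r = cj a r0" using r by blast
      have "r0 \<in> carrier G" "t \<in> carrier G" using r0 t dih_closed by auto
      then have "cj (cj a t) r = cj a (cj t r0)"
        using r0 assms by (simp add: cj_def m_assoc inv_mult_group)
      moreover have "cj t r0 \<in> dih p q" using r0 t cj_dih_iff dih_closed by simp
      ultimately show ?thesis
        using rmin_not_inversion[OF assms] r0 t assms r inversions_reflection[of a t r] by auto
    qed
    then have "{r \<in> ?D \<inter> reflections. len (r \<otimes> cj a t) < len (cj a t)} =
        {r \<in> ?D \<inter> reflections. cj (inv a) r \<in> inversions t}"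
      unfolding inversions_def by blast
    also have "\<dots> = cj a ` inversions t"
    proof -
      have "inversions t \<subseteq> dih p q" "inversions t \<subseteq> reflections" "inversions t \<subseteq> carrier G"
        using t inversions_dih inversions_reflections reflection_carrier by blast+
      then show ?thesis using assms mem_cj_image[of a _ "inversions t"] by (auto simp: subset_iff)
    qed
    finally show ?thesis .
  qed
  have **: "cj a ` inversions t = {cj a t} \<longleftrightarrow> t \<in> {p, q}" if t: "t \<in> dih p q" "t \<in> reflections" for t
  proof
    assume "cj a ` inversions t = {cj a t}"
    moreover have "inj_on (cj a) (inversions t)"
      using inj_on_cj[OF assms(1)] by (rule inj_on_subset) (use inversions_reflections reflection_carrier in blast)
    ultimately have "card (inversions t) = card {cj a t}" by (metis card_image)
    then have "len t = 1" using t card_inversions[of t] by simp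
    then show "t \<in> {p, q}" using dih_aw_len[OF t(1)] by auto
  qed (use assms in auto)
  show ?thesis
  proof (rule Set.set_eqI)
    fix x
    let ?K = "\<lambda>x. {r \<in> ?D \<inter> reflections. len (r \<otimes> x) < len x}"
    have "cj a t \<in> reflections \<longleftrightarrow> t \<in> reflections" if "t \<in> dih p q" for t
      using that assms(1) dih_closed by simp
    then have "x \<in> canonical_gens ?D \<longleftrightarrow>
        (\<exists>t\<in>dih p q. t \<in> reflections \<and> x = cj a t \<and> ?K (cj a t) = {cj a t})"
      unfolding canonical_gens_def by blast
    also have "\<dots> \<longleftrightarrow> (\<exists>t\<in>dih p q. t \<in> reflections \<and> x = cj a t \<and> t \<in> {p, q})"
    proof -
      have "?K (cj a t) = {cj a t} \<longleftrightarrow> t \<in> {p, q}" if "t \<in> dih p q" "t \<in> reflections" for t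
        unfolding *[OF that] **[OF that] ..
      then show ?thesis by (intro bex_cong HOL.refl conj_cong) simp_all
    qed
    also have "\<dots> \<longleftrightarrow> x \<in> {cj a p, cj a q}"
      using p_in_dih q_in_dih S_reflection[OF pS] S_reflection[OF qS] by blast
    finally show "x \<in> canonical_gens ?D \<longleftrightarrow> x \<in> {cj a p, cj a q}" .
  qed
qed

lemma (in dihedral) reflection_subgroup_cj_dih:
  assumes "a \<in> carrier G"
  shows "reflection_subgroup (cj a ` dih p q)"
proof -
  let ?D = "cj a ` dih p q"
  have sub: "subgroup ?D G" using subgroup_dih assms by (rule subgroup_cj_image)
  let ?K = "generate G (?D \<inter> reflections)"
  have K: "subgroup ?K G" by (rule generate_is_subgroup) auto
  have "cj a d \<in> ?K" if "d \<in> generate G {p, q}" for d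
    using that
  proof (induction rule: generate.induct)
    case one
    then show ?case using assms K by (simp add: cj_def subgroup.one_closed)
  next
    case (incl h)
    then show ?case using assms by (auto intro!: generate.incl)
  next
    case (inv h)
    then show ?case using assms by (auto intro!: generate.incl)
  next
    case (eng g h)
    then have "g \<in> carrier G" "h \<in> carrier G" using generate_dih dih_closed by auto
    then show ?case using eng assms by (simp add: cj_mult generate.eng)
  qed
  then have "?D \<subseteq> ?K" unfolding generate_dih by blast
  moreover have "?K \<subseteq> ?D" by (rule generate_subgroup_incl[OF _ sub]) auto
  ultimately show ?thesis using sub unfolding reflection_subgroup_def by blast
qed

lemma (in dihedral) chain_sorted_alts:
  assumes "a \<in> carrier G" "dihedral_chain R (cj a p) (cj a q)"
  shows "sorted_wrt (\<lambda>x y. (x, y) \<in> R) (map (cj a) (alts p q))"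
  using assms
  by (auto simp: sorted_wrt_iff_nth_less alts_def dihedral_chain_def Let_def alt_cj ord_cj simp flip: cj_mult)

lemma (in dihedral) set_map_alts:
  assumes "a \<in> carrier G"
  shows "set (map (cj a) (alts p q)) = cj a ` dih p q \<inter> reflections"
  using assms dih_closed by (auto simp: set_alts)

lemma (in dihedral) distinct_map_alts: "a \<in> carrier G \<Longrightarrow> distinct (map (cj a) (alts p q))"
  using distinct_alts inj_on_subset[OF inj_on_cj, of a "set (alts p q)"] set_alts dih_closed
  by (auto simp: distinct_map)

lemma (in finite_coxeter_system) finite_reflections: "finite reflections"
  using finite_G by (rule finite_subset[rotated]) auto

text \<open>On each conjugate the ordering sorts one of the two chains. A distinct list sorted by an
  antisymmetric relation is determined by its set of entries, so filtering the list of all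
  reflections yields that chain.\<close>

lemma (in finite_coxeter_system) reflection_ordering_list:
  assumes "reflection_ordering R"
  obtains L where "refl_order_list L" "R = list_rel L"
proof -
  have lin: "linear_order_on reflections R" using assms by (simp add: reflection_ordering_def)
  then obtain L where L: "distinct L" "set L = reflections" "sorted_wrt (\<lambda>x y. (x, y) \<in> R) L"
    using linear_order_sorted_list[OF finite_reflections] by blast
  have anti: "x = y" if "(x, y) \<in> R" "(y, x) \<in> R" for x y
    using lin that by (auto simp: linear_order_on_def partial_order_on_def dest: antisymD)
  have "refl_order_list L"
    unfolding refl_order_list_def
  proof (intro conjI allI impI L)
    fix a p q assume *: "a \<in> carrier G \<and> p \<in> S \<and> q \<in> S \<and> p \<noteq> q \<and> inversions (inv a) \<inter> dih p q = {}"
    interpret dihedral G S p q using * by (intro dihedralI) auto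
    have a: "a \<in> carrier G" "lmin (inv a)" using * by (auto simp: lmin_def)
    let ?D = "cj a ` dih p q"
    have "cj a p \<noteq> cj a q" using p_neq_q a by (simp add: cj_eq_iff)
    then have "dihedral_chain R (cj a p) (cj a q) \<or> dihedral_chain R (cj a q) (cj a p)"
      using assms reflection_subgroup_cj_dih[OF a(1)] canonical_gens_cj_dih[OF a]
      unfolding reflection_ordering_def by blast
    then have "sorted_wrt (\<lambda>x y. (x, y) \<in> R) (map (cj a) (alts p q)) \<or>
        sorted_wrt (\<lambda>x y. (x, y) \<in> R) (map (cj a) (alts q p))"
      using chain_sorted_alts swap.chain_sorted_alts a(1) by blast
    moreover have "sorted_wrt (\<lambda>x y. (x, y) \<in> R) (filter (\<lambda>t. t \<in> ?D) L)"
      using L(3) by (rule sorted_wrt_filter)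
    moreover have "set (filter (\<lambda>t. t \<in> ?D) L) = ?D \<inter> reflections" using L(2) by auto
    moreover have "distinct (filter (\<lambda>t. t \<in> ?D) L)" using L(1) by simp
    ultimately have "filter (\<lambda>t. t \<in> ?D) L = map (cj a) (alts p q) \<or>
        filter (\<lambda>t. t \<in> ?D) L = map (cj a) (alts q p)"
      using sorted_wrt_unique[of "\<lambda>x y. (x, y) \<in> R"] anti
        set_map_alts[OF a(1)] swap.set_map_alts[OF a(1)] distinct_map_alts[OF a(1)] swap.distinct_map_alts[OF a(1)]
      unfolding dih_swap by metis
    then show "filter (\<lambda>t. t \<in> ?D) L \<in> {map (cj a) (alts p q), map (cj a) (alts q p)}" by blast
  qed
  then show thesis using that linear_order_list_rel[OF lin L(2,3)] by blast
qed

text \<open>Write \<open>t = w s w^-1\<close> as in \<open>reflection_half\<close>. If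
  \<open>w\<close> is not the identity, it has a right descent \<open>p\<close>; splitting off the
  part of \<open>w\<close> in the subgroup of \<open>p\<close> and \<open>s\<close> leaves a shorter
  \<open>inv z\<close>. Then \<open>t\<close> lies in the conjugate of this subgroup by
  \<open>inv z\<close> and, being first in the list, is an end of its chain: a conjugate of
  \<open>p\<close> or \<open>s\<close> by \<open>inv z\<close>, which is too short for
  \<open>t\<close>.\<close>

lemma (in finite_coxeter_system) refl_order_list_hd_simple:
  assumes "refl_order_list (t # L)"
  shows "t \<in> S"
proof (rule ccontr)
  assume nS: "t \<notin> S"
  have t: "t \<in> reflections" using assms by (auto simp: refl_order_list_def)
  obtain w s where w: "w \<in> carrier G" "s \<in> S" "t = cj w s" "len t = 2 * len w + 1"
    by (rule reflection_half[OF t])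
  have bound: "\<not> (t = cj b r \<and> len b < len w \<and> b \<in> carrier G \<and> r \<in> S)" for b r
    using len_cj_le[of b r] w(4) by auto
  have "w \<noteq> \<one>" using w nS by auto
  then have "inv w \<noteq> \<one>" using w(1) by (metis inv_inv inv_one)
  then obtain p where p: "p \<in> S" "p \<in> inversions (inv w)"
    using simple_inversion[of "inv w"] w(1) by auto
  \<comment> \<open>Otherwise \<open>w p\<close> would be a shorter conjugator giving the same
    reflection.\<close>
  have "p \<noteq> s"
  proof
    assume "p = s"
    have "len (inv (p \<otimes> inv w)) < len w"
      using p w(1) by (simp add: inversions_def del: inv_mult_group)
    then have "len (w \<otimes> p) < len w" using p w(1) by (simp add: inv_mult_group)
    moreover have "t = cj (w \<otimes> p) s" using w p \<open>p = s\<close> by (simp add: cj_def m_assoc inv_mult_group)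
    ultimately show False using bound[of "w \<otimes> p" s] w(1,2) p by simp
  qed
  then interpret dihedral G S p s using p w by (intro dihedralI) auto
  obtain d z where dz: "d \<in> dih p s" "lmin z" "inv w = d \<otimes> z"
    by (rule lmin_decomp[of "inv w"]) (use w in simp)
  have dc: "d \<in> carrier G" using dz dih_closed by simp
  have "d \<noteq> \<one>" using dz p(2) by (auto simp: lmin_def)
  then have "len d \<noteq> 0" using dc len_eq_0_iff by simp
  moreover have "len w = len d + len z" using len_decomp[OF dz(1,2)] w(1) dz(3) by (metis len_inv)
  ultimately have lt: "len (inv z) < len w" using dz(2) by simp
  have "inv (inv w) = inv (d \<otimes> z)" unfolding dz(3) ..
  then have weq: "w = inv z \<otimes> inv d" using w(1) dc dz(2) by (simp add: inv_mult_group)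
  have teq: "t = cj (inv z) (cj (inv d) s)" unfolding w(3) weq using w(2) dz(2) dc by simp
  let ?D = "cj (inv z) ` dih p s"
  have "cj (inv d) s \<in> dih p s" using dz(1) by (simp add: cj_dih_iff)
  then have "t \<in> ?D" unfolding teq by (rule imageI)
  then have "hd (filter (\<lambda>t. t \<in> ?D) (t # L)) = t" by simp
  moreover have "inv z \<in> carrier G \<and> p \<in> S \<and> s \<in> S \<and> p \<noteq> s \<and> inversions (inv (inv z)) \<inter> dih p s = {}"
    using dz(2) p_neq_q by (simp add: lmin_def)
  then have "filter (\<lambda>t. t \<in> ?D) (t # L) \<in> {map (cj (inv z)) (alts p s), map (cj (inv z)) (alts s p)}"
    using assms unfolding refl_order_list_def by blast
  moreover have "hd (map (cj (inv z)) (alts p s)) = cj (inv z) p"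
    "hd (map (cj (inv z)) (alts s p)) = cj (inv z) s"
    using m_ge_2 by (simp_all add: alts_def hd_map ord_swap)
  ultimately have "t = cj (inv z) p \<or> t = cj (inv z) s" by auto
  moreover have "inv z \<in> carrier G" using dz(2) by simp
  ultimately show False using bound lt p(1) w(2) by blast
qed

text \<open>Conjugation by the first reflection of a chain maps the others to the beginning of the
  reverse chain, whose last entry is that first reflection.\<close>

lemma (in dihedral) rotate_alts:
  assumes "a \<in> carrier G" "s # M = map (cj a) (alts p q)"
  shows "map (cj s) M @ [s] = map (cj a) (alts q p)"
proof -
  obtain n where n: "m = Suc n" using m_ge_2 by (cases m) auto
  have "alts p q = p # map (\<lambda>i. cj p (alt q p i)) [0..<n]"
    unfolding alts_def n by (simp add: upt_conv_Cons map_Suc_upt[symmetric] comp_def cj_alt del: upt_Suc)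
  then have s: "s = cj a p" and M: "M = map (\<lambda>i. cj a (cj p (alt q p i))) [0..<n]"
    using assms(2) by (auto simp: comp_def)
  have "cj s (cj a (cj p x)) = cj a x" if "x \<in> carrier G" for x
    using that assms(1) unfolding s by (simp add: cj_def m_assoc inv_mult_group)
  then have "map (cj s) M = map (cj a) (map (alt q p) [0..<n])"
    unfolding M by simp
  moreover have "alts q p = map (alt q p) [0..<n] @ [p]"
    using alt_reflect[of n] n by (simp add: alts_def ord_swap)
  ultimately show ?thesis using s by simp
qed

text \<open>The list counterpart of removing the first letter of a reduced word of the longest
  element and appending the letter that completes it again. Either \<open>s\<close> lies outside the
  conjugate \<open>?D\<close>, whose chain then comes from the conjugate of \<open>?D\<close> by
  \<open>s\<close>, or \<open>s\<close> is the first entry of the chain of \<open>?D\<close> and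
  \<open>rotate_alts\<close> applies.\<close>

lemma (in finite_coxeter_system) refl_order_list_rotate:
  assumes "refl_order_list (s # L)"
  shows "refl_order_list (map (cj s) L @ [s])"
proof -
  have s: "s \<in> S" using assms by (rule refl_order_list_hd_simple)
  have L: "distinct (s # L)" "insert s (set L) = reflections"
    using assms by (auto simp: refl_order_list_def)
  then have Lc: "set L \<subseteq> carrier G" using reflection_carrier by blast
  have dist: "distinct (map (cj s) L @ [s])"
  proof -
    have "cj s x \<noteq> s" if "x \<in> set L" for x
    proof
      assume "cj s x = s"
      then have "x = cj s s" using s that Lc cj_eq_iff[of s x s] by auto
      then show False using s that L(1) by (simp add: cj_def)
    qed
    then have "s \<notin> cj s ` set L" by force
    then show ?thesis
      using L(1) s inj_on_subset[OF inj_on_cj Lc, of s] by (simp add: distinct_map)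
  qed
  have set: "set (map (cj s) L @ [s]) = reflections"
  proof -
    have "cj s ` insert s (set L) = reflections"
      unfolding L(2)
    proof
      show "reflections \<subseteq> cj s ` reflections"
      proof
        fix x assume x: "x \<in> reflections"
        then have "x = cj s (cj s x)" using s by simp
        then show "x \<in> cj s ` reflections" by (rule image_eqI) (use s x in simp)
      qed
    qed (use s in auto)
    then show ?thesis using s by simp
  qed
  show ?thesis
    unfolding refl_order_list_def
  proof (intro conjI allI impI dist set)
    fix a p q assume *: "a \<in> carrier G \<and> p \<in> S \<and> q \<in> S \<and> p \<noteq> q \<and> inversions (inv a) \<inter> dih p q = {}"
    interpret dihedral G S p q using * by (intro dihedralI) auto
    have a: "a \<in> carrier G" "lmin (inv a)" using * by (auto simp: lmin_def)
    let ?D = "cj a ` dih p q"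
    have memD: "t \<in> cj b ` dih p q \<longleftrightarrow> cj (inv b) t \<in> dih p q" if "t \<in> carrier G" "b \<in> carrier G" for t b
      using that mem_cj_image dih_subset by simp
    show "filter (\<lambda>t. t \<in> ?D) (map (cj s) L @ [s]) \<in> {map (cj a) (alts p q), map (cj a) (alts q p)}"
    proof (cases "lmin (inv (s \<otimes> a))")
      case True
      let ?E = "cj (s \<otimes> a) ` dih p q"
      have sE: "x \<in> ?E \<longleftrightarrow> cj s x \<in> ?D" if "x \<in> carrier G" for x
        using that s a by (simp add: memD inv_mult_group)
      have "s \<notin> ?D"
      proof
        \<comment> \<open>If \<open>s = a r a^-1\<close>, then \<open>s a = a r\<close>, and
          \<open>r\<close> is an inversion of the inverse of \<open>s a\<close>, against the case
          assumption.\<close>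
        assume "s \<in> ?D"
        then obtain r where r: "r \<in> dih p q" "s = cj a r" by blast
        then have rc: "r \<in> carrier G" using dih_closed by simp
        have "cj (s \<otimes> a) r = s" using r(2)[symmetric] rc s a cj_cj[of s a r] by simp
        moreover have "s \<in> inversions (s \<otimes> a)"
          using rmin_not_inversion[OF a r(1)] r(2) s a inversions_mult[of s a s] by (simp add: cj_def)
        ultimately have "r \<in> inversions (inv (s \<otimes> a))"
          using inversions_inv[of "s \<otimes> a" r] rc s a by simp
        then show False using True r(1) unfolding lmin_def by blast
      qed
      then have nE: "s \<notin> ?E" using sE[of s] s by simp
      have "filter (\<lambda>t. t \<in> ?D) (map (cj s) L @ [s]) = map (cj s) (filter (\<lambda>t. t \<in> ?E) L)"
        using \<open>s \<notin> ?D\<close> sE Lc by (auto simp: filter_map comp_def intro!: arg_cong[of _ _ "map (cj s)"] filter_cong)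
      also have "filter (\<lambda>t. t \<in> ?E) L = filter (\<lambda>t. t \<in> ?E) (s # L)" using nE by simp
      finally have eq: "filter (\<lambda>t. t \<in> ?D) (map (cj s) L @ [s]) = map (cj s) (filter (\<lambda>t. t \<in> ?E) (s # L))" .
      have "s \<otimes> a \<in> carrier G \<and> p \<in> S \<and> q \<in> S \<and> p \<noteq> q \<and> inversions (inv (s \<otimes> a)) \<inter> dih p q = {}"
        using True * s by (auto simp: lmin_def)
      then have "filter (\<lambda>t. t \<in> ?E) (s # L) \<in> {map (cj (s \<otimes> a)) (alts p q), map (cj (s \<otimes> a)) (alts q p)}"
        using assms unfolding refl_order_list_def by blast
      then have filter_cases: "filter (\<lambda>t. t \<in> ?E) (s # L) = map (cj (s \<otimes> a)) (alts p q) \<or>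
          filter (\<lambda>t. t \<in> ?E) (s # L) = map (cj (s \<otimes> a)) (alts q p)" by blast
      have "map (cj s) (map (cj (s \<otimes> a)) xs) = map (cj a) xs" if "set xs \<subseteq> carrier G" for xs
        using that s a map_cj_map_cj[of s "s \<otimes> a" xs] by simp
      moreover have "set (alts p q) \<subseteq> carrier G" "set (alts q p) \<subseteq> carrier G"
        unfolding set_alts swap.set_alts by auto
      ultimately have
        "map (cj s) (map (cj (s \<otimes> a)) (alts p q)) = map (cj a) (alts p q)"
        "map (cj s) (map (cj (s \<otimes> a)) (alts q p)) = map (cj a) (alts q p)"
        by blast+
      with filter_cases show ?thesis
        unfolding eq by (elim disjE) (simp_all only: insert_iff simp_thms)
    next
      case False
      then obtain r where r: "r \<in> dih p q" "r \<in> inversions (inv (s \<otimes> a))"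
        unfolding lmin_def using s a by auto
      have rc: "r \<in> carrier G" using r dih_closed by simp
      \<comment> \<open>The factor \<open>a\<close> contributes nothing to this inversion of
        \<open>s a\<close>, so the inversion must be \<open>s\<close> itself; hence \<open>s\<close>
        lies in \<open>?D\<close>.\<close>
      have "cj (s \<otimes> a) r \<in> inversions (s \<otimes> a)"
        using inversions_inv[of "s \<otimes> a" r] r rc s a by simp
      moreover have "cj (inv s) (cj (s \<otimes> a) r) = cj a r" using s a rc by simp
      ultimately have "cj (s \<otimes> a) r = s"
        using rmin_not_inversion[OF a r(1)] inversions_mult[of s a "cj (s \<otimes> a) r"] s a rc by auto
      then have "cj s (cj a r) = s" using s a rc by simp
      then have "cj a r = s" using s a rc cj_eq_iff[of s "cj a r" s] by (simp add: cj_def)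
      then have sD: "s \<in> ?D" using r(1) by blast
      have subD: "subgroup ?D G" using subgroup_dih a(1) by (rule subgroup_cj_image)
      have cjD: "cj s x \<in> ?D \<longleftrightarrow> x \<in> ?D" if "x \<in> carrier G" for x
      proof -
        have 1: "cj s y \<in> ?D" if "y \<in> ?D" for y
          using that sD s subgroup.m_closed[OF subD] by (simp add: cj_def)
        have "cj s (cj s x) = x" using that s by simp
        then show ?thesis using 1[of x] 1[of "cj s x"] by auto
      qed
      have "filter (\<lambda>t. t \<in> ?D) (map (cj s) L) = map (cj s) (filter (\<lambda>t. t \<in> ?D) L)"
        using cjD Lc by (auto simp: filter_map comp_def intro!: arg_cong[of _ _ "map (cj s)"] filter_cong)
      then have eq: "filter (\<lambda>t. t \<in> ?D) (map (cj s) L @ [s]) = map (cj s) (filter (\<lambda>t. t \<in> ?D) L) @ [s]"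
        using sD by simp
      have "filter (\<lambda>t. t \<in> ?D) (s # L) \<in> {map (cj a) (alts p q), map (cj a) (alts q p)}"
        using assms * unfolding refl_order_list_def by blast
      then have "s # filter (\<lambda>t. t \<in> ?D) L = map (cj a) (alts p q) \<or>
          s # filter (\<lambda>t. t \<in> ?D) L = map (cj a) (alts q p)" using sD by auto
      then show ?thesis
      proof
        assume "s # filter (\<lambda>t. t \<in> ?D) L = map (cj a) (alts p q)"
        from rotate_alts[OF a(1) this] show ?thesis unfolding eq by simp
      next
        assume "s # filter (\<lambda>t. t \<in> ?D) L = map (cj a) (alts q p)"
        from swap.rotate_alts[OF a(1) this] show ?thesis unfolding eq by simp
      qed
    qed
  qed
qed

text \<open>The letters are the heads of the successive rotations; conjugating by the head turns the
  sequence of the remaining word back into the tail of the list.\<close>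

lemma (in finite_coxeter_system) refl_order_list_word:
  assumes "refl_order_list L" "k \<le> length L"
  obtains ws where "ws \<in> lists S" "refl_seq ws = take k L"
proof -
  have "\<exists>ws\<in>lists S. refl_seq ws = take k L"
    using assms
  proof (induction k arbitrary: L)
    case 0
    then show ?case by (intro bexI[of _ "[]"]) auto
  next
    case (Suc k)
    then obtain s L' where L: "L = s # L'" by (cases L) auto
    have s: "s \<in> S" using Suc.prems refl_order_list_hd_simple L by blast
    have Lc: "set L' \<subseteq> carrier G"
      using Suc.prems(1) L reflection_carrier unfolding refl_order_list_def by (metis list.set_intros(2) subsetI)
    obtain ws where ws: "ws \<in> lists S" "refl_seq ws = take k (map (cj s) L' @ [s])"
      using Suc.IH[OF refl_order_list_rotate, of s L'] Suc.prems L by (auto simp del: take_append)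
    have "map (cj s) (refl_seq ws) = take k L'"
    proof -
      \<comment> \<open>The entry \<open>s\<close> appended by the rotation comes after the first
        \<open>k\<close> entries and is not reached.\<close>
      have "k \<le> length L'" using Suc.prems(2) L by simp
      then have "refl_seq ws = map (cj s) (take k L')" using ws(2) by (simp add: take_map)
      moreover have "set (take k L') \<subseteq> carrier G" using Lc by (auto dest: in_set_takeD)
      ultimately show ?thesis
        using s by (simp add: map_cj_map_cj del: map_map) (auto intro!: map_idI)
    qed
    then show ?case using ws(1) s L by (intro bexI[of _ "s # ws"]) auto
  qed
  then show thesis using that by blast
qed

text \<open>Matsumoto's theorem as an invariance principle. The prefix \<open>us\<close> absorbs
  equal first letters during the induction. Different first letters are both descents, so by
  \<open>both_descents\<close> there are reduced words starting with either alternating word, and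
  one braid move links them. Distinctness is kept for the whole word, so that \<open>braid\<close>
  may assume it.\<close>

theorem (in finite_coxeter_system) braid_invariant_imp_constant:
  assumes braid: "\<And>us p q vs. us \<in> lists S \<Longrightarrow> vs \<in> lists S \<Longrightarrow> p \<in> S \<Longrightarrow> q \<in> S \<Longrightarrow> p \<noteq> q \<Longrightarrow>
      distinct (refl_seq (us @ altw p q (ord (p \<otimes> q)) @ vs)) \<Longrightarrow>
      f (us @ altw p q (ord (p \<otimes> q)) @ vs) = f (us @ altw q p (ord (p \<otimes> q)) @ vs)"
    and "us \<in> lists S" "ws \<in> lists S" "ws' \<in> lists S" "wprod ws = wprod ws'"
    and "distinct (refl_seq (us @ ws))" "distinct (refl_seq (us @ ws'))"
  shows "f (us @ ws) = f (us @ ws')"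
  using assms(2-)
proof (induction "length ws" arbitrary: us ws ws')
  case 0
  have "distinct (refl_seq ws')" using 0 S_lists by (simp add: refl_seq_append distinct_map)
  then have "length ws' = len (wprod ws')" using 0 distinct_imp_reduced[of ws'] by simp
  then show ?case using 0 by auto
next
  case (Suc n)
  have red: "distinct (refl_seq vs)" if "us @ vs \<in> lists S" "distinct (refl_seq (us @ vs))" for vs
  proof -
    have "us \<in> lists (carrier G)" "vs \<in> lists (carrier G)" using that S_lists by auto
    then show ?thesis using that by (simp add: refl_seq_append distinct_map)
  qed
  have lens: "length ws = len (wprod ws)" "length ws' = len (wprod ws)"
    using Suc.prems red[of ws] red[of ws'] distinct_imp_reduced[of ws] distinct_imp_reduced[of ws']
    by simp_all
  obtain s v where ws: "ws = s # v" using Suc.hyps(2) by (cases ws) auto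
  obtain s' v' where ws': "ws' = s' # v'" using Suc.hyps(2) lens by (cases ws') auto
  have step: "f (us @ r # x) = f (us @ r # y)"
    if "r # x \<in> lists S" "r # y \<in> lists S" "wprod (r # x) = wprod (r # y)"
      "distinct (refl_seq (us @ r # x))" "distinct (refl_seq (us @ r # y))" "length (r # x) = length ws" for r x y
  proof -
    have "wprod x = wprod y" using that S_lists[of x] S_lists[of y] by simp
    then show ?thesis
      using Suc.hyps(1)[of x "us @ [r]" y] Suc.hyps(2) Suc.prems(1) that by auto
  qed
  show ?case
  proof (cases "s = s'")
    case True
    then show ?thesis using step[of s v v'] ws ws' Suc.prems by simp
  next
    case False
    let ?w = "wprod ws"
    have w: "?w \<in> carrier G" using Suc.prems S_lists by simp
    interpret dihedral G S s s' using False ws ws' Suc.prems by (intro dihedralI) auto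
    have "s \<in> inversions ?w" "s' \<in> inversions ?w"
      using red[of ws] red[of ws'] Suc.prems inversions_wprod_distinct[of ws] inversions_wprod_distinct[of ws'] ws ws'
      by auto
    then obtain z where z: "lmin z" "?w = aw s s' m \<otimes> z" "len ?w = m + len z"
      using both_descents[OF w] by blast
    obtain vz where vz: "vz \<in> lists S" "wprod vz = z" "length vz = len z"
      by (rule reduced_word_exists[of z]) (use z in simp)
    \<comment> \<open>Both auxiliary words have the product and the length of \<open>ws\<close>, so
      they stay reduced behind the prefix \<open>us\<close>.\<close>
    have wd: "x \<in> lists S \<and> wprod x = ?w \<and> length x = length ws \<and> distinct (refl_seq (us @ x))"
      if x: "x = altw s s' m @ vz \<or> x = altw s' s m @ vz" for x
    proof -
      have A: "altw s s' m \<in> lists S" "altw s' s m \<in> lists S" by (simp_all add: altw_lists)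
      then have xS: "x \<in> lists S" using x vz by auto
      moreover have "wprod x = ?w"
        using x z(2) aw_m wprod_append[OF S_lists[OF A(1)] S_lists[OF vz(1)]]
          wprod_append[OF S_lists[OF A(2)] S_lists[OF vz(1)]] unfolding vz(2) aw_def by metis
      moreover have "length x = length ws" using x vz z(3) lens by auto
      moreover have "len (wprod (us @ ws)) = length (us @ ws)"
        using Suc.prems distinct_imp_reduced[of "us @ ws"] by simp
      moreover have "wprod (us @ x) = wprod (us @ ws)"
        using calculation Suc.prems S_lists by simp
      ultimately show ?thesis
        using Suc.prems distinct_iff_reduced[of "us @ x"] by simp
    qed
    obtain n where n: "m = Suc n" using m_ge_2 by (cases m) auto
    let ?x = "altw s s' m @ vz" and ?y = "altw s' s m @ vz"
    have "f (us @ ws) = f (us @ ?x)"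
      using step[of s v "altw s' s n @ vz"] wd[of ?x] ws Suc.prems n by simp
    also have "\<dots> = f (us @ ?y)"
      using braid[of us vz s s'] Suc.prems vz False ws ws' wd[of ?x] by simp
    also have "\<dots> = f (us @ ws')"
      using step[of s' "altw s s' n @ vz" v'] wd[of ?y] ws' lens Suc.prems n by simp
    finally show ?thesis .
  qed
qed

section \<open>Cosets of dihedral subgroups\<close>

lemma list_rel_Nil [simp]: "list_rel [] = {}"
  by (simp add: list_rel_def)

lemma list_rel_Cons: "list_rel (x # L) = {x} \<times> set (x # L) \<union> list_rel L"
proof (rule Set.set_eqI, clarify)
  fix s t
  have "(s, t) \<in> list_rel (x # L) \<longleftrightarrow> (\<exists>i j. i \<le> j \<and> j < Suc (length L) \<and> s = (x # L) ! i \<and> t = (x # L) ! j)"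
    unfolding list_rel_def by auto
  also have "\<dots> \<longleftrightarrow> s = x \<and> (\<exists>j<Suc (length L). t = (x # L) ! j) \<or>
      (\<exists>i j. i \<le> j \<and> j < length L \<and> s = L ! i \<and> t = L ! j)"
  proof
    assume "\<exists>i j. i \<le> j \<and> j < Suc (length L) \<and> s = (x # L) ! i \<and> t = (x # L) ! j"
    then obtain i j where ij: "i \<le> j" "j < Suc (length L)" "s = (x # L) ! i" "t = (x # L) ! j" by blast
    show "s = x \<and> (\<exists>j<Suc (length L). t = (x # L) ! j) \<or>
      (\<exists>i j. i \<le> j \<and> j < length L \<and> s = L ! i \<and> t = L ! j)"
    proof (cases i)
      case (Suc i')
      then obtain j' where "j = Suc j'" using ij by (cases j) auto
      then have "i' \<le> j' \<and> j' < length L \<and> s = L ! i' \<and> t = L ! j'" using ij Suc by simp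
      then show ?thesis by blast
    qed (use ij in auto)
  next
    assume "s = x \<and> (\<exists>j<Suc (length L). t = (x # L) ! j) \<or>
      (\<exists>i j. i \<le> j \<and> j < length L \<and> s = L ! i \<and> t = L ! j)"
    then show "\<exists>i j. i \<le> j \<and> j < Suc (length L) \<and> s = (x # L) ! i \<and> t = (x # L) ! j"
    proof (elim disjE exE conjE)
      fix j assume "s = x" "j < Suc (length L)" "t = (x # L) ! j"
      then show ?thesis by (intro exI[of _ 0] exI[of _ j]) auto
    next
      fix i j assume "i \<le> j" "j < length L" "s = L ! i" "t = L ! j"
      then show ?thesis by (intro exI[of _ "Suc i"] exI[of _ "Suc j"]) auto
    qed
  qed
  also have "\<dots> \<longleftrightarrow> (s, t) \<in> {x} \<times> set (x # L) \<union> list_rel L"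
    unfolding list_rel_def using in_set_conv_nth[of t "x # L"] by auto
  finally show "(s, t) \<in> list_rel (x # L) \<longleftrightarrow> (s, t) \<in> {x} \<times> set (x # L) \<union> list_rel L" .
qed

lemma list_rel_append: "list_rel (X @ Y) = list_rel X \<union> list_rel Y \<union> set X \<times> set Y"
  by (induction X) (auto simp: list_rel_Cons)

lemma list_rel_subset: "list_rel L \<subseteq> set L \<times> set L"
  by (induction L) (auto simp: list_rel_Cons)

lemma list_rel_rev: "(x, y) \<in> list_rel (rev L) \<longleftrightarrow> (y, x) \<in> list_rel L"
  by (induction L) (auto simp: list_rel_Cons list_rel_append)

lemma antisym_list_rel: "distinct L \<Longrightarrow> (x, y) \<in> list_rel L \<Longrightarrow> (y, x) \<in> list_rel L \<Longrightarrow> x = y"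
proof (induction L)
  case (Cons z L)
  then show ?case using list_rel_subset[of L] by (auto simp: list_rel_Cons)
qed simp

lemma trans_list_rel: "distinct L \<Longrightarrow> (x, y) \<in> list_rel L \<Longrightarrow> (y, z) \<in> list_rel L \<Longrightarrow> (x, z) \<in> list_rel L"
proof (induction L)
  case (Cons w L)
  then show ?case using list_rel_subset[of L] by (auto simp: list_rel_Cons)
qed simp

lemma list_rel_take_drop:
  assumes "x \<in> set (take k L)" "y \<in> set L" "y \<notin> set (take k L)"
  shows "(x, y) \<in> list_rel L"
proof -
  have "y \<in> set (drop k L)" using assms by (metis Un_iff append_take_drop_id set_append)
  then have "(x, y) \<in> list_rel (take k L @ drop k L)" using assms(1) unfolding list_rel_append by blast
  then show ?thesis by simp
qed

text \<open>A comparison with at most one side in the block depends only on the position of the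
  block in the list, so an entry of the block may be replaced by any other one.\<close>

lemma list_rel_reverse_block:
  assumes "distinct (A @ B @ C)"
    and "s \<in> set (A @ B @ C)" "t \<in> set (A @ B @ C)"
    and "s \<in> set B \<longleftrightarrow> s' \<in> set B" "s \<notin> set B \<Longrightarrow> s' = s"
    and "t \<in> set B \<longleftrightarrow> t' \<in> set B" "t \<notin> set B \<Longrightarrow> t' = t"
    and "\<not> (s \<in> set B \<and> t \<in> set B)"
  shows "(s, t) \<in> list_rel (A @ B @ C) \<longleftrightarrow> (s', t') \<in> list_rel (A @ rev B @ C)"
proof -
  have E: "(x, y) \<in> list_rel (A @ B' @ C) \<longleftrightarrow> (x, y) \<in> list_rel A \<or> (x, y) \<in> list_rel B' \<or>
      (x, y) \<in> list_rel C \<or> x \<in> set A \<and> (y \<in> set B' \<or> y \<in> set C) \<or> x \<in> set B' \<and> y \<in> set C" for x y B'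
    by (auto simp: list_rel_append)
  have sub: "(x, y) \<notin> list_rel X" if "x \<notin> set X \<or> y \<notin> set X" for x y :: 'a and X
    using that list_rel_subset[of X] by blast
  consider "s \<in> set B" "t \<notin> set B" | "s \<notin> set B" "t \<in> set B" | "s \<notin> set B" "t \<notin> set B"
    using assms(8) by blast
  then show ?thesis
  proof cases
    case 1
    then have "s' \<in> set B" "t' = t" using assms(4,7) by simp_all
    moreover from this have "s \<notin> set A" "s \<notin> set C" "s' \<notin> set A" "s' \<notin> set C"
      using 1(1) assms(1) by auto
    ultimately show ?thesis using 1 by (simp add: E sub)
  next
    case 2
    then have "t' \<in> set B" "s' = s" using assms(5,6) by simp_all
    moreover from this have "t \<notin> set A" "t \<notin> set C" "t' \<notin> set A" "t' \<notin> set C"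
      using 2(2) assms(1) by auto
    ultimately show ?thesis using 2 by (simp add: E sub)
  next
    case 3
    then have "t' = t" "s' = s" using assms(5,7) by simp_all
    then show ?thesis using 3 by (simp add: E sub)
  qed
qed

section \<open>Midpoints and labels of paths\<close>

context coxeter_system
begin

lemma midpoints_iff:
  assumes "u \<in> carrier G" "v \<in> carrier G"
  shows "x \<in> midpoints u v \<longleftrightarrow> bruhat_edge u x \<and> bruhat_edge x v"
proof
  assume "x \<in> midpoints u v"
  then obtain p where x: "x \<notin> {u, v}" "p \<in> paths 2 u v" "x \<in> set p" by (auto simp: midpoints_def)
  then have p: "length p = 3" "p ! 0 = u" "p ! 2 = v" "\<And>i. i < 2 \<Longrightarrow> bruhat_edge (p ! i) (p ! Suc i)"
    by (auto simp: paths_def)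
  obtain j where j: "j < 3" "x = p ! j" using x(3) p(1) by (metis in_set_conv_nth)
  have "j \<noteq> 0" "j \<noteq> 2" using x(1) j(2) p(2,3) by (metis insertCI)+
  then have "j = 1" using j by simp
  then show "bruhat_edge u x \<and> bruhat_edge x v" using p(4)[of 0] p(4)[of 1] p(2,3) j by (simp add: numeral_2_eq_2)
next
  assume e: "bruhat_edge u x \<and> bruhat_edge x v"
  then have "x \<notin> {u, v}" "x \<in> carrier G" by (auto simp: bruhat_edge_def)
  moreover have "[u, x, v] \<in> paths 2 u v"
    using e assms calculation by (auto simp: paths_def less_Suc_eq numeral_2_eq_2)
  ultimately show "x \<in> midpoints u v" unfolding midpoints_def by force
qed

lemma length_path_labels [simp]: "length (path_labels p) = length p - 1"
  by (simp add: path_labels_def)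

lemma nth_path_labels: "i < length p - 1 \<Longrightarrow> path_labels p ! i = p ! Suc i \<otimes> inv (p ! i)"
  by (simp add: path_labels_def)

lemma increasing_list_rel_iff:
  assumes "distinct L"
  shows "increasing (list_rel L) p \<longleftrightarrow>
    (\<forall>i. Suc i < length p - 1 \<longrightarrow> (path_labels p ! i, path_labels p ! Suc i) \<in> list_rel L)"
proof -
  have "transp (\<lambda>s t. (s, t) \<in> list_rel L)"
    using trans_list_rel[OF assms] by (auto intro: transpI)
  then show ?thesis
    unfolding increasing_def by (simp add: sorted_wrt_iff_nth_Suc_transp)
qed

end

section \<open>The Bruhat graph on a coset of a dihedral subgroup\<close>

locale dihedral_coset = dihedral +
  fixes a
  assumes a_closed [simp]: "a \<in> carrier G" and a_rmin: "lmin (inv a)"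

lemma (in dihedral) lmin_swap: "swap.lmin z \<longleftrightarrow> lmin z"
  unfolding lmin_def swap.lmin_def dih_swap ..

sublocale dihedral_coset \<subseteq> swap: dihedral_coset G S q p a
proof unfold_locales
  show "a \<in> carrier G" by (rule a_closed)
  show "swap.lmin (inv a)" unfolding lmin_swap by (rule a_rmin)
qed

context dihedral_coset
begin

abbreviation D :: "'a set" where
  "D \<equiv> cj a ` dih p q"

(* The length of x inside its coset D x. *)
definition lev :: "'a \<Rightarrow> nat" where
  "lev x = card (inversions x \<inter> D)"

text \<open>The partner of \<open>x\<close> on its level; the description is known to be proper
  strictly between bottom and top of the coset, see \<open>star_ex1\<close>.\<close>

definition star :: "'a \<Rightarrow> 'a" where
  "star x = (THE y. y \<in> carrier G \<and> y \<otimes> inv x \<in> D \<and> y \<noteq> x \<and> lev y = lev x)"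

lemma subgroup_D: "subgroup D G"
  using subgroup_dih a_closed by (rule subgroup_cj_image)

lemma D_iff: "t \<in> carrier G \<Longrightarrow> t \<in> D \<longleftrightarrow> cj (inv a) t \<in> dih p q"
  using mem_cj_image[OF a_closed _ dih_subset] .

lemma coset_refl: "x \<in> carrier G \<Longrightarrow> x \<otimes> inv x \<in> D"
  using subgroup.one_closed[OF subgroup_D] by simp

lemma coset_sym:
  assumes "x \<in> carrier G" "y \<in> carrier G" "y \<otimes> inv x \<in> D"
  shows "x \<otimes> inv y \<in> D"
  using subgroup.m_inv_closed[OF subgroup_D assms(3)] assms by (simp add: inv_mult_group)

lemma coset_trans:
  assumes "x \<in> carrier G" "y \<in> carrier G" "z \<in> carrier G" "y \<otimes> inv x \<in> D" "z \<otimes> inv y \<in> D"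
  shows "z \<otimes> inv x \<in> D"
proof -
  have "z \<otimes> inv x = (z \<otimes> inv y) \<otimes> (y \<otimes> inv x)" using assms by (simp add: m_assoc)
  then show ?thesis using subgroup.m_closed[OF subgroup_D assms(5,4)] by simp
qed

lemma coset_repr:
  assumes "x \<in> carrier G"
  obtains d z where "d \<in> dih p q" "lmin z" "x = a \<otimes> (d \<otimes> z)"
proof -
  obtain d z where dz: "d \<in> dih p q" "lmin z" "inv a \<otimes> x = d \<otimes> z"
    by (rule lmin_decomp[of "inv a \<otimes> x"]) (use assms in simp)
  have "a \<otimes> (inv a \<otimes> x) = a \<otimes> (d \<otimes> z)" unfolding dz(3) ..
  then show thesis using that[OF dz(1,2)] assms by simp
qed

text \<open>\<open>a\<close> has no inversions in \<open>D\<close> and \<open>z\<close> has none in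
  the standard subgroup, so only the factor \<open>d\<close> contributes.\<close>

lemma inversions_repr:
  assumes "d \<in> dih p q" "lmin z"
  shows "inversions (a \<otimes> (d \<otimes> z)) \<inter> D = cj a ` inversions d"
proof -
  have dz: "d \<in> carrier G" "z \<in> carrier G" using assms dih_closed by auto
  have *: "cj a t \<in> inversions (a \<otimes> (d \<otimes> z)) \<longleftrightarrow> t \<in> inversions d" if t: "t \<in> dih p q" for t
  proof -
    have tc: "t \<in> carrier G" using t dih_closed by simp
    have "cj a t \<in> inversions (a \<otimes> (d \<otimes> z)) \<longleftrightarrow> t \<in> inversions (d \<otimes> z)"
      using rmin_not_inversion[OF a_closed a_rmin t] tc dz
        inversions_mult[of a "d \<otimes> z" "cj a t"] by simp
    then show ?thesis using inversions_decomp[OF assms] t by blast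
  qed
  show ?thesis
  proof (rule Set.set_eqI)
    fix x
    show "x \<in> inversions (a \<otimes> (d \<otimes> z)) \<inter> D \<longleftrightarrow> x \<in> cj a ` inversions d"
    proof
      assume "x \<in> inversions (a \<otimes> (d \<otimes> z)) \<inter> D"
      then obtain t where "t \<in> dih p q" "x = cj a t" "cj a t \<in> inversions (a \<otimes> (d \<otimes> z))" by auto
      then show "x \<in> cj a ` inversions d" using * by simp
    next
      assume "x \<in> cj a ` inversions d"
      then obtain t where t: "t \<in> inversions d" "x = cj a t" by auto
      then have "t \<in> dih p q" using inversions_dih[OF assms(1)] by auto
      then show "x \<in> inversions (a \<otimes> (d \<otimes> z)) \<inter> D" using * t by simp
    qed
  qed
qed

lemma lev_repr:
  assumes "d \<in> dih p q" "lmin z"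
  shows "lev (a \<otimes> (d \<otimes> z)) = len d"
proof -
  have "inj_on (cj a) (inversions d)"
    using inj_on_cj[OF a_closed] inversions_dih[OF assms(1)] dih_subset by (meson inj_on_subset subset_trans)
  then show ?thesis
    unfolding lev_def inversions_repr[OF assms]
    using assms dih_closed by (simp add: card_image card_inversions)
qed

lemma lev_le: "x \<in> carrier G \<Longrightarrow> lev x \<le> m"
  by (metis coset_repr lev_repr dih_len_le)

lemma coset_repr_iff:
  assumes "d \<in> dih p q" "lmin z" "y \<in> carrier G"
  shows "y \<otimes> inv (a \<otimes> (d \<otimes> z)) \<in> D \<longleftrightarrow> (\<exists>e\<in>dih p q. y = a \<otimes> (e \<otimes> z))"
proof
  have dz [simp]: "d \<in> carrier G" "z \<in> carrier G" using assms dih_closed by auto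
  assume "y \<otimes> inv (a \<otimes> (d \<otimes> z)) \<in> D"
  then obtain g where g: "g \<in> dih p q" "y \<otimes> inv (a \<otimes> (d \<otimes> z)) = cj a g" by blast
  then have gc: "g \<in> carrier G" using dih_closed by simp
  have "y = (y \<otimes> inv (a \<otimes> (d \<otimes> z))) \<otimes> (a \<otimes> (d \<otimes> z))"
    using assms by (simp add: m_assoc del: inv_mult_group)
  also have "\<dots> = a \<otimes> ((g \<otimes> d) \<otimes> z)" unfolding g(2) using gc by (simp add: cj_def m_assoc)
  finally show "\<exists>e\<in>dih p q. y = a \<otimes> (e \<otimes> z)" using g(1) assms(1) dih_mult by blast
next
  have dz [simp]: "d \<in> carrier G" "z \<in> carrier G" using assms dih_closed by auto
  assume "\<exists>e\<in>dih p q. y = a \<otimes> (e \<otimes> z)"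
  then obtain e where e: "e \<in> dih p q" "y = a \<otimes> (e \<otimes> z)" by blast
  then have "y \<otimes> inv (a \<otimes> (d \<otimes> z)) = cj a (e \<otimes> inv d)"
    using dih_closed[OF e(1)] by (simp add: cj_def m_assoc inv_mult_group)
  then show "y \<otimes> inv (a \<otimes> (d \<otimes> z)) \<in> D" using e(1) assms(1) by simp
qed

text \<open>For \<open>x = a d z\<close> and \<open>y = a e z\<close> the label is the conjugate of
  \<open>e d^-1\<close> by \<open>a\<close>. Whether it is a reflection is a matter of parity in the
  dihedral group, and it is an inversion of \<open>y\<close> exactly if \<open>e d^-1\<close> is one
  of \<open>e\<close>; so the edges are those between \<open>d\<close> and \<open>e\<close>.\<close>

lemma edge_iff:
  assumes "x \<in> carrier G" "y \<in> carrier G" "y \<otimes> inv x \<in> D"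
  shows "bruhat_edge x y \<longleftrightarrow> lev x < lev y \<and> odd (lev x) \<noteq> odd (lev y)"
proof -
  obtain d z where dz: "d \<in> dih p q" "lmin z" "x = a \<otimes> (d \<otimes> z)"
    by (rule coset_repr[OF assms(1)])
  obtain e where e: "e \<in> dih p q" "y = a \<otimes> (e \<otimes> z)"
    using coset_repr_iff[OF dz(1,2) assms(2)] assms(3) unfolding dz(3) by blast
  have c [simp]: "d \<in> carrier G" "z \<in> carrier G" "e \<in> carrier G" using dz e dih_closed by auto
  let ?t = "e \<otimes> inv d"
  have t: "?t \<in> dih p q" using dz(1) e(1) by simp
  have yx: "y \<otimes> inv x = cj a ?t"
    unfolding dz(3) e(2) by (simp add: cj_def m_assoc inv_mult_group)
  have refl: "y \<otimes> inv x \<in> reflections \<longleftrightarrow> odd (len d) \<noteq> odd (len e)"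
    unfolding yx using dih_reflection_iff[OF t] by (auto simp: even_len_mult)
  have less: "len x < len y \<longleftrightarrow> len d < len e" if r: "y \<otimes> inv x \<in> reflections"
  proof -
    have tr: "?t \<in> reflections" using r unfolding yx by simp
    have "d = inv ?t \<otimes> e" by (simp add: inv_mult_group m_assoc)
    then have d: "?t \<otimes> e = d" using tr by simp
    have "x = inv (y \<otimes> inv x) \<otimes> y" using assms by (simp add: inv_mult_group m_assoc)
    then have "cj a ?t \<otimes> y = x" using r unfolding yx[symmetric] by simp
    then have "len x < len y \<longleftrightarrow> cj a ?t \<in> inversions y"
      using tr by (simp add: inversions_def)
    also have "\<dots> \<longleftrightarrow> cj a ?t \<in> inversions y \<inter> D" using t by blast
    also have "\<dots> \<longleftrightarrow> ?t \<in> inversions e"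
    proof -
      have "cj a ?t \<in> cj a ` inversions e \<longleftrightarrow> ?t \<in> inversions e"
        using inj_on_image_mem_iff[OF inj_on_cj[OF a_closed], of ?t "inversions e"]
          inversions_dih[OF e(1)] dih_subset by (simp add: subset_trans)
      then show ?thesis unfolding e(2) inversions_repr[OF e(1) dz(2)] .
    qed
    also have "\<dots> \<longleftrightarrow> len d < len e" using tr d by (simp add: inversions_def)
    finally show ?thesis .
  qed
  have "lev x = len d" "lev y = len e"
    using lev_repr dz(1,2) e(1) unfolding dz(3) e(2) by auto
  then show ?thesis using refl less assms unfolding bruhat_edge_def by auto
qed

text \<open>\<open>q\<close> is an inversion of the word beginning with \<open>q\<close>, but it
  comes last in the chain from \<open>p\<close> and is missing from a proper initial segment of
  it.\<close>

lemma aw_neq: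
  assumes "0 < k" "k < m"
  shows "aw p q k \<noteq> aw q p k"
proof
  assume "aw p q k = aw q p k"
  then have "alt p q ` {..<k} = alt q p ` {..<k}"
    using inversions_aw[of k] swap.inversions_aw[of k] assms by (simp add: ord_swap)
  moreover have "alt q p 0 \<in> alt q p ` {..<k}" using assms(1) by blast
  ultimately obtain i where i: "i < k" "alt q p 0 = alt p q i" by auto
  then have "alt p q (m - 1) = alt p q i" using alt_reflect[of 0] assms by simp
  then have "m - 1 = i" using inj_onD[OF inj_on_alt, of "m - 1" i] i assms by auto
  then show False using i assms by simp
qed

lemma coset_levels:
  assumes "x \<in> carrier G"
  obtains z where "lmin z"
    "\<forall>y\<in>carrier G. y \<otimes> inv x \<in> D \<longleftrightarrow> (\<exists>k\<le>m. y = a \<otimes> (aw p q k \<otimes> z) \<or> y = a \<otimes> (aw q p k \<otimes> z))"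
    "\<forall>k\<le>m. lev (a \<otimes> (aw p q k \<otimes> z)) = k \<and> lev (a \<otimes> (aw q p k \<otimes> z)) = k"
proof -
  obtain d z where dz: "d \<in> dih p q" "lmin z" "x = a \<otimes> (d \<otimes> z)"
    by (rule coset_repr[OF assms])
  have dihs: "aw p q k \<in> dih p q" "aw q p k \<in> dih p q" if "k \<le> m" for k
    using that aw_in_dih swap.aw_in_dih by (auto simp: dih_swap ord_swap)
  show thesis
  proof (rule that[OF dz(2)])
    show "\<forall>y\<in>carrier G. y \<otimes> inv x \<in> D \<longleftrightarrow> (\<exists>k\<le>m. y = a \<otimes> (aw p q k \<otimes> z) \<or> y = a \<otimes> (aw q p k \<otimes> z))"
    proof
      fix y assume y: "y \<in> carrier G"
      show "y \<otimes> inv x \<in> D \<longleftrightarrow> (\<exists>k\<le>m. y = a \<otimes> (aw p q k \<otimes> z) \<or> y = a \<otimes> (aw q p k \<otimes> z))"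
        unfolding dz(3) coset_repr_iff[OF dz(1,2) y] using dihs by (metis dih_cases)
    qed
    show "\<forall>k\<le>m. lev (a \<otimes> (aw p q k \<otimes> z)) = k \<and> lev (a \<otimes> (aw q p k \<otimes> z)) = k"
      using lev_repr[OF dihs(1) dz(2)] lev_repr[OF dihs(2) dz(2)] len_aw swap.len_aw by (auto simp: ord_swap)
  qed
qed

lemma coset_level_exists:
  assumes "x \<in> carrier G" "k \<le> m"
  obtains y where "y \<in> carrier G" "y \<otimes> inv x \<in> D" "lev y = k"
proof -
  obtain z where z: "lmin z"
    "\<forall>y\<in>carrier G. y \<otimes> inv x \<in> D \<longleftrightarrow> (\<exists>k\<le>m. y = a \<otimes> (aw p q k \<otimes> z) \<or> y = a \<otimes> (aw q p k \<otimes> z))"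
    "\<forall>k\<le>m. lev (a \<otimes> (aw p q k \<otimes> z)) = k \<and> lev (a \<otimes> (aw q p k \<otimes> z)) = k"
    by (rule coset_levels[OF assms(1)])
  show thesis
  proof (rule that)
    show c: "a \<otimes> (aw p q k \<otimes> z) \<in> carrier G" using z(1) by simp
    show "(a \<otimes> (aw p q k \<otimes> z)) \<otimes> inv x \<in> D" using z(2) c assms(2) by blast
    show "lev (a \<otimes> (aw p q k \<otimes> z)) = k" using z(3) assms(2) by blast
  qed
qed

text \<open>Levels of equal parity are not joined by an edge, but two edges through an element one
  level above \<open>x\<close> connect them.\<close>

lemma lev_less_imp_len_less:
  assumes "x \<in> carrier G" "y \<in> carrier G" "y \<otimes> inv x \<in> D" "lev x < lev y"
  shows "len x < len y"
proof (cases "odd (lev x) = odd (lev y)")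
  case False
  then show ?thesis using edge_iff[OF assms(1-3)] assms(4) by (simp add: bruhat_edge_def)
next
  case True
  have "Suc (lev x) \<le> m" using lev_le[OF assms(2)] assms(4) by simp
  then obtain w where w: "w \<in> carrier G" "w \<otimes> inv x \<in> D" "lev w = Suc (lev x)"
    using coset_level_exists[OF assms(1)] by blast
  have "lev y \<noteq> Suc (lev x)" using True by auto
  then have "lev w < lev y" using w(3) assms(4) by simp
  moreover have "y \<otimes> inv w \<in> D"
    using coset_trans[OF w(1) assms(1,2) _ assms(3)] coset_sym[OF assms(1) w(1,2)] by simp
  ultimately have "bruhat_edge w y" using edge_iff[OF w(1) assms(2)] w(3) True by simp
  moreover have "bruhat_edge x w" using edge_iff[OF assms(1) w(1,2)] w(3) by simp
  ultimately show ?thesis by (auto simp: bruhat_edge_def)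
qed

lemma star_ex1:
  assumes "x \<in> carrier G" "0 < lev x" "lev x < m"
  shows "\<exists>!y. y \<in> carrier G \<and> y \<otimes> inv x \<in> D \<and> y \<noteq> x \<and> lev y = lev x"
proof -
  let ?k = "lev x"
  obtain z where z: "lmin z"
    and mem: "\<forall>y\<in>carrier G. y \<otimes> inv x \<in> D \<longleftrightarrow> (\<exists>k\<le>m. y = a \<otimes> (aw p q k \<otimes> z) \<or> y = a \<otimes> (aw q p k \<otimes> z))"
    and lv: "\<forall>k\<le>m. lev (a \<otimes> (aw p q k \<otimes> z)) = k \<and> lev (a \<otimes> (aw q p k \<otimes> z)) = k"
    by (rule coset_levels[OF assms(1)])
  let ?P = "a \<otimes> (aw p q ?k \<otimes> z)" and ?Q = "a \<otimes> (aw q p ?k \<otimes> z)"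
  have c: "?P \<in> carrier G" "?Q \<in> carrier G" using z swap.aw_closed by auto
  have ne: "?P \<noteq> ?Q" using aw_neq[OF assms(2,3)] z swap.aw_closed by auto
  have two: "y = ?P \<or> y = ?Q" if y: "y \<in> carrier G" "y \<otimes> inv x \<in> D" "lev y = ?k" for y
  proof -
    obtain k where "k \<le> m" "y = a \<otimes> (aw p q k \<otimes> z) \<or> y = a \<otimes> (aw q p k \<otimes> z)"
      using mem y(1,2) by blast
    moreover from this have "k = ?k" using lv y(3) by metis
    ultimately show ?thesis by blast
  qed
  have in_coset: "?P \<otimes> inv x \<in> D" "?Q \<otimes> inv x \<in> D" using mem c assms(3) less_imp_le by blast+
  have lev: "lev ?P = ?k" "lev ?Q = ?k" using lv assms(3) by auto
  have "x = ?P \<or> x = ?Q" using two[OF assms(1) coset_refl[OF assms(1)]] by simp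
  then show ?thesis
  proof
    assume x: "x = ?P"
    show ?thesis
    proof (rule ex1I[of _ ?Q])
      show "?Q \<in> carrier G \<and> ?Q \<otimes> inv x \<in> D \<and> ?Q \<noteq> x \<and> lev ?Q = ?k"
        using c in_coset lev ne x by metis
    qed (use two x in metis)
  next
    assume x: "x = ?Q"
    show ?thesis
    proof (rule ex1I[of _ ?P])
      show "?P \<in> carrier G \<and> ?P \<otimes> inv x \<in> D \<and> ?P \<noteq> x \<and> lev ?P = ?k"
        using c in_coset lev ne x by metis
    qed (use two x in metis)
  qed
qed

lemma star:
  assumes "x \<in> carrier G" "0 < lev x" "lev x < m"
  shows "star x \<in> carrier G" "star x \<otimes> inv x \<in> D" "star x \<noteq> x" "lev (star x) = lev x"
  using theI'[OF star_ex1[OF assms]] unfolding star_def by blast+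

lemma star_unique:
  assumes "x \<in> carrier G" "0 < lev x" "lev x < m" "y \<in> carrier G" "y \<otimes> inv x \<in> D" "y \<noteq> x" "lev y = lev x"
  shows "y = star x"
  unfolding star_def
  by (rule the1_equality[OF star_ex1[OF assms(1-3)], symmetric]) (intro conjI assms)

lemma star_star:
  assumes "x \<in> carrier G" "0 < lev x" "lev x < m"
  shows "star (star x) = x"
  by (rule star_unique[symmetric])
     (use star[OF assms] assms coset_sym[OF assms(1) star(1,2)[OF assms]] in simp_all)

end

section \<open>Flips and increasing paths\<close>

lemma (in dihedral) rev_alts: "rev (alts p q) = alts q p"
proof (rule nth_equalityI)
  fix i assume "i < length (rev (alts p q))"
  then have "i < m" by (simp add: alts_def)
  then show "rev (alts p q) ! i = alts q p ! i"
    using alt_reflect[of i] by (simp add: alts_def rev_nth ord_swap)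
qed (simp add: alts_def ord_swap)

context coxeter_system
begin

lemma edge_label:
  assumes "bruhat_edge u x"
  shows "x \<otimes> inv u \<in> reflections" "x \<otimes> inv u \<in> inversions x" "x \<otimes> inv u \<notin> inversions u"
proof -
  have c: "u \<in> carrier G" "x \<in> carrier G" and l: "len u < len x" and r: "x \<otimes> inv u \<in> reflections"
    using assms by (auto simp: bruhat_edge_def)
  have "inv (x \<otimes> inv u) \<otimes> x = u" using c by (simp add: inv_mult_group m_assoc)
  then have "(x \<otimes> inv u) \<otimes> x = u" using r by (simp del: inv_mult_group)
  moreover have "(x \<otimes> inv u) \<otimes> u = x" using c by (simp add: m_assoc)
  ultimately show "x \<otimes> inv u \<in> reflections" "x \<otimes> inv u \<in> inversions x" "x \<otimes> inv u \<notin> inversions u"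
    using l r by (simp_all add: inversions_def)
qed

lemma pathsD:
  assumes "p \<in> paths h u v"
  shows "length p = Suc h" "i \<le> h \<Longrightarrow> p ! i \<in> carrier G" "i < h \<Longrightarrow> bruhat_edge (p ! i) (p ! Suc i)"
  using assms nth_mem[of i p] unfolding paths_def by auto

end

context dihedral_coset
begin

lemma product_in_D:
  assumes "r \<in> reflections" "r' \<in> reflections" "r \<noteq> r'" "r \<otimes> r' \<in> D"
  shows "r \<in> D" "r' \<in> D"
proof -
  have rc: "r \<in> carrier G" "r' \<in> carrier G" using assms by auto
  have "cj (inv a) r \<noteq> cj (inv a) r'" using assms(3) rc by (simp add: cj_eq_iff)
  moreover have "cj (inv a) r \<otimes> cj (inv a) r' \<in> dih p q"
    using assms(4) rc D_iff[of "r \<otimes> r'"] by (simp add: cj_mult)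
  moreover have "cj (inv a) r \<in> reflections" "cj (inv a) r' \<in> reflections"
    using assms(1,2) by simp_all
  ultimately have "cj (inv a) r \<in> dih p q"
    using reflection_product_in_dih by metis
  then show r: "r \<in> D" using D_iff rc by simp
  have "r' = r \<otimes> (r \<otimes> r')" using assms rc by simp
  then show "r' \<in> D" using subgroup.m_closed[OF subgroup_D r assms(4)] by simp
qed

text \<open>The two labels at a midpoint \<open>w\<close> have the product
  \<open>v \<otimes> inv u\<close> in \<open>D\<close> and are distinct because \<open>u\<close> and
  \<open>v\<close> differ. So \<open>product_in_D\<close> puts them into \<open>D\<close>, and no
  midpoint of the whole group lies outside the coset; \<open>edge_iff\<close> does the rest.\<close>

lemma midpoints_coset:
  assumes "bruhat_edge u x" "bruhat_edge x v" "x \<otimes> inv u \<in> D" "v \<otimes> inv x \<in> D"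
  shows "w \<in> midpoints u v \<longleftrightarrow> w \<in> carrier G \<and> w \<otimes> inv u \<in> D \<and> lev u < lev w \<and> lev w < lev v \<and>
    odd (lev w) \<noteq> odd (lev u)"
proof -
  have c: "u \<in> carrier G" "x \<in> carrier G" "v \<in> carrier G" and l: "len u < len v"
    using assms(1,2) by (auto simp: bruhat_edge_def)
  have vu: "v \<otimes> inv u \<in> D" using coset_trans[OF c assms(3,4)] .
  have par: "odd (lev v) = odd (lev u)"
    using assms edge_iff[OF c(1,2) assms(3)] edge_iff[OF c(2,3) assms(4)] by auto
  have in_coset: "w \<otimes> inv u \<in> D" if w: "bruhat_edge u w" "bruhat_edge w v"
  proof -
    have wc: "w \<in> carrier G" using w by (simp add: bruhat_edge_def)
    have prod: "(v \<otimes> inv w) \<otimes> (w \<otimes> inv u) = v \<otimes> inv u" using c wc by (simp add: m_assoc)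
    have ne: "v \<otimes> inv w \<noteq> w \<otimes> inv u"
    proof
      assume eq: "v \<otimes> inv w = w \<otimes> inv u"
      have "v \<otimes> inv u = \<one>" using prod edge_label(1)[OF w(1)] unfolding eq by simp
      then have "v = u" using c by (metis inv_equality inv_closed inv_inv)
      then show False using l by simp
    qed
    show ?thesis
      using product_in_D(2)[OF edge_label(1)[OF w(2)] edge_label(1)[OF w(1)] ne] vu unfolding prod by blast
  qed
  have vw: "v \<otimes> inv w \<in> D" if "w \<in> carrier G" "w \<otimes> inv u \<in> D"
    using coset_trans[OF that(1) c(1,3) coset_sym[OF c(1) that] vu] .
  show ?thesis
  proof
    assume "w \<in> midpoints u v"
    then have w: "bruhat_edge u w" "bruhat_edge w v" using midpoints_iff[OF c(1,3)] by auto
    then have wc: "w \<in> carrier G" by (simp add: bruhat_edge_def)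
    have wu: "w \<otimes> inv u \<in> D" by (rule in_coset[OF w])
    show "w \<in> carrier G \<and> w \<otimes> inv u \<in> D \<and> lev u < lev w \<and> lev w < lev v \<and> odd (lev w) \<noteq> odd (lev u)"
      using w wc wu edge_iff[OF c(1) wc wu] edge_iff[OF wc c(3) vw[OF wc wu]] by blast
  next
    assume w: "w \<in> carrier G \<and> w \<otimes> inv u \<in> D \<and> lev u < lev w \<and> lev w < lev v \<and> odd (lev w) \<noteq> odd (lev u)"
    then have "bruhat_edge u w" using edge_iff[OF c(1)] by blast
    moreover have "bruhat_edge w v" using w par vw edge_iff[OF _ c(3), of w] by blast
    ultimately show "w \<in> midpoints u v" using midpoints_iff[OF c(1,3)] by blast
  qed
qed

text \<open>Between different levels the lengths follow the levels, whereas the two elements on one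
  level may have lengths in any order. The condition in \<open>flip\<close> does not compare a point
  with its own image, which is what admits the exchange of these two.\<close>

lemma flip_eq_star:
  assumes "bruhat_edge u x" "bruhat_edge x v" "x \<otimes> inv u \<in> D" "v \<otimes> inv x \<in> D"
  shows "flip u v x = star x"
proof -
  define X where "X = midpoints u v"
  note mid = midpoints_coset[OF assms, folded X_def]
  have c: "u \<in> carrier G" "x \<in> carrier G" "v \<in> carrier G"
    using assms(1,2) by (auto simp: bruhat_edge_def)
  have Xu: "w \<in> carrier G" "w \<otimes> inv u \<in> D" if "w \<in> X" for w
    using that mid[of w] by simp_all
  have coset: "w' \<otimes> inv w \<in> D" if "w \<in> X" "w' \<in> X" for w w'
    using coset_trans[OF Xu(1)[OF that(1)] c(1) Xu(1)[OF that(2)] coset_sym[OF c(1) Xu[OF that(1)]] Xu(2)[OF that(2)]] .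
  have Xc: "w \<in> carrier G" "0 < lev w" "lev w < m" if "w \<in> X" for w
    using that mid[of w] lev_le[OF c(3)] by auto
  have starX: "star w \<in> X" if w: "w \<in> X" for w
  proof -
    have "star w \<otimes> inv u \<in> D"
      using coset_trans[OF c(1) Xc(1)[OF w] star(1)[OF Xc[OF w]] Xu(2)[OF w] star(2)[OF Xc[OF w]]] .
    then show ?thesis using mid[of w] mid[of "star w"] star[OF Xc[OF w]] w by simp
  qed
  have lenX: "len w < len w'" if "w \<in> X" "w' \<in> X" "lev w < lev w'" for w w'
    using lev_less_imp_len_less[OF Xc(1)[OF that(1)] Xc(1)[OF that(2)] coset[OF that(1,2)] that(3)] .
  define good where "good f \<longleftrightarrow> f \<in> X \<rightarrow>\<^sub>E X \<and> (\<forall>x\<in>X. f x \<noteq> x \<and> f (f x) = x) \<and>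
      (\<forall>x\<^sub>1\<in>X. \<forall>x\<^sub>2\<in>X. len x\<^sub>1 < len x\<^sub>2 \<and> x\<^sub>2 \<noteq> f x\<^sub>1 \<longrightarrow> len (f x\<^sub>1) < len (f x\<^sub>2))" for f
  have good: "good (restrict star X)"
  proof -
    have "len (star w) < len (star w')" if w: "w \<in> X" "w' \<in> X" "len w < len w'" "w' \<noteq> star w" for w w'
    proof -
      have "\<not> lev w' < lev w" using lenX[OF w(2,1)] w(3) by auto
      moreover have "lev w' \<noteq> lev w"
        using star_unique[OF Xc[OF w(1)] Xc(1)[OF w(2)] coset[OF w(1,2)]] w(3,4) by auto
      ultimately have "lev (star w) < lev (star w')"
        using star(4)[OF Xc[OF w(1)]] star(4)[OF Xc[OF w(2)]] by simp
      then show ?thesis using lenX starX w by blast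
    qed
    then show ?thesis
      unfolding good_def using starX star_star[OF Xc] star(3)[OF Xc] by auto
  qed
  have uniq: "f = restrict star X" if f: "good f" for f
  proof -
    have fX: "f w \<in> X" "f w \<noteq> w" "f (f w) = w" if "w \<in> X" for w
      using f that unfolding good_def by auto
    have fmono: "len (f w) < len (f w')" if "w \<in> X" "w' \<in> X" "len w < len w'" "w' \<noteq> f w" for w w'
      using f that unfolding good_def by blast
    have other: "w' = star w" if "w \<in> X" "w' \<in> X" "w' \<noteq> w" "lev w' = lev w" for w w'
      using star_unique[OF Xc[OF that(1)] Xc(1)[OF that(2)] coset[OF that(1,2)]] that by blast
    (* By induction on the level: if f w lay above the level of w, then so would f (star w), and
       monotonicity of f, applied to star w and f w, would put f (star w) below w. *)
    have "f w = star w" if "w \<in> X" for w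
      using that
    proof (induction "lev w" arbitrary: w rule: less_induct)
      case less
      note w = \<open>w \<in> X\<close>
      \<comment> \<open>An image on a lower level would fall under the induction hypothesis, and
        \<open>f\<close> would keep it on that lower level instead of sending it back to
        \<open>w'\<close>.\<close>
      have lev_ge: "lev w \<le> lev (f w')" if w': "w' \<in> X" "lev w' = lev w" for w'
      proof (rule ccontr)
        assume lt: "\<not> lev w \<le> lev (f w')"
        then have "f (f w') = star (f w')" using less.hyps[of "f w'"] fX(1)[OF w'(1)] by simp
        then have "w' = star (f w')" using fX(3)[OF w'(1)] by simp
        then have "lev w' = lev (f w')" using star(4)[OF Xc[OF fX(1)[OF w'(1)]]] by simp
        then show False using lt w'(2) by simp
      qed
      show ?case
      proof (rule ccontr)
        assume neq: "f w \<noteq> star w"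
        let ?w' = "star w"
        have w': "?w' \<in> X" "lev ?w' = lev w" "?w' \<noteq> w"
          using starX[OF w] star(3,4)[OF Xc[OF w]] by auto
        have "lev (f w) \<noteq> lev w" using other[OF w fX(1,2)[OF w]] neq by blast
        then have up: "lev w < lev (f w)" using lev_ge[OF w] by simp
        have "lev (f ?w') \<noteq> lev w"
        proof
          assume "lev (f ?w') = lev w"
          then have "f ?w' = star ?w'" using other[OF w'(1) fX(1,2)[OF w'(1)]] w'(2) by simp
          then have "f ?w' = w" using star_star[OF Xc[OF w]] by simp
          then have "f w = ?w'" using fX(3)[OF w'(1)] by simp
          then show False using neq by simp
        qed
        then have up': "lev w < lev (f ?w')" using lev_ge[OF w'(1,2)] by simp
        have "len ?w' < len (f w)" using lenX[OF w'(1) fX(1)[OF w]] w'(2) up by simp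
        moreover have "f w \<noteq> f ?w'" using fX(3)[OF w] fX(3)[OF w'(1)] w'(3) by metis
        ultimately have "len (f ?w') < len (f (f w))" using fmono[OF w'(1) fX(1)[OF w]] by blast
        then have "len (f ?w') < len w" using fX(3)[OF w] by simp
        moreover have "len w < len (f ?w')" using lenX[OF w fX(1)[OF w'(1)] up'] .
        ultimately show False by simp
      qed
    qed
    then show ?thesis using f unfolding good_def by (intro extensionalityI[of _ X]) (auto simp: PiE_def)
  qed
  have "flip u v = (THE f. good f)" unfolding flip_def good_def X_def ..
  also have "\<dots> = restrict star X" using good uniq by (rule the_equality)
  finally have "flip u v = restrict star X" .
  moreover have "x \<in> X" unfolding X_def using assms midpoints_iff[OF c(1,3)] by blast
  ultimately show ?thesis by simp
qed

section \<open>Reversal of a block and its effect at one vertex\<close>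

abbreviation block :: "'a list" where
  "block \<equiv> map (cj a) (alts p q)"

lemma rev_block: "rev block = map (cj a) (alts q p)"
  by (simp add: rev_map rev_alts)

text \<open>The two elements on a level have dihedral factors beginning with \<open>p\<close> and
  with \<open>q\<close>, whose inversions are cut off from opposite ends of the chain; which of them
  is \<open>x\<close> stays open.\<close>

lemma inversions_star:
  assumes "x \<in> carrier G" "0 < lev x" "lev x < m"
  shows "inversions x \<inter> D = set (take (lev x) block) \<and> inversions (star x) \<inter> D = set (take (lev x) (rev block)) \<or>
    inversions x \<inter> D = set (take (lev x) (rev block)) \<and> inversions (star x) \<inter> D = set (take (lev x) block)"
proof -
  let ?k = "lev x"
  obtain z where z: "lmin z"
    and mem: "\<forall>y\<in>carrier G. y \<otimes> inv x \<in> D \<longleftrightarrow> (\<exists>k\<le>m. y = a \<otimes> (aw p q k \<otimes> z) \<or> y = a \<otimes> (aw q p k \<otimes> z))"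
    and lv: "\<forall>k\<le>m. lev (a \<otimes> (aw p q k \<otimes> z)) = k \<and> lev (a \<otimes> (aw q p k \<otimes> z)) = k"
    by (rule coset_levels[OF assms(1)])
  let ?P = "a \<otimes> (aw p q ?k \<otimes> z)" and ?Q = "a \<otimes> (aw q p ?k \<otimes> z)"
  have c: "?P \<in> carrier G" "?Q \<in> carrier G" using z swap.aw_closed by auto
  have ne: "?P \<noteq> ?Q" using aw_neq[OF assms(2,3)] z swap.aw_closed by auto
  have km: "?k \<le> m" using assms(3) by simp
  have in_coset: "?P \<otimes> inv x \<in> D" "?Q \<otimes> inv x \<in> D" using mem c km by blast+
  have lev: "lev ?P = ?k" "lev ?Q = ?k" using lv km by auto
  obtain k where k: "k \<le> m" "x = a \<otimes> (aw p q k \<otimes> z) \<or> x = a \<otimes> (aw q p k \<otimes> z)"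
    using mem assms(1) coset_refl[OF assms(1)] by blast
  then have "k = ?k" using lv by metis
  then have xPQ: "x = ?P \<or> x = ?Q" using k by simp
  have dihs: "aw p q ?k \<in> dih p q" "aw q p ?k \<in> dih p q"
    using km aw_in_dih swap.aw_in_dih by (auto simp: dih_swap ord_swap)
  have P: "inversions ?P \<inter> D = set (take ?k block)"
    unfolding inversions_repr[OF dihs(1) z] inversions_aw[OF km]
    using km by (simp add: alts_def take_map take_upt image_image atLeast0LessThan)
  have Q: "inversions ?Q \<inter> D = set (take ?k (rev block))"
    unfolding inversions_repr[OF dihs(2) z] rev_block
    using km swap.inversions_aw[of ?k] by (simp add: alts_def take_map take_upt image_image atLeast0LessThan ord_swap)
  from xPQ show ?thesis
  proof
    assume x: "x = ?P"
    have "?Q \<noteq> x" using ne x by metis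
    then have "?Q = star x" using star_unique[OF assms c(2) in_coset(2) _ lev(2)] by blast
    then show ?thesis using P Q x by metis
  next
    assume x: "x = ?Q"
    have "?P \<noteq> x" using ne x by metis
    then have "?P = star x" using star_unique[OF assms c(1) in_coset(1) _ lev(1)] by blast
    then show ?thesis using P Q x by metis
  qed
qed

lemma set_block: "set block = D \<inter> reflections"
  by (rule set_map_alts) simp

lemma distinct_block: "distinct block"
  by (rule distinct_map_alts) simp

text \<open>An initial segment of a list precedes the remaining entries. If \<open>x\<close> belongs
  to the start of the block, both comparisons hold; if it belongs to the end, both are reversed and
  fail by antisymmetry, the reflections compared being distinct.\<close>

lemma block_order_star:
  assumes "x \<in> carrier G" "0 < lev x" "lev x < m"
    and "t \<in> inversions x \<inter> D" "t' \<in> reflections \<inter> D - inversions x"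
    and "s \<in> inversions (star x) \<inter> D" "s' \<in> reflections \<inter> D - inversions (star x)"
  shows "(t, t') \<in> list_rel block \<longleftrightarrow> (s, s') \<in> list_rel (rev block)"
proof -
  have mem: "t \<in> set block" "t' \<in> set block" "s \<in> set block" "s' \<in> set block"
    unfolding set_block using assms(4-) inversions_reflections by blast+
  have ne: "t \<noteq> t'" "s \<noteq> s'" using assms(4-) by blast+
  have after: "(y, y') \<in> list_rel L"
    if "N \<inter> D = set (take k L)" "y \<in> N \<inter> D" "y' \<in> D - N" "y' \<in> set L" for N k L y y'
    using that by (intro list_rel_take_drop[of _ k]) auto
  from inversions_star[OF assms(1-3)] show ?thesis
  proof (elim disjE conjE)
    assume N: "inversions x \<inter> D = set (take (lev x) block)"
      "inversions (star x) \<inter> D = set (take (lev x) (rev block))"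
    have "(t, t') \<in> list_rel block" using after[OF N(1), of t t'] assms(4,5) mem by blast
    moreover have "(s, s') \<in> list_rel (rev block)"
      using after[OF N(2), of s s'] assms(6,7) mem unfolding set_rev by blast
    ultimately show ?thesis by blast
  next
    assume N: "inversions x \<inter> D = set (take (lev x) (rev block))"
      "inversions (star x) \<inter> D = set (take (lev x) block)"
    have "(t, t') \<in> list_rel (rev block)"
      using after[OF N(1), of t t'] assms(4,5) mem unfolding set_rev by blast
    then have "(t, t') \<notin> list_rel block"
      using antisym_list_rel[OF distinct_block] ne(1) unfolding list_rel_rev by blast
    moreover have "(s, s') \<in> list_rel block" using after[OF N(2), of s s'] assms(6,7) mem by blast
    then have "(s, s') \<notin> list_rel (rev block)"
      using antisym_list_rel[OF distinct_block] ne(2) unfolding list_rel_rev by blast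
    ultimately show ?thesis by blast
  qed
qed

section \<open>Simultaneous flips along a path\<close>

definition inner :: "'a list \<Rightarrow> nat \<Rightarrow> bool" where
  "inner w i \<longleftrightarrow> 0 < i \<and> Suc i < length w \<and> w ! i \<otimes> inv (w ! (i - 1)) \<in> D \<and> w ! Suc i \<otimes> inv (w ! i) \<in> D"

text \<open>Whether a vertex moves is decided on the original path \<open>w\<close>; the bound
  \<open>n\<close> serves to build the simultaneous move from single flips.\<close>

definition star_upto :: "nat \<Rightarrow> 'a list \<Rightarrow> 'a list" where
  "star_upto n w = map (\<lambda>i. if i < n \<and> inner w i then star (w ! i) else w ! i) [0..<length w]"

abbreviation star_path :: "'a list \<Rightarrow> 'a list" where
  "star_path w \<equiv> star_upto (length w) w"

lemma length_star_upto [simp]: "length (star_upto n w) = length w"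
  by (simp add: star_upto_def)

lemma nth_star_upto:
  "i < length w \<Longrightarrow> star_upto n w ! i = (if i < n \<and> inner w i then star (w ! i) else w ! i)"
  by (simp add: star_upto_def)

lemma inner_lev:
  assumes "w \<in> paths h u v" "inner w i"
  shows "w ! i \<in> carrier G" "0 < lev (w ! i)" "lev (w ! i) < m"
proof -
  obtain j where j: "i = Suc j" using assms(2) by (cases i) (auto simp: inner_def)
  have h: "Suc j < h" using assms pathsD(1)[OF assms(1)] j by (simp add: inner_def)
  have c: "w ! j \<in> carrier G" "w ! i \<in> carrier G" "w ! Suc i \<in> carrier G"
    using pathsD(2)[OF assms(1)] h j by auto
  have "lev (w ! j) < lev (w ! i)"
    using edge_iff[OF c(1,2)] pathsD(3)[OF assms(1), of j] h assms(2) j by (simp add: inner_def)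
  moreover have "lev (w ! i) < lev (w ! Suc i)"
    using edge_iff[OF c(2,3)] pathsD(3)[OF assms(1), of i] h assms(2) j by (simp add: inner_def)
  ultimately show "w ! i \<in> carrier G" "0 < lev (w ! i)" "lev (w ! i) < m"
    using c lev_le[OF c(3)] by auto
qed

lemma star_upto_coset:
  assumes "w \<in> paths h u v" "i \<le> h"
  shows "star_upto n w ! i \<in> carrier G" "star_upto n w ! i \<otimes> inv (w ! i) \<in> D"
proof -
  have "w ! i \<in> carrier G" "i < length w" using pathsD[OF assms(1)] assms(2) by auto
  then show "star_upto n w ! i \<in> carrier G" "star_upto n w ! i \<otimes> inv (w ! i) \<in> D"
    using star(1,2)[OF inner_lev[OF assms(1), of i]] coset_refl by (auto simp: nth_star_upto)
qed

text \<open>The flips are performed in the order of the vertices. When vertex \<open>n\<close> is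
  due, it and its successor are still those of \<open>w\<close>, and its predecessor has moved at
  most within its coset. So both labels at \<open>n\<close> lie in \<open>D\<close>, and
  \<open>flip_eq_star\<close> describes the flip.\<close>

lemma star_upto_closed:
  assumes "F \<subseteq> paths h u v" "flip_closed h F" "w \<in> F"
  shows "star_upto n w \<in> F"
proof (induction n)
  case 0
  have "star_upto 0 w = w" unfolding star_upto_def by (simp add: map_nth)
  then show ?case using assms by simp
next
  case (Suc n)
  let ?w = "star_upto n w"
  have w: "w \<in> paths h u v" "?w \<in> paths h u v" using assms Suc by auto
  show ?case
  proof (cases "inner w n")
    case False
    then have "star_upto (Suc n) w = ?w"
      unfolding star_upto_def by (auto simp: less_Suc_eq)
    then show ?thesis using Suc by simp
  next
    case True
    obtain j where j: "n = Suc j" using True by (cases n) (auto simp: inner_def)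
    have h: "n < h" using True pathsD(1)[OF w(1)] by (simp add: inner_def)
    have len: "length w = Suc h" using pathsD(1)[OF w(1)] .
    have at: "?w ! n = w ! n" "?w ! Suc n = w ! Suc n" using h len by (auto simp: nth_star_upto)
    have c: "w ! j \<in> carrier G" "w ! n \<in> carrier G" using pathsD(2)[OF w(1)] h j by auto
    have jc: "?w ! j \<in> carrier G" "?w ! j \<otimes> inv (w ! j) \<in> D"
      using star_upto_coset[OF w(1), of j n] h j by auto
    have "w ! n \<otimes> inv (w ! j) \<in> D" using True j by (simp add: inner_def)
    then have D1: "?w ! n \<otimes> inv (?w ! j) \<in> D"
      unfolding at using coset_trans[OF jc(1) c(1,2) coset_sym[OF c(1) jc]] by blast
    have D2: "?w ! Suc n \<otimes> inv (?w ! n) \<in> D" unfolding at using True by (simp add: inner_def)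
    have "flip (?w ! j) (?w ! Suc n) (?w ! n) = star (?w ! n)"
      using flip_eq_star[OF _ _ D1 D2] pathsD(3)[OF w(2), of j] pathsD(3)[OF w(2), of n] h j by simp
    then have "path_flip n ?w = ?w[n := star (w ! n)]"
      unfolding path_flip_def at(1) using j by (simp add: at(1))
    also have "\<dots> = star_upto (Suc n) w"
    proof (rule nth_equalityI)
      fix i assume "i < length (?w[n := star (w ! n)])"
      then show "?w[n := star (w ! n)] ! i = star_upto (Suc n) w ! i"
        using True by (cases "i = n") (auto simp: nth_star_upto nth_list_update less_Suc_eq)
    qed simp
    finally show ?thesis
      using assms(2) Suc h j unfolding flip_closed_def by (metis Suc_le_eq One_nat_def zero_less_Suc)
  qed
qed

text \<open>Vertices move only within their cosets, which preserves membership of labels in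
  \<open>D\<close>. A label outside \<open>D\<close> prevents both of its ends from being inner, so
  neither of them moves.\<close>

lemma star_path_label:
  assumes "w \<in> paths h u v" "i < h"
  defines "t \<equiv> w ! Suc i \<otimes> inv (w ! i)"
    and "t' \<equiv> star_path w ! Suc i \<otimes> inv (star_path w ! i)"
  shows "t \<in> D \<longleftrightarrow> t' \<in> D" and "t \<notin> D \<Longrightarrow> t' = t"
proof -
  let ?w = "star_path w"
  have len: "length w = Suc h" using pathsD(1)[OF assms(1)] .
  have c: "w ! i \<in> carrier G" "w ! Suc i \<in> carrier G" using pathsD(2)[OF assms(1)] assms(2) by auto
  have s: "?w ! i \<in> carrier G" "?w ! i \<otimes> inv (w ! i) \<in> D"
    "?w ! Suc i \<in> carrier G" "?w ! Suc i \<otimes> inv (w ! Suc i) \<in> D"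
    using star_upto_coset[OF assms(1)] assms(2) by auto
  show eq: "t' = t" if "t \<notin> D"
  proof -
    have "\<not> inner w i" "\<not> inner w (Suc i)" using that by (auto simp: inner_def t_def)
    then show ?thesis using len assms(2) by (simp add: t_def t'_def nth_star_upto)
  qed
  have "t' \<in> D" if "t \<in> D"
    using coset_trans[OF s(1) c(2) s(3) coset_trans[OF s(1) c(1,2) coset_sym[OF c(1) s(1,2)]] s(4)] that
    unfolding t_def t'_def by blast
  then show "t \<in> D \<longleftrightarrow> t' \<in> D" using eq by blast
qed

lemma inner_star_path:
  assumes "w \<in> paths h u v"
  shows "inner (star_path w) i \<longleftrightarrow> inner w i"
proof (cases "0 < i \<and> Suc i < length w")
  case True
  then obtain j where j: "i = Suc j" by (cases i) auto
  have h: "Suc j < h" using True j pathsD(1)[OF assms] by simp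
  show ?thesis
    using star_path_label(1)[OF assms, of j] star_path_label(1)[OF assms, of i] h j
    by (simp add: inner_def)
qed (auto simp: inner_def)

lemma star_path_star_path:
  assumes "w \<in> paths h u v"
  shows "star_path (star_path w) = w"
proof (rule nth_equalityI)
  fix i assume "i < length (star_path (star_path w))"
  then show "star_path (star_path w) ! i = w ! i"
    using star_star[OF inner_lev[OF assms, of i]] by (simp add: nth_star_upto inner_star_path[OF assms])
qed simp

text \<open>By transitivity only consecutive labels are compared. If both lie in \<open>D\<close>,
  the vertex between them moves and \<open>block_order_star\<close> applies; otherwise
  \<open>list_rel_reverse_block\<close> does, as a label in the block stays in the block and any
  other label is unchanged.\<close>

lemma increasing_star_path:
  assumes w: "w \<in> paths h u v" "star_path w \<in> paths h u v"
    and L: "distinct (A @ block @ C)" "set (A @ block @ C) = reflections"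
  shows "increasing (list_rel (A @ block @ C)) w \<longleftrightarrow>
    increasing (list_rel (A @ rev block @ C)) (star_path w)"
proof -
  let ?w = "star_path w"
  have len: "length w = Suc h" using pathsD(1)[OF w(1)] .
  have dist': "distinct (A @ rev block @ C)" using L(1) by auto
  have "(path_labels w ! i, path_labels w ! Suc i) \<in> list_rel (A @ block @ C) \<longleftrightarrow>
      (path_labels ?w ! i, path_labels ?w ! Suc i) \<in> list_rel (A @ rev block @ C)"
    if i: "Suc i < h" for i
  proof -
    let ?t = "\<lambda>i. w ! Suc i \<otimes> inv (w ! i)" and ?s = "\<lambda>i. ?w ! Suc i \<otimes> inv (?w ! i)"
    have lab: "path_labels w ! i = ?t i" "path_labels w ! Suc i = ?t (Suc i)"
      "path_labels ?w ! i = ?s i" "path_labels ?w ! Suc i = ?s (Suc i)"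
      using i len by (simp_all add: nth_path_labels)
    have e: "bruhat_edge (w ! i) (w ! Suc i)" "bruhat_edge (w ! Suc i) (w ! Suc (Suc i))"
      "bruhat_edge (?w ! i) (?w ! Suc i)" "bruhat_edge (?w ! Suc i) (?w ! Suc (Suc i))"
      using pathsD(3)[OF w(1)] pathsD(3)[OF w(2)] i by auto
    note D = star_path_label(1)[OF w(1) Suc_lessD[OF i]] star_path_label(1)[OF w(1) i]
    note D' = star_path_label(2)[OF w(1) Suc_lessD[OF i]] star_path_label(2)[OF w(1) i]
    show ?thesis
    proof (cases "?t i \<in> D \<and> ?t (Suc i) \<in> D")
      case True
      have inn: "inner w (Suc i)" using True i len by (simp add: inner_def)
      have st: "?w ! Suc i = star (w ! Suc i)" using inn i len by (simp add: nth_star_upto)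
      have "(?t i, ?t (Suc i)) \<in> list_rel block \<longleftrightarrow> (?s i, ?s (Suc i)) \<in> list_rel (rev block)"
      proof (rule block_order_star[OF inner_lev[OF w(1) inn]])
        show "?t i \<in> inversions (w ! Suc i) \<inter> D" using True edge_label(2)[OF e(1)] by blast
        show "?t (Suc i) \<in> reflections \<inter> D - inversions (w ! Suc i)"
          using True edge_label(1,3)[OF e(2)] by blast
        show "?s i \<in> inversions (star (w ! Suc i)) \<inter> D"
          using True D edge_label(2)[OF e(3)] unfolding st[symmetric] by blast
        show "?s (Suc i) \<in> reflections \<inter> D - inversions (star (w ! Suc i))"
          using True D edge_label(1,3)[OF e(4)] unfolding st[symmetric] by blast
      qed
      moreover have "?t i \<in> set block" "?t (Suc i) \<in> set block" "?s i \<in> set block" "?s (Suc i) \<in> set block"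
        unfolding set_block using True D edge_label(1)[OF e(1)] edge_label(1)[OF e(2)]
          edge_label(1)[OF e(3)] edge_label(1)[OF e(4)] by blast+
      moreover have "(y, y') \<in> list_rel (A @ B @ C) \<longleftrightarrow> (y, y') \<in> list_rel B"
        if "y \<in> set block" "y' \<in> set block" "set B = set block" for y y' B
      proof -
        have "y \<notin> set A" "y' \<notin> set A" "y \<notin> set C" "y' \<notin> set C" using that L(1) by auto
        then show ?thesis using list_rel_subset[of A] list_rel_subset[of C]
          unfolding list_rel_append by blast
      qed
      ultimately show ?thesis unfolding lab by simp
    next
      case False
      have B: "?t i \<in> set block \<longleftrightarrow> ?t i \<in> D" "?t (Suc i) \<in> set block \<longleftrightarrow> ?t (Suc i) \<in> D"
        "?s i \<in> set block \<longleftrightarrow> ?s i \<in> D" "?s (Suc i) \<in> set block \<longleftrightarrow> ?s (Suc i) \<in> D"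
        unfolding set_block using edge_label(1)[OF e(1)] edge_label(1)[OF e(2)]
          edge_label(1)[OF e(3)] edge_label(1)[OF e(4)] by blast+
      show ?thesis
        unfolding lab
      proof (rule list_rel_reverse_block[OF L(1)])
        show "?t i \<in> set (A @ block @ C)" "?t (Suc i) \<in> set (A @ block @ C)"
          unfolding L(2) using edge_label(1)[OF e(1)] edge_label(1)[OF e(2)] by blast+
        show "?t i \<in> set block \<longleftrightarrow> ?s i \<in> set block" "?t (Suc i) \<in> set block \<longleftrightarrow> ?s (Suc i) \<in> set block"
          unfolding B using D by simp_all
        show "?t i \<notin> set block \<Longrightarrow> ?s i = ?t i" "?t (Suc i) \<notin> set block \<Longrightarrow> ?s (Suc i) = ?t (Suc i)"
          unfolding B using D' by simp_all
        show "\<not> (?t i \<in> set block \<and> ?t (Suc i) \<in> set block)" unfolding B by (rule False)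
      qed
    qed
  qed
  then show ?thesis
    unfolding increasing_list_rel_iff[OF L(1)] increasing_list_rel_iff[OF dist'] using len by simp
qed

lemma card_increasing_reverse_block:
  assumes "F \<subseteq> paths h u v" "flip_closed h F"
    and "distinct (A @ block @ C)" "set (A @ block @ C) = reflections"
  shows "card {w \<in> F. increasing (list_rel (A @ block @ C)) w} =
    card {w \<in> F. increasing (list_rel (A @ rev block @ C)) w}"
proof (rule bij_betw_same_card)
  have closed: "star_path w \<in> F" if "w \<in> F" for w using star_upto_closed[OF assms(1,2) that] .
  have inc: "increasing (list_rel (A @ block @ C)) w \<longleftrightarrow>
      increasing (list_rel (A @ rev block @ C)) (star_path w)" if "w \<in> F" for w
    using increasing_star_path[OF _ _ assms(3,4)] that closed assms(1) by blast
  have invol: "star_path (star_path w) = w" if "w \<in> F" for w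
    using star_path_star_path that assms(1) by blast
  show "bij_betw star_path {w \<in> F. increasing (list_rel (A @ block @ C)) w}
      {w \<in> F. increasing (list_rel (A @ rev block @ C)) w}"
  proof (rule bij_betw_byWitness[where f' = star_path])
    show "star_path ` {w \<in> F. increasing (list_rel (A @ rev block @ C)) w}
        \<subseteq> {w \<in> F. increasing (list_rel (A @ block @ C)) w}"
    proof clarify
      fix w assume w: "w \<in> F" "increasing (list_rel (A @ rev block @ C)) w"
      then show "star_path w \<in> F \<and> increasing (list_rel (A @ block @ C)) (star_path w)"
        using closed inc[of "star_path w"] invol[OF w(1)] by simp
    qed
  qed (use closed inc invol in auto)
qed

end

theorem (in finite_coxeter_system) card_increasing_invariant:
  assumes F: "F \<subseteq> paths h u v" "flip_closed h F"
    and R: "reflection_ordering R" "reflection_ordering R'"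
  shows "card {w \<in> F. increasing R w} = card {w \<in> F. increasing R' w}"
proof -
  \<comment> \<open>The value 0 is a filler for words whose sequence misses a reflection. A braid
    move only permutes the sequence, so both of its sides fall into the same case.\<close>
  define f where "f ws = (if set (refl_seq ws) = reflections
      then card {w \<in> F. increasing (list_rel (refl_seq ws)) w} else 0)" for ws
  have word: "\<exists>ws\<in>lists S. distinct (refl_seq ws) \<and> set (refl_seq ws) = reflections \<and> R = list_rel (refl_seq ws)"
    if ro: "reflection_ordering R" for R
  proof -
    obtain L where L: "refl_order_list L" "R = list_rel L" by (rule reflection_ordering_list[OF ro])
    obtain ws where "ws \<in> lists S" "refl_seq ws = take (length L) L"
      by (rule refl_order_list_word[OF L(1) order.refl])
    then show ?thesis using L by (intro bexI[of _ ws]) (auto simp: refl_order_list_def)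
  qed
  have braid: "f (us @ altw p q (ord (p \<otimes> q)) @ vs) = f (us @ altw q p (ord (p \<otimes> q)) @ vs)"
    if S: "us \<in> lists S" "vs \<in> lists S" and pq: "p \<in> S" "q \<in> S" "p \<noteq> q"
      and dist: "distinct (refl_seq (us @ altw p q (ord (p \<otimes> q)) @ vs))" for us p q vs
  proof -
    interpret dihedral G S p q using pq by (rule dihedralI)
    define a where "a = wprod us"
    have Lu: "us \<in> lists (carrier G)" and Lv: "vs \<in> lists (carrier G)" using S S_lists by auto
    have Lw: "altw p q m \<in> lists (carrier G)" "altw q p m \<in> lists (carrier G)"
      using altw_lists[of p q m] altw_lists[of q p m] S_lists by auto
    have a: "a \<in> carrier G" unfolding a_def using Lu by simp
    let ?C = "map (cj (a \<otimes> aw p q m)) (refl_seq vs)"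
    have alts: "refl_seq (altw p q m) = alts p q" "refl_seq (altw q p m) = alts q p"
      by (simp_all add: refl_seq_altw alts_def ord_swap)
    have aw: "wprod (altw p q m) = aw p q m" "wprod (altw q p m) = aw p q m"
      using aw_m by (simp_all add: aw_def)
    have C: "map (cj a) (map (cj (aw p q m)) (refl_seq vs)) = ?C"
      using refl_seq_closed[OF Lv] a by (intro map_cj_map_cj) auto
    have seq1: "refl_seq (us @ altw p q m @ vs) = refl_seq us @ map (cj a) (alts p q) @ ?C"
      using Lu Lv Lw C by (simp add: refl_seq_append alts aw a_def del: map_map)
    have seq2: "refl_seq (us @ altw q p m @ vs) = refl_seq us @ map (cj a) (alts q p) @ ?C"
      using Lu Lv Lw C by (simp add: refl_seq_append alts aw a_def del: map_map)
    \<comment> \<open>An inversion of \<open>inv a\<close> inside the subgroup would yield a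
      reflection occurring both in the sequence of \<open>us\<close> and in the block, against
      distinctness.\<close>
    have "lmin (inv a)"
    proof -
      have "t \<notin> inversions (inv a)" if t: "t \<in> dih p q" for t
      proof
        assume ti: "t \<in> inversions (inv a)"
        then have "t \<in> set (alts p q)" using t inversions_reflections set_alts by blast
        then have "cj a t \<in> set (map (cj a) (alts p q) @ ?C)" by simp
        moreover have "cj a t \<in> inversions a" using ti inversions_inv[OF a, of t] t dih_closed by simp
        then have "cj a t \<in> set (refl_seq us)"
          using inversions_wprod_distinct[OF S(1)] dist unfolding seq1 a_def by simp
        moreover have "set (refl_seq us) \<inter> set (map (cj a) (alts p q) @ ?C) = {}"
          using dist unfolding seq1 distinct_append by (elim conjE)
        ultimately show False by (meson disjoint_iff)
      qed
      then show ?thesis unfolding lmin_def using a by auto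
    qed
    then interpret dihedral_coset G S p q a using a by unfold_locales
    have seq2': "refl_seq (us @ altw q p m @ vs) = refl_seq us @ rev block @ ?C"
      unfolding seq2 rev_block ..
    show ?thesis
    proof (cases "set (refl_seq us @ block @ ?C) = reflections")
      case True
      then have "set (refl_seq us @ rev block @ ?C) = reflections" by simp
      then show ?thesis
        unfolding f_def seq1 seq2'
        using True card_increasing_reverse_block[OF F dist[unfolded seq1] True] by simp
    next
      case False
      then have "set (refl_seq us @ rev block @ ?C) \<noteq> reflections" by simp
      then show ?thesis unfolding f_def seq1 seq2' using False by simp
    qed
  qed
  obtain ws where ws: "ws \<in> lists S" "distinct (refl_seq ws)" "set (refl_seq ws) = reflections"
    "R = list_rel (refl_seq ws)" using word[OF R(1)] by blast
  obtain ws' where ws': "ws' \<in> lists S" "distinct (refl_seq ws')" "set (refl_seq ws') = reflections"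
    "R' = list_rel (refl_seq ws')" using word[OF R(2)] by blast
  \<comment> \<open>Both words represent the element that has every reflection as an inversion, the
    longest one.\<close>
  have "wprod ws = wprod ws'"
  proof (rule inversions_inj)
    show "wprod ws \<in> carrier G" "wprod ws' \<in> carrier G" using ws ws' S_lists by simp_all
    show "inversions (wprod ws) = inversions (wprod ws')"
      using inversions_wprod_distinct[OF ws(1,2)] inversions_wprod_distinct[OF ws'(1,2)] ws(3) ws'(3) by simp
  qed
  then have "f ([] @ ws) = f ([] @ ws')"
    using ws ws' by (intro braid_invariant_imp_constant[of f, OF braid]) auto
  then show ?thesis using ws ws' by (simp add: f_def)
qed

theorem theorem5p1:
  fixes G :: "('a, 'b) monoid_scheme" and S :: "'a set"
    and h :: nat and u v :: 'a and F :: "'a list set" and R R' :: "('a \<times> 'a) set"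
  assumes "coxeter_system G S"
    and "finite (carrier G)"
    and "coxeter_system.flipclass G S h u v F"
    and "coxeter_system.reflection_ordering G S R"
    and "coxeter_system.reflection_ordering G S R'"
  shows "card {p \<in> F. coxeter_system.increasing G R p} =
         card {p \<in> F. coxeter_system.increasing G R' p}"
proof -
  interpret coxeter_system G S by (rule assms(1))
  interpret finite_coxeter_system G S by unfold_locales (rule assms(2))
  have "F \<subseteq> paths h u v" "flip_closed h F" using assms(3) by (auto simp: flipclass_def)
  then show ?thesis using assms(4,5) by (rule card_increasing_invariant)
qed

end
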